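(* Let $k\ge0$ and $c>0$ be fixed, and for each $n$ let $X_n$ be a homogeneous and spatially independent random subcomplex of $\triangle_n$ with $n^{k+1}q_k\to\infty$ and $nr_k\sim c$. Then there exists a deterministic Borel probability measure $\mu$ on $\mathbb{R}$ such that for every open set $U$ of the space $\mathcal{P}_{\mathbb{R}}$ of Borel probability measures on $\mathbb{R}$ (with the topology of weak convergence) with $\mu\in U$, \[ \lim_{n\to\infty}\mathbb{P}\bigl(\mu_{L_k^{\mathrm{up}}(X_n)}\in U\ \big|\ \dim X_n\ge k\bigr)=1, \] i.e. the empirical spectral distribution of $L_k^{\mathrm{up}}(X_n)$ under $\mathbb{P}(\cdot\mid\dim X_n\ge k)$ converges weakly to $\mu$ in distribution.
   Context: $\triangle_n=2^{[n]}$, subcomplexes (families $Y\subset2^{[n]}$ closed under subsets), random subcomplexes, homogeneity ($X$ and $gX$ equal in law for all permutations $g$ of $[n]$), spatial independence ($\mathbb{P}(Y_1\cup Y_2\subset X)\mathbb{P}(Y_1\cap Y_2\subset X)=\mathbb{P}(Y_1\subset X)\mathbb{P}(Y_2\subset X)$ for all subcomplexes $Y_1,Y_2$), and $q_k=\mathbb{P}(\tau\in X)$, $r_k=\mathbb{P}(\sigma\in X\mid\tau\in X)$ (or $0$ if $q_k=0$) for $k$-simplex $\tau\subset(k+1)$-simplex $\sigma$, are as usual; $\dim X$ is the maximal dimension of a simplex of $X$. For a finite simplicial complex $X$ and $k\ge0$: $C^k(X)$ is the real vector space of alternating functions on ordered $k$-simplices $(v_0,\dots,v_k)$, with inner product $(\varphi,\psi)_k=\frac{1}{(k+1)!}\sum_{\sigma}\varphi(\sigma)\psi(\sigma)$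 over ordered $k$-simplices; $d_k:C^k\to C^{k+1}$ is $d_k\varphi(v_0,\dots,v_{k+1})=\sum_{i}(-1)^i\varphi(v_0,\dots,\hat v_i,\dots,v_{k+1})$; the up Laplacian is $L_k^{\mathrm{up}}(X)=d_k^*d_k$, the adjoint taken with respect to $(\cdot,\cdot)_k$ and $(\cdot,\cdot)_{k+1}$. Its empirical spectral distribution is $\mu_{L_k^{\mathrm{up}}(X)}=\frac{1}{f_k(X)}\sum_{i=1}^{f_k(X)}\delta_{\lambda_i}$ over its eigenvalues $\lambda_i$ with multiplicity, $f_k(X)$ being the number of $k$-simplices. *)

theory Defs
  imports "HOL-Probability.Probability" "Jordan_Normal_Form.Char_Poly"
begin

definition subcomplex :: "nat \<Rightarrow> nat set set \<Rightarrow> bool" where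
  "subcomplex n Y \<longleftrightarrow> Y \<subseteq> Pow {0..<n} \<and> (\<forall>\<sigma>\<in>Y. \<forall>\<tau>. \<tau> \<subseteq> \<sigma> \<longrightarrow> \<tau> \<in> Y)"

definition cdim :: "nat set set \<Rightarrow> int" where
  "cdim X = Max (insert (-1) {int (card \<sigma>) - 1 | \<sigma>. \<sigma> \<in> X})"

definition faces :: "nat set set \<Rightarrow> nat \<Rightarrow> nat set set" where
  "faces X k = {\<sigma> \<in> X. card \<sigma> = k + 1}"

definition random_subcomplex :: "nat \<Rightarrow> nat set set pmf \<Rightarrow> bool" where
  "random_subcomplex n P \<longleftrightarrow> (\<forall>Y\<in>set_pmf P. subcomplex n Y)"

definition homogeneous :: "nat \<Rightarrow> nat set set pmf \<Rightarrow> bool" where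
  "homogeneous n P \<longleftrightarrow>
     (\<forall>g. g permutes {0..<n} \<longrightarrow> map_pmf (\<lambda>X. (`) g ` X) P = P)"

definition spatially_independent :: "nat \<Rightarrow> nat set set pmf \<Rightarrow> bool" where
  "spatially_independent n P \<longleftrightarrow>
     (\<forall>Y1 Y2. subcomplex n Y1 \<longrightarrow> subcomplex n Y2 \<longrightarrow>
        measure_pmf.prob P {X. Y1 \<union> Y2 \<subseteq> X} * measure_pmf.prob P {X. Y1 \<inter> Y2 \<subseteq> X}
        = measure_pmf.prob P {X. Y1 \<subseteq> X} * measure_pmf.prob P {X. Y2 \<subseteq> X})"

text \<open>q_k = P(tau \<in> X) for the k-simplex tau = {0..k};
  r_k = P(sigma \<in> X | tau \<in> X) for sigma = {0..k+1} (0 if q_k = 0).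
  By homogeneity these do not depend on the choice of tau \<subseteq> sigma.\<close>
definition qk :: "nat set set pmf \<Rightarrow> nat \<Rightarrow> real" where
  "qk P k = measure_pmf.prob P {X. {0..k} \<in> X}"

definition rk :: "nat set set pmf \<Rightarrow> nat \<Rightarrow> real" where
  "rk P k = (if qk P k = 0 then 0
             else measure_pmf.prob P {X. {0..Suc k} \<in> X \<and> {0..k} \<in> X} / qk P k)"

text \<open>An enumeration of a finite set (any fixed one; spectra do not depend on it).\<close>
definition enum_set :: "'a set \<Rightarrow> 'a list" where
  "enum_set S = (SOME xs. distinct xs \<and> set xs = S)"

text \<open>Incidence sign [eta : sigma] for sigma = eta minus its i-th vertex
  (vertices of eta listed increasingly): (-1)^i; 0 if sigma is not a facet of eta.
  With respect to the orthonormal bases of C^k, C^(k+1) given by the cochains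
  taking value 1 on the increasingly ordered simplex (and 0 on the other simplices),
  d_k has matrix entries D[eta, sigma] = coboundary_sign eta sigma.\<close>
definition coboundary_sign :: "nat set \<Rightarrow> nat set \<Rightarrow> real" where
  "coboundary_sign \<eta> \<sigma> =
     (if \<sigma> \<subseteq> \<eta> \<and> card (\<eta> - \<sigma>) = 1
      then (-1) ^ card {w\<in>\<eta>. w < the_elem (\<eta> - \<sigma>)} else 0)"

definition coboundary_matrix :: "nat set set \<Rightarrow> nat \<Rightarrow> real mat" where
  "coboundary_matrix X k =
     (let S = enum_set (faces X k); T = enum_set (faces X (Suc k))
      in mat (length T) (length S) (\<lambda>(i, j). coboundary_sign (T ! i) (S ! j)))"

text \<open>L_k^up = d_k^* d_k; since the bases are orthonormal, the adjoint is the transpose.\<close>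
definition up_laplacian :: "nat set set \<Rightarrow> nat \<Rightarrow> real mat" where
  "up_laplacian X k = transpose_mat (coboundary_matrix X k) * coboundary_matrix X k"

definition eigenvalue_mset :: "real mat \<Rightarrow> real multiset" where
  "eigenvalue_mset A =
     (\<Sum>x\<in>{x. poly (char_poly A) x = 0}. replicate_mset (order x (char_poly A)) x)"

definition esd :: "real mat \<Rightarrow> real measure" where
  "esd A = distr (measure_pmf (pmf_of_multiset (eigenvalue_mset A))) borel id"

definition borel_prob_measures :: "real measure set" where
  "borel_prob_measures = {M. prob_space M \<and> sets M = sets (borel :: real measure)}"

definition weak_topology :: "real measure topology" where
  "weak_topology = topology_generated_by
     {{M \<in> borel_prob_measures. (\<integral>x. f x \<partial>M) \<in> V} | f V.
        bounded (range f) \<and> continuous_on UNIV f \<and> open (V :: real set)}"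

end

(* The proof is the method of moments. The m-th moment of the empirical spectral distribution of
   L = d^* d is tr(L^m) / f_k, and tr(L^m) is a signed sum over closed walks tau_0, sigma_1, tau_1, ...,
   tau_m = tau_0 alternating between k- and (k+1)-simplices. A walk contributes to the expectation
   through the probability that the complex it spans lies in X. Spatial independence gives the cost of
   extending a complex by one (k+1)-simplex sigma = tau + x: exactly r_k if x is a new vertex, and at
   most alpha = P(sigma) P(tau - u) / P(tau)^2 if the edge {u, x} is missing. As n r_k -> c, a new vertex
   contributes a factor tending to c, while alpha -> 0 because alpha_j = Q(j+2) Q(j) / Q(j+1)^2 decreases
   in j, where Q(j) is the probability of a simplex with j vertices. So E tr(L^m) / (n^(k+1) q_k) converges.
   Walks with disjoint vertex sets are uncorrelated, and pairs sharing a vertex are negligible since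
   n^j Q(j) -> infinity for 1 <= j <= k+1, which gives convergence in probability. Building a walk step by
   step bounds the limiting moments by K D^m m!, which makes them determine the limit: the Taylor expansion
   of t |-> E[X^j exp(itX)] about any point has a fixed radius of convergence, so characteristic functions
   are pinned down in steps of constant length. All of this is done after conditioning on the empty simplex
   being in X, which does not affect probabilities conditional on dim X >= k. *)

theory Submission
  imports Defs "Jordan_Normal_Form.Schur_Decomposition"
begin

text \<open>Two points shape the argument. The limiting moments are not computed: only their
  existence and size are proved, and \<mu> is not constructed from them. It is a weak subsequential
  limit of spectral measures of suitable realisations, which exist because every finite moment
  condition holds with positive probability for some n; uniqueness then does the work of
  identification. Moreover, besides n r_k -> c only n^(k+1) q_k -> infinity is given, and no single
  Q(j) is assumed to converge. Inequalities from log-concavity fill the gap: Q(k+1)^j \<le>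
  Q(j)^(k+1) transfers the divergence to every n^j Q(j), and since Q(i+1) / Q(i) telescopes into
  Q(1) times the first i edge ratios, Q(1) \<alpha>^(k+1) \<le> r_k, so n Q(1) \<alpha>^(k+1) stays
  bounded while n Q(1) diverges. Numerator and denominator of the m-th moment are both divided by
  n^(k+1) q_k; the denominator f_k is the case m = 0, with limit 1 / (k+1)!, so one family of limits
  \<open>A m\<close> covers both.\<close>

section \<open>The method of moments\<close>

text \<open>Up to powers of i, the integrals of x^j exp(i s x) are the derivatives of the
  characteristic function, so this is its Taylor formula around s. The remainder of exp(i t x) is at
  most |t x|^(N+1) / (N+1)! pointwise; the factor exp(i s x) has modulus 1, so the bound does not
  depend on s and can be reused at every base point.\<close>

lemma char_moment_taylor:
  fixes M :: "real measure"
  assumes "real_distribution M" and int: "\<And>j. integrable M (\<lambda>x. x ^ j)"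
  shows "cmod ((CLINT x|M. of_real (x ^ j) * iexp ((s + t) * x))
           - (\<Sum>l\<le>N. (\<i> * of_real t) ^ l / fact l * (CLINT x|M. of_real (x ^ (j + l)) * iexp (s * x))))
         \<le> \<bar>t\<bar> ^ Suc N / fact (Suc N) * (LINT x|M. \<bar>x\<bar> ^ (j + Suc N))"
proof -
  interpret real_distribution M by fact
  have int1: "complex_integrable M (\<lambda>x. of_real (x ^ j) * iexp (u * x))" for j and u :: real
  proof (rule Bochner_Integration.integrable_bound[OF int[of j]])
    show "AE x in M. cmod (complex_of_real (x ^ j) * iexp (u * x)) \<le> norm (x ^ j)"
      by (simp add: norm_mult norm_power power_abs)
  qed simp
  have int2: "integrable M (\<lambda>x. \<bar>x\<bar> ^ m)" for m
    using integrable_norm[OF int[of m]] by (simp add: power_abs)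
  let ?f = "\<lambda>x. of_real (x ^ j) * iexp ((s + t) * x)
     - (\<Sum>l\<le>N. (\<i> * of_real t) ^ l / fact l * (of_real (x ^ (j + l)) * iexp (s * x)))"
  have int3: "complex_integrable M (\<lambda>x. \<Sum>l\<le>N. (\<i> * of_real t) ^ l / fact l * (of_real (x ^ (j + l)) * iexp (s * x)))"
    by (intro Bochner_Integration.integrable_sum integrable_mult_right int1)
  have "(CLINT x|M. of_real (x ^ j) * iexp ((s + t) * x))
           - (\<Sum>l\<le>N. (\<i> * of_real t) ^ l / fact l * (CLINT x|M. of_real (x ^ (j + l)) * iexp (s * x)))
        = (CLINT x|M. ?f x)"
    unfolding Bochner_Integration.integral_diff[OF int1 int3]
    by (subst Bochner_Integration.integral_sum)
      (intro integrable_mult_right int1, simp only: integral_mult_right_zero)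
  also have "cmod \<dots> \<le> (LINT x|M. \<bar>t\<bar> ^ Suc N / fact (Suc N) * \<bar>x\<bar> ^ (j + Suc N))"
  proof (rule Bochner_Integration.integral_norm_bound_integral)
    show "complex_integrable M ?f"
      by (intro Bochner_Integration.integrable_diff int1 int3)
    show "integrable M (\<lambda>x. \<bar>t\<bar> ^ Suc N / fact (Suc N) * \<bar>x\<bar> ^ (j + Suc N))"
      by (intro integrable_mult_right int2)
    fix x assume "x \<in> space M"
    have 1: "iexp ((s + t) * x) = iexp (s * x) * iexp (t * x)"
      by (simp add: exp_add[symmetric] distrib_left distrib_right)
    have 2: "(\<i> * of_real t) ^ l / fact l * (of_real (x ^ (j + l)) * iexp (s * x))
        = of_real (x ^ j) * iexp (s * x) * ((\<i> * of_real (t * x)) ^ l / fact l)" for l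
      by (simp add: power_add power_mult_distrib)
    have "?f x = of_real (x ^ j) * iexp (s * x) * (iexp (t * x) - (\<Sum>l\<le>N. (\<i> * of_real (t * x)) ^ l / fact l))"
      unfolding 1 2 sum_distrib_left[symmetric] by (simp only: right_diff_distrib mult.assoc)
    then have "cmod (?f x) = \<bar>x\<bar> ^ j * cmod (iexp (t * x) - (\<Sum>l\<le>N. (\<i> * of_real (t * x)) ^ l / fact l))"
      by (simp only: norm_mult norm_exp_i_times norm_of_real power_abs mult_1_right)
    also have "\<dots> \<le> \<bar>x\<bar> ^ j * (\<bar>t * x\<bar> ^ Suc N / fact (Suc N))"
      using iexp_approx1[of "t * x" N] by (intro mult_left_mono) auto
    also have "\<dots> = \<bar>t\<bar> ^ Suc N / fact (Suc N) * \<bar>x\<bar> ^ (j + Suc N)"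
      by (simp only: abs_mult power_mult_distrib power_add) simp
    finally show "cmod (?f x) \<le> \<bar>t\<bar> ^ Suc N / fact (Suc N) * \<bar>x\<bar> ^ (j + Suc N)" .
  qed
  finally show ?thesis by simp
qed

text \<open>The binomial coefficient of j + m over j is at most 2^(j+m). This is one of the two
  factors 2 behind the step length 1 / (4D) of \<open>char_moment_step\<close>; the other makes the
  remainder decay geometrically.\<close>

lemma fact_add_le: "fact (j + m) \<le> (2::real) ^ (j + m) * fact j * fact m"
proof -
  have "real ((j + m) choose j) \<le> 2 ^ (j + m)"
    using binomial_le_pow2[of "j + m" j] by (metis of_nat_le_iff of_nat_numeral of_nat_power)
  moreover have "real ((j + m) choose j) = fact (j + m) / (fact j * fact m)"
    using binomial_fact[of j "j + m", where 'a=real] by simp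
  ultimately show ?thesis by (simp add: field_simps)
qed

text \<open>All orders j must vanish at s together, because the expansion of order j at s + t uses
  the orders j + l at s. Two sequences are compared with each other rather than with a limit, so
  neither characteristic function has to converge beforehand.\<close>

lemma char_moment_step:
  fixes \<nu> \<nu>' :: "nat \<Rightarrow> real measure" and a :: "nat \<Rightarrow> real"
  assumes D: "D > 0" and a: "\<And>j. \<bar>a j\<bar> \<le> K * D ^ j * fact j"
    and rd: "\<And>n. real_distribution (\<nu> n)" "\<And>n. real_distribution (\<nu>' n)"
    and int: "\<And>n j. integrable (\<nu> n) (\<lambda>x. x ^ j)" "\<And>n j. integrable (\<nu>' n) (\<lambda>x. x ^ j)"
    and lim: "\<And>j. (\<lambda>n. LINT x|\<nu> n. x ^ j) \<longlonglongrightarrow> a j" "\<And>j. (\<lambda>n. LINT x|\<nu>' n. x ^ j) \<longlonglongrightarrow> a j"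
    and s: "\<And>j. (\<lambda>n. (CLINT x|\<nu> n. of_real (x ^ j) * iexp (s * x))
                      - (CLINT x|\<nu>' n. of_real (x ^ j) * iexp (s * x))) \<longlonglongrightarrow> 0"
    and t: "\<bar>t\<bar> * (4 * D) \<le> 1"
  shows "(\<lambda>n. (CLINT x|\<nu> n. of_real (x ^ j) * iexp ((s + t) * x))
              - (CLINT x|\<nu>' n. of_real (x ^ j) * iexp ((s + t) * x))) \<longlonglongrightarrow> 0"
proof (rule LIMSEQ_I)
  fix e :: real assume e: "e > 0"
  define \<Delta> where "\<Delta> u j n = (CLINT x|\<nu> n. of_real (x ^ j) * iexp (u * x))
                      - (CLINT x|\<nu>' n. of_real (x ^ j) * iexp (u * x))" for u :: real and j n
  \<comment> \<open>Dividing the moment bound of order j + N + 1 by (N+1)! leaves C (2D)^(N+1); C is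
    the part that depends on j alone.\<close>
  define C where "C = K * (2 * D) ^ j * fact j"
  have K: "K \<ge> 0" using a[of 0] by (simp add: order_trans[OF abs_ge_zero])
  have C: "C \<ge> 0" using K D by (simp add: C_def)
  have "(\<lambda>N. (2 * C + 1) * (1/2) ^ N) \<longlonglongrightarrow> (2 * C + 1) * 0"
    by (intro tendsto_intros LIMSEQ_realpow_zero) auto
  then obtain N0 where N0: "\<And>N. N \<ge> N0 \<Longrightarrow> \<bar>(2 * C + 1) * (1/2) ^ N\<bar> < e / 2"
    using e LIMSEQ_D[where r="e/2"] by (metis diff_zero half_gt_zero mult_zero_right real_norm_def)
  \<comment> \<open>With this N the order j + N + 1 = 2 (j + N0 + 1) is even, so the absolute moment
    in the remainder is an ordinary moment with a known limit.\<close>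
  define N where "N = j + 2 * N0 + 1"
  have ev: "even (j + Suc N)" by (simp add: N_def)
  have err_lim: "(\<lambda>n. \<bar>t\<bar> ^ Suc N / fact (Suc N) * ((LINT x|\<nu> n. x ^ (j + Suc N)) + (LINT x|\<nu>' n. x ^ (j + Suc N))))
         \<longlonglongrightarrow> \<bar>t\<bar> ^ Suc N / fact (Suc N) * (a (j + Suc N) + a (j + Suc N))"
    by (intro tendsto_intros lim)
  have "\<bar>t\<bar> ^ Suc N / fact (Suc N) * (a (j + Suc N) + a (j + Suc N))
      \<le> \<bar>t\<bar> ^ Suc N / fact (Suc N) * (2 * (K * D ^ (j + Suc N) * (2 ^ (j + Suc N) * fact j * fact (Suc N))))"
  proof (intro mult_left_mono)
    have "a (j + Suc N) \<le> K * D ^ (j + Suc N) * fact (j + Suc N)" using a[of "j + Suc N"] by linarith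
    also have "\<dots> \<le> K * D ^ (j + Suc N) * (2 ^ (j + Suc N) * fact j * fact (Suc N))"
      using K D by (intro mult_left_mono fact_add_le) auto
    finally show "a (j + Suc N) + a (j + Suc N) \<le> 2 * (K * D ^ (j + Suc N) * (2 ^ (j + Suc N) * fact j * fact (Suc N)))" by linarith
  qed simp
  also have "\<dots> = 2 * C * (\<bar>t\<bar> * (2 * D)) ^ Suc N"
    unfolding C_def power_add power_mult_distrib by (simp del: power_Suc fact_Suc)
  also have "\<dots> \<le> 2 * C * (1/2) ^ Suc N"
    using t C D by (intro mult_left_mono power_mono) auto
  also have "\<dots> \<le> (2 * C + 1) * (1/2) ^ Suc N" by (intro mult_right_mono) auto
  also have "\<dots> < e / 2" using N0[of "Suc N"] by (simp add: N_def del: power_Suc)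
  finally have ev1: "\<forall>\<^sub>F n in sequentially. \<bar>t\<bar> ^ Suc N / fact (Suc N) * ((LINT x|\<nu> n. x ^ (j + Suc N)) + (LINT x|\<nu>' n. x ^ (j + Suc N))) < e / 2"
    by (rule order_tendstoD(2)[OF err_lim])
  have "(\<lambda>n. \<Sum>l\<le>N. (\<i> * of_real t) ^ l / fact l * \<Delta> s (j + l) n) \<longlonglongrightarrow> (\<Sum>l\<le>N. (\<i> * of_real t) ^ l / fact l * 0)"
    unfolding \<Delta>_def by (intro tendsto_sum tendsto_mult tendsto_const s)
  then have ev2: "\<forall>\<^sub>F n in sequentially. cmod (\<Sum>l\<le>N. (\<i> * of_real t) ^ l / fact l * \<Delta> s (j + l) n) < e / 2"
    using e by (auto dest!: tendstoD[where e="e/2"])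
  have "\<forall>\<^sub>F n in sequentially. cmod (\<Delta> (s + t) j n) < e"
    using ev1 ev2
  proof eventually_elim
    case (elim n)
    let ?S = "\<lambda>M. \<Sum>l\<le>N. (\<i> * of_real t) ^ l / fact l * (CLINT x|M. of_real (x ^ (j + l)) * iexp (s * x))"
    let ?I = "\<lambda>M. CLINT x|M. of_real (x ^ j) * iexp ((s + t) * x)"
    have abs: "\<bar>x\<bar> ^ (j + Suc N) = x ^ (j + Suc N)" for x :: real
      using ev by (simp only: power_even_abs)
    have "(\<Sum>l\<le>N. (\<i> * of_real t) ^ l / fact l * \<Delta> s (j + l) n) = ?S (\<nu> n) - ?S (\<nu>' n)"
      unfolding \<Delta>_def by (simp only: sum_subtractf right_diff_distrib)
    note diff = this
    have gen: "x - y = (x - u) - (y - v) + (u - v)" for x y u v :: complex by (simp add: algebra_simps)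
    have "cmod (\<Delta> (s + t) j n) = cmod ((?I (\<nu> n) - ?S (\<nu> n)) - (?I (\<nu>' n) - ?S (\<nu>' n))
        + (\<Sum>l\<le>N. (\<i> * of_real t) ^ l / fact l * \<Delta> s (j + l) n))"
      unfolding \<Delta>_def[of "s + t"] diff by (rule arg_cong[OF gen])
    also have "\<dots> \<le> cmod (?I (\<nu> n) - ?S (\<nu> n)) + cmod (?I (\<nu>' n) - ?S (\<nu>' n))
        + cmod (\<Sum>l\<le>N. (\<i> * of_real t) ^ l / fact l * \<Delta> s (j + l) n)"
      by (rule order_trans[OF norm_triangle_ineq]) (rule add_right_mono[OF norm_triangle_ineq4])
    also have "\<dots> < e"
      using char_moment_taylor[OF rd(1) int(1), of n j s t N] char_moment_taylor[OF rd(2) int(2), of n j s t N] elim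
      unfolding abs distrib_left by linarith
    finally show ?case .
  qed
  then show "\<exists>n0. \<forall>n\<ge>n0. cmod (((CLINT x|\<nu> n. of_real (x ^ j) * iexp ((s + t) * x))
              - (CLINT x|\<nu>' n. of_real (x ^ j) * iexp ((s + t) * x))) - 0) < e"
    by (simp add: \<Delta>_def eventually_sequentially)
qed

text \<open>At s = 0 the weighted differences are differences of moments, which tend to 0. From
  there \<open>char_moment_step\<close> is iterated along the multiples of u = t / (m + 1), with m
  so large that |u| 4D \<le> 1.\<close>

lemma char_diff_tendsto_0:
  fixes \<nu> \<nu>' :: "nat \<Rightarrow> real measure" and a :: "nat \<Rightarrow> real"
  assumes D: "D > 0" and a: "\<And>j. \<bar>a j\<bar> \<le> K * D ^ j * fact j"
    and rd: "\<And>n. real_distribution (\<nu> n)" "\<And>n. real_distribution (\<nu>' n)"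
    and int: "\<And>n j. integrable (\<nu> n) (\<lambda>x. x ^ j)" "\<And>n j. integrable (\<nu>' n) (\<lambda>x. x ^ j)"
    and lim: "\<And>j. (\<lambda>n. LINT x|\<nu> n. x ^ j) \<longlonglongrightarrow> a j" "\<And>j. (\<lambda>n. LINT x|\<nu>' n. x ^ j) \<longlonglongrightarrow> a j"
  shows "(\<lambda>n. char (\<nu> n) t - char (\<nu>' n) t) \<longlonglongrightarrow> 0"
proof -
  obtain m :: nat where m: "real m \<ge> \<bar>t\<bar> * (4 * D)" using real_arch_simple by blast
  define u where "u = t / real (Suc m)"
  have u: "\<bar>u\<bar> * (4 * D) \<le> 1" using m by (simp add: u_def field_simps)
  have "\<forall>j. (\<lambda>n. (CLINT x|\<nu> n. of_real (x ^ j) * iexp ((real i * u) * x))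
              - (CLINT x|\<nu>' n. of_real (x ^ j) * iexp ((real i * u) * x))) \<longlonglongrightarrow> 0" for i
  proof (induction i)
    case 0
    have "(\<lambda>n. complex_of_real ((LINT x|\<nu> n. x ^ j) - (LINT x|\<nu>' n. x ^ j))) \<longlonglongrightarrow> of_real (a j - a j)" for j
      by (intro tendsto_intros lim)
    then show ?case by (simp add: of_real_power[symmetric] del: of_real_power)
  next
    case (Suc i)
    have "real i * u + u = real (Suc i) * u" by (simp add: algebra_simps)
    with char_moment_step[OF D a rd int lim Suc[rule_format] u] show ?case by simp
  qed
  from this[of "Suc m", rule_format, of 0] show ?thesis
    by (simp add: u_def char_def)
qed

lemma tight_of_bounded_second_moments:
  fixes \<nu> :: "nat \<Rightarrow> real measure"
  assumes rd: "\<And>n. real_distribution (\<nu> n)"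
    and int: "\<And>n. integrable (\<nu> n) (\<lambda>x. x ^ 2)"
    and bd: "\<And>n. (LINT x|\<nu> n. x ^ 2) \<le> B"
  shows "tight \<nu>"
  unfolding tight_def
proof (intro conjI allI impI rd)
  fix e :: real assume e: "e > 0"
  \<comment> \<open>Chosen so that B / b^2 < e in Markov's inequality for x^2; the summand 1 gives
    strictness and keeps b positive when B = 0.\<close>
  define b where "b = sqrt (\<bar>B\<bar> / e) + 1"
  have b: "b > 0" using e by (simp add: b_def add_nonneg_pos)
  have b2: "B / b ^ 2 < e"
  proof -
    have "\<bar>B\<bar> / e = (sqrt (\<bar>B\<bar> / e)) ^ 2" using e by simp
    also have "\<dots> < b ^ 2" unfolding b_def using e by (intro power_strict_mono) auto
    finally have "\<bar>B\<bar> < e * b ^ 2" using e by (simp add: field_simps)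
    then show ?thesis using b by (simp add: field_simps)
  qed
  have "measure (\<nu> n) {-b<..b} > 1 - e" for n
  proof -
    interpret real_distribution "\<nu> n" by (rule rd)
    have "measure (\<nu> n) {x \<in> space (\<nu> n). x ^ 2 \<ge> b ^ 2} \<le> (LINT x|\<nu> n. x ^ 2) / b ^ 2"
      by (rule integral_Markov_inequality_measure[where A="{}"]) (use b int in auto)
    also have "\<dots> \<le> B / b ^ 2" using bd b by (intro divide_right_mono) auto
    also have "\<dots> < e" by (rule b2)
    finally have 1: "prob {x. x ^ 2 \<ge> b ^ 2} < e" by simp
    have "- {-b<..b} \<subseteq> {x. x ^ 2 \<ge> b ^ 2}"
      using b by (auto simp: abs_le_square_iff[symmetric])
    then have "prob (- {-b<..b}) \<le> prob {x. x ^ 2 \<ge> b ^ 2}"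
      by (intro finite_measure_mono) auto
    moreover have "prob (- {-b<..b}) = 1 - prob {-b<..b}"
      using prob_compl[of "{-b<..b}"] by (simp add: Compl_eq_Diff_UNIV)
    ultimately show ?thesis using 1 by simp
  qed
  then show "\<exists>a b. a < b \<and> (\<forall>n. 1 - e < measure (\<nu> n) {a<..b})"
    using b by (intro exI[of _ "-b"] exI[of _ b]) auto
qed

text \<open>A finite-precision form of moment convergence that concerns a single measure. For a
  random measure it is an event, so convergence of moments in probability can be expressed by its
  probability.\<close>

definition has_moments_near :: "(nat \<Rightarrow> real) \<Rightarrow> nat \<Rightarrow> real \<Rightarrow> real measure \<Rightarrow> bool" where
  "has_moments_near a m \<delta> \<nu> \<longleftrightarrow> real_distribution \<nu> \<and> (\<forall>j. integrable \<nu> (\<lambda>x. x ^ j)) \<and>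
     (\<forall>j\<le>m. \<bar>(LINT x|\<nu>. x ^ j) - a j\<bar> < \<delta>)"

text \<open>The second moments converge, hence are bounded, and tightness yields a weakly convergent
  subsequence. The moment limits are carried along it because \<open>char_diff_tendsto_0\<close>
  takes them in this form.\<close>

lemma has_moments_near_subsequence:
  fixes \<nu> :: "nat \<Rightarrow> real measure"
  assumes nu: "\<And>n. has_moments_near a n (1 / real (Suc n)) (\<nu> n)"
  obtains r M where "strict_mono (r :: nat \<Rightarrow> nat)" "real_distribution M" "weak_conv_m (\<nu> \<circ> r) M"
    "\<And>j. (\<lambda>n. LINT x|(\<nu> \<circ> r) n. x ^ j) \<longlonglongrightarrow> a j"
proof -
  have lim: "(\<lambda>n. LINT x|\<nu> n. x ^ j) \<longlonglongrightarrow> a j" for j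
  proof -
    have "(\<lambda>n. (LINT x|\<nu> n. x ^ j) - a j) \<longlonglongrightarrow> 0"
    proof (rule Lim_null_comparison)
      show "\<forall>\<^sub>F n in sequentially. norm ((LINT x|\<nu> n. x ^ j) - a j) \<le> 1 / real (Suc n)"
        using eventually_ge_at_top[of j]
        by eventually_elim (use nu in \<open>auto simp: has_moments_near_def less_imp_le\<close>)
      show "(\<lambda>n. 1 / real (Suc n)) \<longlonglongrightarrow> 0" by real_asymp
    qed
    then show ?thesis using Lim_null by blast
  qed
  obtain B where B: "\<And>n. \<bar>LINT x|\<nu> n. x ^ 2\<bar> \<le> B"
    using convergent_imp_Bseq[OF convergentI[OF lim[of 2]]] by (auto simp: Bseq_def)
  have "tight \<nu>"
    by (rule tight_of_bounded_second_moments[where B=B])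
      (use nu B in \<open>auto simp: has_moments_near_def intro: order_trans[OF abs_ge_self]\<close>)
  from tight_imp_convergent_subsubsequence[OF this strict_mono_id]
  obtain r M where r: "strict_mono r" "real_distribution M" "weak_conv_m (\<nu> \<circ> r) M" by auto
  have "(\<lambda>n. LINT x|(\<nu> \<circ> r) n. x ^ j) \<longlonglongrightarrow> a j" for j
    using LIMSEQ_subseq_LIMSEQ[OF lim r(1)] by (simp add: comp_def)
  with r show ?thesis by (rule that)
qed

text \<open>Compactness instead of a construction: \<mu> is a weak subsequential limit of measures
  with increasingly accurate moments. If some f and \<epsilon> failed, the counterexamples would
  have a weak subsequential limit \<mu>' as well; comparing characteristic functions gives \<mu> =
  \<mu>', against their integrals of f staying \<epsilon> away. The measure \<mu> is fixed before
  f.\<close>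

lemma moment_method:
  fixes a :: "nat \<Rightarrow> real"
  assumes D: "D > 0" and a: "\<And>j. \<bar>a j\<bar> \<le> K * D ^ j * fact j"
    and ex: "\<And>m \<delta>. \<delta> > 0 \<Longrightarrow> \<exists>\<nu>. has_moments_near a m \<delta> \<nu>"
  obtains \<mu> where "real_distribution \<mu>"
    "\<And>f \<epsilon>. bounded (range f) \<Longrightarrow> continuous_on UNIV f \<Longrightarrow> \<epsilon> > 0 \<Longrightarrow>
       \<exists>m. \<exists>\<delta>>0. \<forall>\<nu>. has_moments_near a m \<delta> \<nu> \<longrightarrow> \<bar>(LINT x|\<nu>. (f x :: real)) - (LINT x|\<mu>. f x)\<bar> < \<epsilon>"
proof -
  have "\<exists>\<nu>. \<forall>n. has_moments_near a n (1 / real (Suc n)) (\<nu> n)"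
    using ex by (intro choice) auto
  then obtain \<nu> where nu: "\<And>n. has_moments_near a n (1 / real (Suc n)) (\<nu> n)" by blast
  obtain r \<mu> where r: "strict_mono r" "real_distribution \<mu>" "weak_conv_m (\<nu> \<circ> r) \<mu>"
    "\<And>j. (\<lambda>n. LINT x|(\<nu> \<circ> r) n. x ^ j) \<longlonglongrightarrow> a j"
    by (rule has_moments_near_subsequence[OF nu]) blast
  show ?thesis
  proof (rule that[OF r(2)], rule ccontr)
    fix f :: "real \<Rightarrow> real" and \<epsilon> :: real
    assume f: "bounded (range f)" "continuous_on UNIV f" and eps: "\<epsilon> > 0"
      and neg: "\<not> (\<exists>m. \<exists>\<delta>>0. \<forall>\<nu>. has_moments_near a m \<delta> \<nu> \<longrightarrow> \<bar>(LINT x|\<nu>. f x) - (LINT x|\<mu>. f x)\<bar> < \<epsilon>)"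
    have "\<exists>\<nu>. \<forall>n. has_moments_near a n (1 / real (Suc n)) (\<nu> n) \<and> \<bar>(LINT x|\<nu> n. f x) - (LINT x|\<mu>. f x)\<bar> \<ge> \<epsilon>"
    proof (intro choice allI)
      fix n
      have "1 / real (Suc n) > 0" by simp
      with neg show "\<exists>\<nu>. has_moments_near a n (1 / real (Suc n)) \<nu> \<and> \<epsilon> \<le> \<bar>(LINT x|\<nu>. f x) - (LINT x|\<mu>. f x)\<bar>"
        by (meson not_le)
    qed
    then obtain \<nu>' where nu': "\<And>n. has_moments_near a n (1 / real (Suc n)) (\<nu>' n)"
      and far: "\<And>n. \<bar>(LINT x|\<nu>' n. f x) - (LINT x|\<mu>. f x)\<bar> \<ge> \<epsilon>" by blast
    obtain r' \<mu>' where r': "strict_mono r'" "real_distribution \<mu>'" "weak_conv_m (\<nu>' \<circ> r') \<mu>'"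
      "\<And>j. (\<lambda>n. LINT x|(\<nu>' \<circ> r') n. x ^ j) \<longlonglongrightarrow> a j"
      by (rule has_moments_near_subsequence[OF nu']) blast
    have rd: "\<And>n. real_distribution ((\<nu> \<circ> r) n)" "\<And>n. real_distribution ((\<nu>' \<circ> r') n)"
      and int: "\<And>n j. integrable ((\<nu> \<circ> r) n) (\<lambda>x. x ^ j)" "\<And>n j. integrable ((\<nu>' \<circ> r') n) (\<lambda>x. x ^ j)"
      using nu nu' by (auto simp: has_moments_near_def)
    have "char \<mu> t - char \<mu>' t = 0" for t
    proof (rule LIMSEQ_unique)
      show "(\<lambda>n. char ((\<nu> \<circ> r) n) t - char ((\<nu>' \<circ> r') n) t) \<longlonglongrightarrow> char \<mu> t - char \<mu>' t"
        by (intro tendsto_diff levy_continuity1 rd r(2,3) r'(2,3))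
      show "(\<lambda>n. char ((\<nu> \<circ> r) n) t - char ((\<nu>' \<circ> r') n) t) \<longlonglongrightarrow> 0"
        by (rule char_diff_tendsto_0[OF D a rd int r(4) r'(4)])
    qed
    then have "\<mu> = \<mu>'" using r(2) r'(2) by (intro Levy_uniqueness) auto
    obtain B where B: "\<And>x. \<bar>f x\<bar> \<le> B" using f(1) by (auto simp: bounded_iff)
    have "(\<lambda>n. LINT x|(\<nu>' \<circ> r') n. f x) \<longlonglongrightarrow> (LINT x|\<mu>'. f x)"
      by (rule weak_conv_imp_integral_bdd_continuous_conv[OF rd(2) r'(2,3), where B=B])
        (use f(2) B in \<open>auto simp: continuous_on_eq_continuous_at\<close>)
    then have "\<forall>\<^sub>F n in sequentially. \<bar>(LINT x|(\<nu>' \<circ> r') n. f x) - (LINT x|\<mu>'. f x)\<bar> < \<epsilon>"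
      using eps by (auto dest: tendstoD simp: dist_real_def)
    then obtain n where "\<bar>(LINT x|(\<nu>' \<circ> r') n. f x) - (LINT x|\<mu>'. f x)\<bar> < \<epsilon>"
      by (auto simp: eventually_sequentially)
    with far[of "r' n"] \<open>\<mu> = \<mu>'\<close> show False by simp
  qed
qed

section \<open>Moments of spectral distributions and closed walks\<close>

definition mat_trace :: "'a::comm_monoid_add mat \<Rightarrow> 'a" where
  "mat_trace A = (\<Sum>i<dim_row A. A $$ (i, i))"

lemma mat_trace_commute:
  fixes A B :: "'a::comm_semiring_0 mat"
  assumes "A \<in> carrier_mat n m" "B \<in> carrier_mat m n"
  shows "mat_trace (A * B) = mat_trace (B * A)"
proof -
  have "mat_trace (A * B) = (\<Sum>i<n. \<Sum>j<m. A $$ (i, j) * B $$ (j, i))"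
    using assms by (auto simp: mat_trace_def scalar_prod_def atLeast0LessThan intro!: sum.cong)
  also have "\<dots> = (\<Sum>j<m. \<Sum>i<n. A $$ (i, j) * B $$ (j, i))" by (rule sum.swap)
  also have "\<dots> = mat_trace (B * A)"
    using assms by (auto simp: mat_trace_def scalar_prod_def atLeast0LessThan mult.commute intro!: sum.cong)
  finally show ?thesis .
qed

lemma mat_trace_similar:
  fixes A :: "'a::comm_ring_1 mat"
  assumes "similar_mat_wit A B P Q"
  shows "mat_trace A = mat_trace B"
proof -
  define n where "n = dim_row A"
  from similar_mat_witD[OF refl assms, folded n_def] have
    *: "A \<in> carrier_mat n n" "B \<in> carrier_mat n n" "P \<in> carrier_mat n n" "Q \<in> carrier_mat n n"
    "Q * P = 1\<^sub>m n" "A = P * B * Q" by auto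
  have "mat_trace A = mat_trace (Q * (P * B))"
    unfolding *(6) by (rule mat_trace_commute[of _ n n]) (use * in auto)
  also have "Q * (P * B) = (Q * P) * B" using * by (intro assoc_mult_mat[symmetric]) auto
  also have "\<dots> = B" unfolding *(5) using *(2) by simp
  finally show ?thesis .
qed

lemma upper_triangular_mult:
  fixes A B :: "'a::semiring_0 mat"
  assumes A: "A \<in> carrier_mat n n" "upper_triangular A"
    and B: "B \<in> carrier_mat n n" "upper_triangular B"
  shows "upper_triangular (A * B)" "i < n \<Longrightarrow> (A * B) $$ (i, i) = A $$ (i, i) * B $$ (i, i)"
proof -
  have AB: "(A * B) $$ (i, j) = (\<Sum>l<n. A $$ (i, l) * B $$ (l, j))" if "i < n" "j < n" for i j
    using A B that by (simp add: scalar_prod_def atLeast0LessThan)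
  have z: "A $$ (i, l) * B $$ (l, j) = 0" if "i < n" "l < n" "l < i \<or> j < l" for i j l
    using that A(1) B(1) upper_triangularD[OF A(2), of l i] upper_triangularD[OF B(2), of j l] by auto
  show "upper_triangular (A * B)"
  proof
    fix i j assume *: "j < i" "i < dim_row (A * B)"
    then have ij: "i < n" "j < n" using A(1) by auto
    have "A $$ (i, l) * B $$ (l, j) = 0" if "l < n" for l
      using that ij * by (intro z) auto
    then show "(A * B) $$ (i, j) = 0" unfolding AB[OF ij] by (intro sum.neutral) auto
  qed
  assume i: "i < n"
  have "(\<Sum>l<n. A $$ (i, l) * B $$ (l, i)) = (\<Sum>l\<in>{i}. A $$ (i, l) * B $$ (l, i))"
    using i by (intro sum.mono_neutral_right) (auto intro!: z)
  then show "(A * B) $$ (i, i) = A $$ (i, i) * B $$ (i, i)" using i by (simp add: AB)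
qed

lemma upper_triangular_pow:
  fixes A :: "'a::comm_semiring_1 mat"
  assumes A: "A \<in> carrier_mat n n" "upper_triangular A"
  shows "upper_triangular (A ^\<^sub>m m) \<and> (\<forall>i<n. (A ^\<^sub>m m) $$ (i, i) = (A $$ (i, i)) ^ m)"
proof (induction m)
  case 0
  then show ?case using A by auto
next
  case (Suc m)
  have "A ^\<^sub>m m \<in> carrier_mat n n" using A by simp
  then show ?case using upper_triangular_mult[of "A ^\<^sub>m m" n A] A Suc
    by (simp add: mult.commute del: index_mult_mat)
qed

text \<open>Schur decomposition gives a triangular matrix similar to A with diagonal
  \<open>es\<close>. Powers respect similarity, the trace is invariant under it, and the diagonal of
  a power of a triangular matrix consists of the powers of its diagonal.\<close>

lemma mat_trace_pow:
  fixes A :: "'a::conjugatable_ordered_field mat"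
  assumes A: "A \<in> carrier_mat n n" and es: "char_poly A = (\<Prod>e\<leftarrow>es. [:- e, 1:])"
  shows "mat_trace (A ^\<^sub>m m) = (\<Sum>e\<leftarrow>es. e ^ m)"
proof -
  obtain B P Q where S: "schur_decomposition A es = (B, P, Q)" by (metis prod_cases3)
  from schur_decomposition[OF A es S]
  have B: "similar_mat_wit A B P Q" "upper_triangular B" "diag_mat B = es" by auto
  have Bn: "B \<in> carrier_mat n n" using B(1) A by (auto simp: similar_mat_wit_def Let_def)
  have "mat_trace (A ^\<^sub>m m) = mat_trace (B ^\<^sub>m m)"
    by (rule mat_trace_similar[OF similar_mat_wit_pow[OF B(1)]])
  also have "\<dots> = (\<Sum>i<n. (B $$ (i, i)) ^ m)"
    using upper_triangular_pow[OF Bn B(2), of m] Bn by (simp add: mat_trace_def)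
  also have "\<dots> = (\<Sum>e\<leftarrow>es. e ^ m)"
    using Bn by (simp add: B(3)[symmetric] diag_mat_def comp_def sum_list_distinct_conv_sum_set atLeast0LessThan)
  finally show ?thesis .
qed

text \<open>For an eigenvector v the sum of conj(v_i) A_ij v_j equals its own conjugate, as A is
  real and symmetric, and it equals a |v|^2 with |v|^2 \<noteq> 0.\<close>

lemma real_symmetric_eigenvalue_real:
  fixes A :: "real mat"
  assumes A: "A \<in> carrier_mat n n" and sym: "transpose_mat A = A"
    and ev: "eigenvalue (map_mat complex_of_real A) a"
  shows "of_real (Re a) = a"
proof -
  let ?B = "map_mat complex_of_real A"
  have S: "A $$ (i, j) = A $$ (j, i)" if "i < n" "j < n" for i j
    using that A sym index_transpose_mat(1)[of i A j] by auto
  from ev obtain v where v: "v \<in> carrier_vec n" "v \<noteq> 0\<^sub>v n" "?B *\<^sub>v v = a \<cdot>\<^sub>v v"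
    using A by (auto simp: eigenvalue_def eigenvector_def)
  have vi: "(\<Sum>j<n. of_real (A $$ (i, j)) * v $ j) = a * v $ i" if "i < n" for i
  proof -
    have "(?B *\<^sub>v v) $ i = (\<Sum>j<n. of_real (A $$ (i, j)) * v $ j)"
      using A v(1) that by (simp add: scalar_prod_def atLeast0LessThan)
    moreover have "(a \<cdot>\<^sub>v v) $ i = a * v $ i" using v(1) that by simp
    ultimately show ?thesis by (simp only: v(3))
  qed
  define x where "x = (\<Sum>i<n. \<Sum>j<n. cnj (v $ i) * of_real (A $$ (i, j)) * v $ j)"
  define s where "s = (\<Sum>i<n. (cmod (v $ i))\<^sup>2)"
  have "x = (\<Sum>i<n. cnj (v $ i) * (\<Sum>j<n. of_real (A $$ (i, j)) * v $ j))"
    by (simp add: x_def sum_distrib_left mult.assoc)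
  also have "\<dots> = (\<Sum>i<n. a * of_real ((cmod (v $ i))\<^sup>2))"
    by (rule sum.cong) (simp_all only: vi lessThan_iff complex_norm_square, simp only: mult_ac)
  finally have xs: "x = a * of_real s" by (simp add: s_def sum_distrib_left)
  have "cnj x = (\<Sum>i<n. \<Sum>j<n. v $ i * of_real (A $$ (i, j)) * cnj (v $ j))"
    by (simp add: x_def)
  also have "\<dots> = (\<Sum>j<n. \<Sum>i<n. v $ i * of_real (A $$ (i, j)) * cnj (v $ j))" by (rule sum.swap)
  also have "\<dots> = x" unfolding x_def
    by (intro sum.cong refl) (auto simp: S mult_ac)
  finally have "cnj x = x" .
  then have "cnj a * of_real s = a * of_real s" by (simp add: xs)
  moreover have "s \<noteq> 0"
  proof
    assume "s = 0"
    then have "\<forall>i<n. v $ i = 0" by (simp add: s_def sum_nonneg_eq_0_iff)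
    then show False using v by auto
  qed
  ultimately have "cnj a = a" by simp
  then show ?thesis by (metis Reals_cnj_iff of_real_Re)
qed

text \<open>Over the complex numbers the polynomial splits, its roots are real by the previous
  lemma, and the embedding of real into complex polynomials is injective, so the factorisation
  descends.\<close>

lemma real_symmetric_char_poly_splits:
  fixes A :: "real mat"
  assumes A: "A \<in> carrier_mat n n" and sym: "transpose_mat A = A"
  obtains es where "char_poly A = (\<Prod>e\<leftarrow>es. [:- e, 1:])" "length es = n"
proof -
  let ?B = "map_mat complex_of_real A"
  have B: "?B \<in> carrier_mat n n" using A by simp
  from char_poly_factorized[OF B] obtain as
    where as: "char_poly ?B = (\<Prod>a\<leftarrow>as. [:- a, 1:])" "length as = n" by blast
  have re: "complex_of_real (Re a) = a" if "a \<in> set as" for a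
    using that by (intro real_symmetric_eigenvalue_real[OF A sym])
      (auto simp: eigenvalue_root_char_poly[OF B] as(1) poly_prod_list prod_list_zero_iff)
  interpret H: map_poly_inj_comm_ring_hom "of_real :: real \<Rightarrow> complex" ..
  have "map_poly complex_of_real (char_poly A) = (\<Prod>a\<leftarrow>as. [:- a, 1:])"
    by (simp add: of_real_hom.char_poly_hom[OF A, symmetric] as(1))
  also have "\<dots> = (\<Prod>a\<leftarrow>as. map_poly complex_of_real [:- Re a, 1:])"
    using re by (intro arg_cong[where f=prod_list] map_cong) auto
  also have "\<dots> = map_poly of_real (\<Prod>a\<leftarrow>as. [:- Re a, 1:])"
    by (simp only: H.hom_prod_list map_map comp_def)
  finally have "char_poly A = (\<Prod>e\<leftarrow>map Re as. [:- e, 1:])" by (simp add: comp_def)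
  then show ?thesis using as(2) by (intro that[of "map Re as"]) auto
qed

text \<open>The order of a product of monic linear factors at y counts the factors with root
  y.\<close>

lemma eigenvalue_mset_eq:
  assumes "char_poly A = (\<Prod>e\<leftarrow>es. [:- e, 1:])"
  shows "eigenvalue_mset A = mset es"
proof (rule multiset_eqI)
  fix y
  have ne: "(\<Prod>e\<leftarrow>es. [:- e, 1:]) \<noteq> (0 :: real poly)" for es by (auto simp: prod_list_zero_iff)
  have ord: "Polynomial.order y (\<Prod>e\<leftarrow>es. [:- e, 1:]) = count (mset es) y" for es :: "real list"
  proof (induction es)
    case (Cons e es)
    have "Polynomial.order y ([:- e, 1:] * (\<Prod>e\<leftarrow>es. [:- e, 1:])) = Polynomial.order y [:- e, 1:] + Polynomial.order y (\<Prod>e\<leftarrow>es. [:- e, 1:])"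
      using ne[of "e # es"] by (intro order_mult) simp
    moreover have "Polynomial.order y [:- e, 1:] = (if e = y then 1 else 0)"
      using order_power_n_n[of e 1] order_0I[of "[:- e, 1:]" y] by auto
    ultimately show ?case using Cons by simp
  qed (simp add: order_1_eq_0)
  have fin: "finite {x. poly (char_poly A) x = 0}" using ne by (simp add: assms poly_roots_finite)
  have "count (eigenvalue_mset A) y
     = (\<Sum>x\<in>{x. poly (char_poly A) x = 0}. if x = y then Polynomial.order x (char_poly A) else 0)"
    unfolding eigenvalue_mset_def count_sum by (intro sum.cong) auto
  also have "\<dots> = Polynomial.order y (char_poly A)"
    using fin by (simp add: order_0I)
  finally show "count (eigenvalue_mset A) y = count (mset es) y" by (simp add: assms ord)
qed

lemma real_distribution_esd: "real_distribution (esd A)"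
  unfolding esd_def real_distribution_def real_distribution_axioms_def
  by (auto intro: measure_pmf.prob_space_distr)

lemma sum_list_eq_sum_count:
  fixes f :: "'a \<Rightarrow> real"
  shows "finite B \<Longrightarrow> set xs \<subseteq> B \<Longrightarrow> (\<Sum>x\<in>B. real (count (mset xs) x) * f x) = (\<Sum>x\<leftarrow>xs. f x)"
proof (induction xs)
  case (Cons y ys)
  have "(\<Sum>x\<in>B. real (count (mset (y # ys)) x) * f x)
      = (\<Sum>x\<in>B. (if x = y then f x else 0) + real (count (mset ys) x) * f x)"
    by (intro sum.cong) (auto simp: algebra_simps)
  also have "\<dots> = f y + (\<Sum>x\<in>B. real (count (mset ys) x) * f x)"
    using Cons.prems by (simp add: sum.distrib)
  finally show ?case using Cons by simp
qed simp

text \<open>With n > 0 the spectrum is nonempty and \<open>pmf_of_multiset\<close> is the uniform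
  choice among the eigenvalues with multiplicity; the integral is then their power sum over n, to
  which \<open>mat_trace_pow\<close> applies.\<close>

lemma esd_moments:
  fixes A :: "real mat"
  assumes A: "A \<in> carrier_mat n n" and sym: "transpose_mat A = A" and n: "n > 0"
  shows "integrable (esd A) (\<lambda>x. x ^ m)" "(LINT x|esd A. x ^ m) = mat_trace (A ^\<^sub>m m) / n"
proof -
  obtain es where es: "char_poly A = (\<Prod>e\<leftarrow>es. [:- e, 1:])" "length es = n"
    by (rule real_symmetric_char_poly_splits[OF A sym])
  have ne: "mset es \<noteq> {#}" using es(2) n by auto
  let ?p = "pmf_of_multiset (mset es)"
  have esd: "esd A = distr (measure_pmf ?p) borel id" by (simp add: esd_def eigenvalue_mset_eq[OF es(1)])
  show "integrable (esd A) (\<lambda>x. x ^ m)" unfolding esd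
    by (subst integrable_distr_eq) (auto intro!: integrable_measure_pmf_finite simp: set_pmf_of_multiset[OF ne])
  have "(LINT x|esd A. x ^ m) = (LINT x|measure_pmf ?p. x ^ m)"
    unfolding esd by (subst integral_distr) auto
  also have "\<dots> = (\<Sum>x\<in>set es. x ^ m * pmf ?p x)"
    by (rule integral_measure_pmf_real) (auto simp: set_pmf_of_multiset[OF ne])
  also have "\<dots> = (\<Sum>x\<in>set es. real (count (mset es) x) * x ^ m) / n"
    by (simp add: pmf_of_multiset[OF ne] es(2) sum_divide_distrib mult.commute)
  also have "\<dots> = (\<Sum>e\<leftarrow>es. e ^ m) / n" by (simp add: sum_list_eq_sum_count)
  finally show "(LINT x|esd A. x ^ m) = mat_trace (A ^\<^sub>m m) / n" by (simp add: mat_trace_pow[OF A es(1)])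
qed

section \<open>Closed walks and the expansion of the trace\<close>

fun walk_valid :: "nat \<Rightarrow> nat set \<Rightarrow> (nat set \<times> nat set) list \<Rightarrow> bool" where
  "walk_valid k \<tau> [] \<longleftrightarrow> card \<tau> = Suc k"
| "walk_valid k \<tau> ((\<sigma>, \<rho>) # ws) \<longleftrightarrow>
     card \<tau> = Suc k \<and> card \<sigma> = Suc (Suc k) \<and> \<tau> \<subseteq> \<sigma> \<and> \<rho> \<subseteq> \<sigma> \<and> walk_valid k \<rho> ws"

fun walk_end :: "nat set \<Rightarrow> (nat set \<times> nat set) list \<Rightarrow> nat set" where
  "walk_end \<tau> [] = \<tau>"
| "walk_end \<tau> ((\<sigma>, \<rho>) # ws) = walk_end \<rho> ws"

fun walk_weight :: "nat set \<Rightarrow> (nat set \<times> nat set) list \<Rightarrow> real" where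
  "walk_weight \<tau> [] = 1"
| "walk_weight \<tau> ((\<sigma>, \<rho>) # ws) = coboundary_sign \<sigma> \<tau> * coboundary_sign \<sigma> \<rho> * walk_weight \<rho> ws"

text \<open>Down-closed on purpose: inclusion of this complex in X is an event to which spatial
  independence applies, and for down-closed X it says that every simplex visited lies in X.\<close>

fun walk_complex :: "nat set \<Rightarrow> (nat set \<times> nat set) list \<Rightarrow> nat set set" where
  "walk_complex \<tau> [] = Pow \<tau>"
| "walk_complex \<tau> ((\<sigma>, \<rho>) # ws) = Pow \<sigma> \<union> walk_complex \<rho> ws"

text \<open>A walk is its initial k-simplex with a list of pairs (\<sigma>, \<rho>): the
  (k+1)-simplex crossed and the k-simplex reached. Validity involves only cardinalities and
  inclusions, so \<rho> may equal the simplex just left; the ambient complex Y enters solely through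
  the spanned complex.\<close>

definition closed_walks :: "nat \<Rightarrow> nat \<Rightarrow> nat set set \<Rightarrow> (nat set \<times> (nat set \<times> nat set) list) set" where
  "closed_walks k m Y = {(\<tau>, ws). length ws = m \<and> walk_valid k \<tau> ws \<and> walk_end \<tau> ws = \<tau> \<and> walk_complex \<tau> ws \<subseteq> Y}"

definition walks_between :: "nat \<Rightarrow> nat \<Rightarrow> nat set set \<Rightarrow> nat set \<Rightarrow> nat set \<Rightarrow> (nat set \<times> nat set) list set" where
  "walks_between k m Y \<tau> \<tau>' = {ws. length ws = m \<and> walk_valid k \<tau> ws \<and> walk_end \<tau> ws = \<tau>' \<and> walk_complex \<tau> ws \<subseteq> Y}"

lemma walk_valid_card: "walk_valid k \<tau> ws \<Longrightarrow> card \<tau> = Suc k"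
  by (cases ws) auto

lemma walk_valid_Pow_subset: "walk_valid k \<tau> ws \<Longrightarrow> Pow \<tau> \<subseteq> walk_complex \<tau> ws"
  by (cases ws) (auto, blast)

lemma walk_steps_subset: "walk_valid k \<tau> ws \<Longrightarrow> walk_complex \<tau> ws \<subseteq> Y \<Longrightarrow> set ws \<subseteq> Y \<times> Y"
proof (induction ws arbitrary: \<tau>)
  case (Cons p ws)
  obtain \<sigma> \<rho> where p: "p = (\<sigma>, \<rho>)" by force
  have "Pow \<rho> \<subseteq> walk_complex \<rho> ws" using Cons.prems p by (auto dest: walk_valid_Pow_subset)
  then show ?case using Cons p by auto
qed simp

lemma finite_walks_between: "finite Y \<Longrightarrow> finite (walks_between k m Y \<tau> \<tau>')"
  by (rule finite_subset[of _ "{ws. set ws \<subseteq> Y \<times> Y \<and> length ws = m}"])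
    (auto simp: walks_between_def finite_lists_length_eq dest!: walk_steps_subset)

lemma finite_closed_walks: assumes "finite Y" shows "finite (closed_walks k m Y)"
proof (rule finite_subset)
  show "closed_walks k m Y \<subseteq> Y \<times> {ws. set ws \<subseteq> Y \<times> Y \<and> length ws = m}"
  proof
    fix p assume "p \<in> closed_walks k m Y"
    then obtain \<tau> ws where p: "p = (\<tau>, ws)" "length ws = m" "walk_valid k \<tau> ws" "walk_complex \<tau> ws \<subseteq> Y"
      by (auto simp: closed_walks_def)
    with walk_valid_Pow_subset[OF p(3)] walk_steps_subset[OF p(3,4)]
    show "p \<in> Y \<times> {ws. set ws \<subseteq> Y \<times> Y \<and> length ws = m}" by auto
  qed
qed (simp add: finite_lists_length_eq assms)

text \<open>The entries of L, indexed by simplices instead of positions in \<open>enum_set\<close>,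
  which frees the walk recursion from the enumeration.\<close>

definition laplacian_kernel :: "nat set set \<Rightarrow> nat \<Rightarrow> nat set \<Rightarrow> nat set \<Rightarrow> real" where
  "laplacian_kernel Y k \<tau> \<rho> = (\<Sum>\<sigma>\<in>faces Y (Suc k). coboundary_sign \<sigma> \<tau> * coboundary_sign \<sigma> \<rho>)"

lemma enum_set: assumes "finite S" shows "distinct (enum_set S)" "set (enum_set S) = S"
  using someI_ex[of "\<lambda>xs. distinct xs \<and> set xs = S"] finite_distinct_list[OF assms]
  unfolding enum_set_def by blast+

lemma sum_nth_enum_set:
  assumes "finite S" shows "(\<Sum>i<length (enum_set S). f (enum_set S ! i)) = (\<Sum>x\<in>S. f x)"
proof -
  have "bij_betw ((!) (enum_set S)) {..<length (enum_set S)} S"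
    using enum_set[OF assms] by (intro bij_betw_nth) auto
  then show ?thesis by (rule sum.reindex_bij_betw)
qed

text \<open>\<open>pow_mat\<close> multiplies on the right, whereas walks are lists extended at the
  front.\<close>

lemma pow_mat_Suc_left:
  assumes L: "L \<in> carrier_mat n n"
  shows "L ^\<^sub>m Suc m = L * L ^\<^sub>m m"
proof (induction m)
  case 0
  show ?case using L by auto
next
  case (Suc m)
  have "L ^\<^sub>m Suc (Suc m) = (L * L ^\<^sub>m m) * L" unfolding pow_mat.simps(2)[of L "Suc m"] Suc ..
  also have "\<dots> = L * (L ^\<^sub>m m * L)"
    by (rule assoc_mult_mat[of _ n n _ n _ n]) (use L in auto)
  finally show ?case by simp
qed

context
  fixes Y :: "nat set set" and k :: nat
  assumes fin: "finite Y" and closed: "\<And>\<sigma> \<tau>. \<sigma> \<in> Y \<Longrightarrow> \<tau> \<subseteq> \<sigma> \<Longrightarrow> \<tau> \<in> Y"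
begin

lemma Pow_subset_complex: "\<sigma> \<in> Y \<Longrightarrow> Pow \<sigma> \<subseteq> Y"
  using closed by blast

lemma finite_faces: "finite (faces Y j)"
  using fin by (simp add: faces_def)

lemma up_laplacian_carrier:
  "up_laplacian Y k \<in> carrier_mat (length (enum_set (faces Y k))) (length (enum_set (faces Y k)))"
  by (auto simp: up_laplacian_def coboundary_matrix_def Let_def)

lemma up_laplacian_symmetric: "transpose_mat (up_laplacian Y k) = up_laplacian Y k"
  unfolding up_laplacian_def
  by (subst transpose_mult[of _ _ "dim_row (coboundary_matrix Y k)"]) auto

lemma up_laplacian_index:
  assumes "i < length (enum_set (faces Y k))" "j < length (enum_set (faces Y k))"
  shows "up_laplacian Y k $$ (i, j) = laplacian_kernel Y k (enum_set (faces Y k) ! i) (enum_set (faces Y k) ! j)"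
  using assms
    sum_nth_enum_set[OF finite_faces, of "\<lambda>\<sigma>. coboundary_sign \<sigma> (enum_set (faces Y k) ! i) * coboundary_sign \<sigma> (enum_set (faces Y k) ! j)" "Suc k"]
  by (simp add: up_laplacian_def coboundary_matrix_def Let_def laplacian_kernel_def scalar_prod_def atLeast0LessThan)

lemma coboundary_sign_nonzeroD:
  "coboundary_sign \<sigma> \<tau> \<noteq> 0 \<Longrightarrow> \<tau> \<subseteq> \<sigma>"
  by (auto simp: coboundary_sign_def split: if_splits)

text \<open>Splitting off the first pair (\<sigma>, \<rho>) of a walk mirrors the recursion L^(m+1)
  = L L^m.\<close>

lemma walks_between_Suc:
  assumes \<tau>: "\<tau> \<in> faces Y k"
  shows "(\<Sum>ws\<in>walks_between k (Suc m) Y \<tau> \<tau>'. walk_weight \<tau> ws)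
    = (\<Sum>\<rho>\<in>faces Y k. laplacian_kernel Y k \<tau> \<rho> * (\<Sum>ws\<in>walks_between k m Y \<rho> \<tau>'. walk_weight \<rho> ws))"
proof -
  define S where "S = {(\<sigma>, \<rho>). \<sigma> \<in> faces Y (Suc k) \<and> \<rho> \<in> faces Y k \<and> \<tau> \<subseteq> \<sigma> \<and> \<rho> \<subseteq> \<sigma>}"
  have S: "S \<subseteq> faces Y (Suc k) \<times> faces Y k" by (auto simp: S_def)
  have finS: "finite S" by (rule finite_subset[OF S]) (simp add: finite_faces)
  have eq: "walks_between k (Suc m) Y \<tau> \<tau>'
      = (\<lambda>(p, ws). p # ws) ` (SIGMA p:S. walks_between k m Y (snd p) \<tau>')" (is "?A = ?B")
  proof (intro equalityI subsetI)
    fix ws assume ws: "ws \<in> ?A"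
    then obtain \<sigma> \<rho> ws' where e: "ws = (\<sigma>, \<rho>) # ws'"
      by (cases ws) (auto simp: walks_between_def)
    have *: "walk_valid k \<rho> ws'" "Pow \<sigma> \<subseteq> Y" "\<rho> \<subseteq> \<sigma>" "\<tau> \<subseteq> \<sigma>" "card \<sigma> = Suc (Suc k)"
      using ws by (auto simp: e walks_between_def)
    then have "\<sigma> \<in> Y" "\<rho> \<in> Y" by auto
    then have "(\<sigma>, \<rho>) \<in> S" using * walk_valid_card[OF *(1)] by (auto simp: S_def faces_def)
    moreover have "ws' \<in> walks_between k m Y \<rho> \<tau>'" using ws by (auto simp: e walks_between_def)
    ultimately show "ws \<in> ?B" unfolding e by force
  next
    fix ws assume "ws \<in> ?B"
    then obtain \<sigma> \<rho> ws' where *: "ws = (\<sigma>, \<rho>) # ws'" "(\<sigma>, \<rho>) \<in> S" "ws' \<in> walks_between k m Y \<rho> \<tau>'"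
      by auto
    then have "Pow \<sigma> \<subseteq> Y" using Pow_subset_complex by (auto simp: S_def faces_def)
    then show "ws \<in> ?A" using * \<tau> by (auto simp: S_def walks_between_def faces_def)
  qed
  have "(\<Sum>ws\<in>?A. walk_weight \<tau> ws)
      = (\<Sum>(p, ws)\<in>(SIGMA p:S. walks_between k m Y (snd p) \<tau>'). walk_weight \<tau> (p # ws))"
    unfolding eq by (subst sum.reindex) (auto simp: inj_on_def case_prod_unfold)
  also have "\<dots> = (\<Sum>p\<in>S. \<Sum>ws\<in>walks_between k m Y (snd p) \<tau>'. walk_weight \<tau> (p # ws))"
    by (subst sum.Sigma) (auto simp: finS finite_walks_between fin)
  also have "\<dots> = (\<Sum>p\<in>S. coboundary_sign (fst p) \<tau> * coboundary_sign (fst p) (snd p) * (\<Sum>ws\<in>walks_between k m Y (snd p) \<tau>'. walk_weight (snd p) ws))"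
    by (intro sum.cong) (auto simp: sum_distrib_left)
  \<comment> \<open>The sum over S is enlarged to all pairs: outside S one of the two incidence
    signs is 0.\<close>
  also have "\<dots> = (\<Sum>p\<in>faces Y (Suc k) \<times> faces Y k. coboundary_sign (fst p) \<tau> * coboundary_sign (fst p) (snd p) * (\<Sum>ws\<in>walks_between k m Y (snd p) \<tau>'. walk_weight (snd p) ws))"
    by (rule sum.mono_neutral_left) (use S in \<open>auto simp: finite_faces S_def dest!: coboundary_sign_nonzeroD\<close>)
  also have "\<dots> = (\<Sum>\<rho>\<in>faces Y k. laplacian_kernel Y k \<tau> \<rho> * (\<Sum>ws\<in>walks_between k m Y \<rho> \<tau>'. walk_weight \<rho> ws))"
    unfolding laplacian_kernel_def sum_distrib_right
    by (subst sum.swap) (simp add: sum.cartesian_product case_prod_unfold)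
  finally show ?thesis .
qed

lemma walks_between_0:
  assumes "Pow \<tau> \<subseteq> Y" "card \<tau> = Suc k"
  shows "walks_between k 0 Y \<tau> \<tau>' = (if \<tau> = \<tau>' then {[]} else {})"
  using assms by (cases "\<tau> = \<tau>'") (simp_all add: walks_between_def cong: conj_cong)

lemma up_laplacian_pow_index:
  assumes "i < length (enum_set (faces Y k))" "j < length (enum_set (faces Y k))"
  shows "(up_laplacian Y k ^\<^sub>m m) $$ (i, j)
    = (\<Sum>ws\<in>walks_between k m Y (enum_set (faces Y k) ! i) (enum_set (faces Y k) ! j).
         walk_weight (enum_set (faces Y k) ! i) ws)"
proof -
  define S where "S = enum_set (faces Y k)"
  define L where "L = up_laplacian Y k"
  have S: "distinct S" "set S = faces Y k" unfolding S_def using enum_set[OF finite_faces] by auto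
  have mem: "S ! i \<in> faces Y k" if "i < length S" for i using that S(2) nth_mem by metis
  have L: "L \<in> carrier_mat (length S) (length S)" unfolding L_def S_def by (rule up_laplacian_carrier)
  then have Lm: "L ^\<^sub>m m \<in> carrier_mat (length S) (length S)" for m by simp
  have j: "j < length S" using assms(2) unfolding S_def .
  have "i < length S \<Longrightarrow> (L ^\<^sub>m m) $$ (i, j) = (\<Sum>ws\<in>walks_between k m Y (S ! i) (S ! j). walk_weight (S ! i) ws)" for i
  proof (induction m arbitrary: i)
    case 0
    have "Pow (S ! i) \<subseteq> Y" using mem[OF 0] by (intro Pow_subset_complex) (simp add: faces_def)
    moreover have "card (S ! i) = Suc k" using mem[OF 0] by (simp add: faces_def)
    ultimately have "walks_between k 0 Y (S ! i) (S ! j) = (if S ! i = S ! j then {[]} else {})"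
      by (rule walks_between_0)
    then show ?case using 0 j S(1) L by (auto simp: nth_eq_iff_index_eq)
  next
    case (Suc m)
    have "(L ^\<^sub>m Suc m) $$ (i, j) = (\<Sum>l<length S. L $$ (i, l) * (L ^\<^sub>m m) $$ (l, j))"
      unfolding pow_mat_Suc_left[OF L] using L Lm[of m] Suc.prems j
      by (simp add: scalar_prod_def atLeast0LessThan)
    also have "\<dots> = (\<Sum>l<length S. laplacian_kernel Y k (S ! i) (S ! l) *
        (\<Sum>ws\<in>walks_between k m Y (S ! l) (S ! j). walk_weight (S ! l) ws))"
    proof (rule sum.cong[OF refl])
      fix l assume "l \<in> {..<length S}"
      then have l: "l < length S" by simp
      show "L $$ (i, l) * (L ^\<^sub>m m) $$ (l, j) = laplacian_kernel Y k (S ! i) (S ! l) *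
        (\<Sum>ws\<in>walks_between k m Y (S ! l) (S ! j). walk_weight (S ! l) ws)"
        unfolding Suc.IH[OF l] using up_laplacian_index[of i l] Suc.prems l by (simp only: S_def L_def)
    qed
    also have "\<dots> = (\<Sum>\<rho>\<in>faces Y k. laplacian_kernel Y k (S ! i) \<rho> *
        (\<Sum>ws\<in>walks_between k m Y \<rho> (S ! j). walk_weight \<rho> ws))"
      unfolding S_def by (rule sum_nth_enum_set[OF finite_faces])
    finally show ?case by (simp only: walks_between_Suc[OF mem[OF Suc.prems]])
  qed
  then show ?thesis using assms(1) by (simp only: S_def L_def)
qed

lemma mat_trace_up_laplacian_pow:
  "mat_trace (up_laplacian Y k ^\<^sub>m m) = (\<Sum>(\<tau>, ws)\<in>closed_walks k m Y. walk_weight \<tau> ws)"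
proof -
  let ?S = "enum_set (faces Y k)"
  have "dim_row (up_laplacian Y k ^\<^sub>m m) = length ?S"
    by (rule carrier_matD(1)[OF pow_carrier_mat[OF up_laplacian_carrier]])
  then have "mat_trace (up_laplacian Y k ^\<^sub>m m)
      = (\<Sum>i<length ?S. \<Sum>ws\<in>walks_between k m Y (?S ! i) (?S ! i). walk_weight (?S ! i) ws)"
    by (auto simp: mat_trace_def up_laplacian_pow_index intro!: sum.cong)
  also have "\<dots> = (\<Sum>\<tau>\<in>faces Y k. \<Sum>ws\<in>walks_between k m Y \<tau> \<tau>. walk_weight \<tau> ws)"
    by (rule sum_nth_enum_set[OF finite_faces])
  also have "\<dots> = (\<Sum>(\<tau>, ws)\<in>(SIGMA \<tau>:faces Y k. walks_between k m Y \<tau> \<tau>). walk_weight \<tau> ws)"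
    by (rule sum.Sigma) (auto simp: finite_faces finite_walks_between fin)
  also have "(SIGMA \<tau>:faces Y k. walks_between k m Y \<tau> \<tau>) = closed_walks k m Y"
  proof (intro equalityI subsetI)
    fix p assume "p \<in> closed_walks k m Y"
    then obtain \<tau> ws where p: "p = (\<tau>, ws)" "length ws = m" "walk_valid k \<tau> ws" "walk_end \<tau> ws = \<tau>"
      "walk_complex \<tau> ws \<subseteq> Y" by (auto simp: closed_walks_def)
    then have "\<tau> \<in> Y" using walk_valid_Pow_subset[OF p(3)] by auto
    then show "p \<in> (SIGMA \<tau>:faces Y k. walks_between k m Y \<tau> \<tau>)"
      using p by (auto simp: walks_between_def faces_def dest: walk_valid_card)
  qed (auto simp: closed_walks_def walks_between_def)
  finally show ?thesis .
qed

lemma length_enum_faces: "length (enum_set (faces Y k)) = card (faces Y k)"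
  using distinct_card[OF enum_set(1)[OF finite_faces[of k]]] by (simp only: enum_set(2)[OF finite_faces])

text \<open>The hypothesis is the counterpart of conditioning on dim X \<ge> k: it makes the matrix
  nonempty.\<close>

lemma up_laplacian_esd_moments:
  assumes "faces Y k \<noteq> {}"
  shows "integrable (esd (up_laplacian Y k)) (\<lambda>x. x ^ m)"
    "(LINT x|esd (up_laplacian Y k). x ^ m)
      = (\<Sum>(\<tau>, ws)\<in>closed_walks k m Y. walk_weight \<tau> ws) / card (faces Y k)"
proof -
  have pos: "length (enum_set (faces Y k)) > 0"
    using assms by (simp add: length_enum_faces card_gt_0_iff finite_faces)
  show "integrable (esd (up_laplacian Y k)) (\<lambda>x. x ^ m)"
    by (rule esd_moments(1)[OF up_laplacian_carrier up_laplacian_symmetric pos])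
  show "(LINT x|esd (up_laplacian Y k). x ^ m)
      = (\<Sum>(\<tau>, ws)\<in>closed_walks k m Y. walk_weight \<tau> ws) / card (faces Y k)"
    unfolding esd_moments(2)[OF up_laplacian_carrier up_laplacian_symmetric pos]
      mat_trace_up_laplacian_pow length_enum_faces ..
qed

end

section \<open>Spatially independent laws\<close>

text \<open>With the empty simplex almost surely present, Q(0) = 1: complexes that share no vertex
  become independent, and the chain of ratios Q(i+1) / Q(i) starts at Q(1).\<close>

locale spatial_law =
  fixes n :: nat and P :: "nat set set pmf"
  assumes random: "random_subcomplex n P"
    and homog: "homogeneous n P"
    and indep: "spatially_independent n P"
    and empty_mem: "\<And>Y. Y \<in> set_pmf P \<Longrightarrow> {} \<in> Y"
begin

definition cprob :: "nat set set \<Rightarrow> real" where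
  "cprob Y = measure_pmf.prob P {X. Y \<subseteq> X}"

text \<open>This is Q(j). The index counts vertices, not dimension, so q_k is
  \<open>sprob (Suc k)\<close>.\<close>

definition sprob :: "nat \<Rightarrow> real" where
  "sprob j = cprob (Pow {0..<j})"

lemma cprob_nonneg: "0 \<le> cprob Y" and cprob_le_1: "cprob Y \<le> 1"
  by (auto simp: cprob_def)

lemma sprob_nonneg: "0 \<le> sprob j"
  by (simp add: sprob_def cprob_nonneg)

lemma prob_cong:
  assumes "\<And>X. X \<in> set_pmf P \<Longrightarrow> X \<in> A \<longleftrightarrow> X \<in> B"
  shows "measure_pmf.prob P A = measure_pmf.prob P B"
  by (rule measure_pmf.finite_measure_eq_AE) (auto simp: AE_measure_pmf_iff assms)

lemma set_pmf_subcomplex: "X \<in> set_pmf P \<Longrightarrow> subcomplex n X"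
  using random by (auto simp: random_subcomplex_def)

lemma cprob_antimono: "Y \<subseteq> Z \<Longrightarrow> cprob Z \<le> cprob Y"
  unfolding cprob_def by (intro measure_pmf.finite_measure_mono) auto

lemma cprob_empty_simplex: "cprob {{}} = 1"
proof -
  have "measure_pmf.prob P {X. {{}} \<subseteq> X} = measure_pmf.prob P UNIV"
    by (rule prob_cong) (simp add: empty_mem)
  then show ?thesis by (simp add: cprob_def)
qed

lemma cprob_mult:
  "subcomplex n Y \<Longrightarrow> subcomplex n Z \<Longrightarrow> cprob (Y \<union> Z) * cprob (Y \<inter> Z) = cprob Y * cprob Z"
  using indep unfolding spatially_independent_def cprob_def by blast

lemma cprob_zero: "\<not> \<sigma> \<subseteq> {0..<n} \<Longrightarrow> \<sigma> \<in> Y \<Longrightarrow> cprob Y = 0"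
proof -
  assume "\<not> \<sigma> \<subseteq> {0..<n}" "\<sigma> \<in> Y"
  then have "measure_pmf.prob P {X. Y \<subseteq> X} = measure_pmf.prob P {}"
    by (intro prob_cong) (use set_pmf_subcomplex in \<open>fastforce simp: subcomplex_def\<close>)
  then show ?thesis by (simp add: cprob_def)
qed

lemma cprob_permute:
  assumes g: "g permutes {0..<n}"
  shows "cprob ((`) g ` Y) = cprob Y"
proof -
  have "inj ((`) g)" using permutes_inj[OF g] by (simp add: inj_image_eq_iff inj_on_def)
  then have *: "(`) g ` Y \<subseteq> (`) g ` X \<longleftrightarrow> Y \<subseteq> X" for X by (simp add: inj_image_subset_iff)
  have "cprob ((`) g ` Y) = measure_pmf.prob (map_pmf (\<lambda>X. (`) g ` X) P) {X. (`) g ` Y \<subseteq> X}"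
    using homog g by (simp add: homogeneous_def cprob_def)
  also have "\<dots> = cprob Y" by (simp add: cprob_def measure_map_pmf vimage_def *)
  finally show ?thesis .
qed

lemma subcomplex_Pow: "\<sigma> \<subseteq> {0..<n} \<Longrightarrow> subcomplex n (Pow \<sigma>)"
  by (auto simp: subcomplex_def)

lemma subcomplex_Un: "subcomplex n Y \<Longrightarrow> subcomplex n Z \<Longrightarrow> subcomplex n (Y \<union> Z)"
  by (simp add: subcomplex_def ball_Un)

end

text \<open>The complements of A and B in S have equal size, so h can be completed by any bijection
  between them.\<close>

lemma exists_permutation_extending:
  fixes h :: "nat \<Rightarrow> nat"
  assumes h: "bij_betw h A B" and A: "A \<subseteq> S" and B: "B \<subseteq> S" and S: "finite S"
  obtains g where "g permutes S" "\<And>x. x \<in> A \<Longrightarrow> g x = h x"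
proof -
  have "card A = card B" using h by (rule bij_betw_same_card)
  then have "card (S - A) = card (S - B)"
    using A B S by (simp add: card_Diff_subset finite_subset)
  then obtain h' where h': "bij_betw h' (S - A) (S - B)"
    using S by (metis finite_Diff finite_same_card_bij)
  define g where "g x = (if x \<in> A then h x else if x \<in> S then h' x else x)" for x
  have "bij_betw g (A \<union> (S - A)) (B \<union> (S - B))"
  proof (rule bij_betw_combine)
    show "bij_betw g A B" using h by (rule bij_betw_cong[THEN iffD1, rotated]) (simp add: g_def)
    show "bij_betw g (S - A) (S - B)" using h' by (rule bij_betw_cong[THEN iffD1, rotated]) (simp add: g_def)
  qed auto
  moreover have "A \<union> (S - A) = S" "B \<union> (S - B) = S" using A B by auto
  ultimately have "bij_betw g S S" by simp
  then have "g permutes S" by (rule bij_imp_permutes) (use A in \<open>auto simp: g_def\<close>)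
  then show ?thesis by (rule that) (simp add: g_def)
qed

context spatial_law begin

lemma cprob_Pow:
  assumes "\<sigma> \<subseteq> {0..<n}" shows "cprob (Pow \<sigma>) = sprob (card \<sigma>)"
proof -
  have fin: "finite \<sigma>" using assms finite_subset by blast
  have le: "card \<sigma> \<le> n" using card_mono[OF _ assms] by simp
  obtain h where h: "bij_betw h {0..<card \<sigma>} \<sigma>" using ex_bij_betw_nat_finite[OF fin] by blast
  obtain g where g: "g permutes {0..<n}" "\<And>x. x \<in> {0..<card \<sigma>} \<Longrightarrow> g x = h x"
    by (rule exists_permutation_extending[OF h, of "{0..<n}"]) (use assms le in auto)
  have "g ` {0..<card \<sigma>} = \<sigma>" using g(2) h by (force simp: bij_betw_def)
  then have "(`) g ` Pow {0..<card \<sigma>} = Pow \<sigma>" by (metis image_Pow_surj)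
  then show ?thesis using cprob_permute[OF g(1), of "Pow {0..<card \<sigma>}"] by (simp add: sprob_def)
qed

lemma sprob_0: "sprob 0 = 1"
  using cprob_empty_simplex by (simp add: sprob_def)

lemma sprob_antimono: "i \<le> j \<Longrightarrow> sprob j \<le> sprob i"
  unfolding sprob_def by (intro cprob_antimono) auto

lemma sprob_zero: "j > n \<Longrightarrow> sprob j = 0"
  unfolding sprob_def by (rule cprob_zero[of "{0..<j}"]) auto

lemma qk_eq: "qk P k = sprob (Suc k)"
proof -
  have "measure_pmf.prob P {X. {0..k} \<in> X} = measure_pmf.prob P {X. Pow {0..<Suc k} \<subseteq> X}"
    unfolding atLeastLessThanSuc_atLeastAtMost
    by (rule prob_cong) (use set_pmf_subcomplex in \<open>auto simp: subcomplex_def\<close>)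
  then show ?thesis by (simp add: qk_def sprob_def cprob_def)
qed

lemma rk_eq: "rk P k = sprob (Suc (Suc k)) / sprob (Suc k)"
proof -
  have "measure_pmf.prob P {X. {0..Suc k} \<in> X \<and> {0..k} \<in> X} = qk P (Suc k)"
    unfolding qk_def
  proof (rule prob_cong)
    fix X assume X: "X \<in> set_pmf P"
    have "{0..k} \<subseteq> {0..Suc k}" by auto
    then show "X \<in> {X. {0..Suc k} \<in> X \<and> {0..k} \<in> X} \<longleftrightarrow> X \<in> {X. {0..Suc k} \<in> X}"
      using set_pmf_subcomplex[OF X] unfolding subcomplex_def by blast
  qed
  then show ?thesis by (simp add: rk_def qk_eq)
qed

text \<open>Since x is new, Y and the full simplex on \<open>insert x \<tau>\<close> meet exactly in
  \<open>Pow \<tau>\<close>, so spatial independence becomes an identity between known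
  probabilities; this is the exact factor r_k.\<close>

lemma cprob_new_vertex:
  assumes Y: "subcomplex n Y" and \<tau>: "\<tau> \<in> Y" and x: "x \<notin> \<Union>Y" "x < n"
  shows "cprob (Y \<union> Pow (insert x \<tau>)) * sprob (card \<tau>) = cprob Y * sprob (Suc (card \<tau>))"
proof -
  have sub: "\<tau> \<subseteq> {0..<n}" using Y \<tau> by (auto simp: subcomplex_def)
  then have fin: "finite \<tau>" using finite_subset by blast
  have x\<tau>: "x \<notin> \<tau>" using x \<tau> by auto
  have sub': "insert x \<tau> \<subseteq> {0..<n}" using sub x by auto
  have "Y \<inter> Pow (insert x \<tau>) = Pow \<tau>" using Y \<tau> x unfolding subcomplex_def by blast
  then show ?thesis
    using cprob_mult[OF Y subcomplex_Pow[OF sub']] cprob_Pow[OF sub] cprob_Pow[OF sub'] fin x\<tau> by simp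
qed

text \<open>The ratio \<alpha>_j: by \<open>cprob_two_facets\<close> it is the conditional
  probability of a simplex on j + 2 vertices given two of its facets. If Q(j+1) = 0, the division
  makes it 0.\<close>

definition edge_ratio :: "nat \<Rightarrow> real" where
  "edge_ratio j = sprob (Suc (Suc j)) * sprob j / (sprob (Suc j))\<^sup>2"

lemma cprob_two_facets:
  assumes \<sigma>: "\<sigma> \<subseteq> {0..<n}" "card \<sigma> = Suc (Suc j)" and uv: "u \<in> \<sigma>" "v \<in> \<sigma>" "u \<noteq> v"
  shows "cprob (Pow (\<sigma> - {u}) \<union> Pow (\<sigma> - {v})) * sprob j = (sprob (Suc j))\<^sup>2"
proof -
  have fin: "finite \<sigma>" using \<sigma> finite_subset by blast
  have sub: "\<sigma> - {u} \<subseteq> {0..<n}" "\<sigma> - {v} \<subseteq> {0..<n}" "\<sigma> - {u, v} \<subseteq> {0..<n}" using \<sigma> by auto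
  have cards: "card (\<sigma> - {u}) = Suc j" "card (\<sigma> - {v}) = Suc j" "card (\<sigma> - {u, v}) = j"
    using uv \<sigma> fin by (auto simp: card_Diff_subset)
  have "Pow (\<sigma> - {u}) \<inter> Pow (\<sigma> - {v}) = Pow (\<sigma> - {u, v})" by auto
  then show ?thesis
    using cprob_mult[OF subcomplex_Pow[OF sub(1)] subcomplex_Pow[OF sub(2)]]
      cprob_Pow[OF sub(1)] cprob_Pow[OF sub(2)] cprob_Pow[OF sub(3)] cards
    by (simp add: power2_eq_square)
qed

text \<open>A face of \<sigma> already in Y cannot contain both u and v, so it lies in one of the
  facets opposite to them. The part of \<sigma> present in Y is therefore at most these two facets,
  and the factor for adding \<sigma> is at most its conditional probability given both.\<close>

lemma cprob_missing_edge:
  assumes Y: "subcomplex n Y" and \<sigma>: "\<sigma> \<subseteq> {0..<n}" "card \<sigma> = Suc (Suc j)"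
    and uv: "u \<in> \<sigma>" "v \<in> \<sigma>" "u \<noteq> v" "{u, v} \<notin> Y" and pos: "sprob (Suc j) > 0"
  shows "cprob (Y \<union> Pow \<sigma>) \<le> edge_ratio j * cprob Y"
proof -
  let ?E = "Pow (\<sigma> - {u}) \<union> Pow (\<sigma> - {v})"
  have "sprob j > 0" using pos sprob_antimono[of j "Suc j"] by simp
  have E: "cprob ?E * sprob j = (sprob (Suc j))\<^sup>2" by (rule cprob_two_facets[OF \<sigma> uv(1-3)])
  have "Y \<inter> Pow \<sigma> \<subseteq> ?E"
  proof
    fix \<rho> assume \<rho>: "\<rho> \<in> Y \<inter> Pow \<sigma>"
    then have "\<not> {u, v} \<subseteq> \<rho>" using Y uv(4) by (auto simp: subcomplex_def)
    then show "\<rho> \<in> ?E" using \<rho> by auto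
  qed
  then have "cprob ?E \<le> cprob (Y \<inter> Pow \<sigma>)" by (rule cprob_antimono)
  then have "cprob (Y \<union> Pow \<sigma>) * cprob ?E \<le> cprob Y * sprob (Suc (Suc j))"
    using mult_left_mono[OF _ cprob_nonneg[of "Y \<union> Pow \<sigma>"], of "cprob ?E" "cprob (Y \<inter> Pow \<sigma>)"]
    unfolding cprob_mult[OF Y subcomplex_Pow[OF \<sigma>(1)]] cprob_Pow[OF \<sigma>(1)] \<sigma>(2) by blast
  then have "cprob (Y \<union> Pow \<sigma>) * cprob ?E * sprob j \<le> cprob Y * sprob (Suc (Suc j)) * sprob j"
    using \<open>sprob j > 0\<close> by (intro mult_right_mono) auto
  then have "cprob (Y \<union> Pow \<sigma>) * (sprob (Suc j))\<^sup>2 \<le> cprob Y * sprob (Suc (Suc j)) * sprob j"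
    using E by (simp add: mult.assoc)
  then show ?thesis using pos by (simp add: edge_ratio_def field_simps)
qed

text \<open>What Y and \<open>Pow \<tau>\<close> have in common is contained in the full simplex on
  the shared vertices, hence is at least as likely as that simplex.\<close>

lemma cprob_add_simplex_le:
  assumes Y: "subcomplex n Y" and \<tau>: "\<tau> \<subseteq> {0..<n}" and pos: "sprob (card (\<tau> \<inter> \<Union>Y)) > 0"
  shows "cprob (Y \<union> Pow \<tau>) \<le> cprob Y * sprob (card \<tau>) / sprob (card (\<tau> \<inter> \<Union>Y))"
proof -
  have "cprob (Pow (\<tau> \<inter> \<Union>Y)) \<le> cprob (Y \<inter> Pow \<tau>)" by (rule cprob_antimono) auto
  moreover have "cprob (Pow (\<tau> \<inter> \<Union>Y)) = sprob (card (\<tau> \<inter> \<Union>Y))" by (rule cprob_Pow) (use \<tau> in auto)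
  ultimately have "cprob (Y \<union> Pow \<tau>) * sprob (card (\<tau> \<inter> \<Union>Y)) \<le> cprob Y * sprob (card \<tau>)"
    using mult_left_mono[OF _ cprob_nonneg[of "Y \<union> Pow \<tau>"], of "cprob (Pow (\<tau> \<inter> \<Union>Y))" "cprob (Y \<inter> Pow \<tau>)"]
    unfolding cprob_mult[OF Y subcomplex_Pow[OF \<tau>]] cprob_Pow[OF \<tau>] by simp
  then show ?thesis using pos by (simp add: field_simps)
qed

lemma cprob_disjoint:
  assumes "subcomplex n Y" "subcomplex n Z" "{} \<in> Y" "{} \<in> Z" "\<Union>Y \<inter> \<Union>Z = {}"
  shows "cprob (Y \<union> Z) = cprob Y * cprob Z"
proof -
  have "Y \<inter> Z = {{}}" using assms(3-5) by blast
  then show ?thesis using cprob_mult[OF assms(1,2)] by (simp add: cprob_empty_simplex)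
qed

text \<open>Positive association: in the independence identity the factor for the intersection is at
  most 1.\<close>

lemma cprob_supermult:
  assumes "subcomplex n Y" "subcomplex n Z" shows "cprob Y * cprob Z \<le> cprob (Y \<union> Z)"
  using mult_left_le[OF cprob_le_1[of "Y \<inter> Z"] cprob_nonneg[of "Y \<union> Z"]]
  unfolding cprob_mult[OF assms] .

text \<open>Two facets of a simplex are at least as likely as the whole simplex, and
  \<open>cprob_two_facets\<close> evaluates their probability. Beyond n vertices the left side is
  0.\<close>

lemma sprob_log_concave: "sprob (Suc (Suc j)) * sprob j \<le> (sprob (Suc j))\<^sup>2"
proof (cases "Suc (Suc j) \<le> n")
  case True
  let ?\<sigma> = "{0..<Suc (Suc j)}"
  have "sprob (Suc (Suc j)) \<le> cprob (Pow (?\<sigma> - {0}) \<union> Pow (?\<sigma> - {Suc j}))"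
    unfolding sprob_def by (rule cprob_antimono) auto
  then have "sprob (Suc (Suc j)) * sprob j \<le> cprob (Pow (?\<sigma> - {0}) \<union> Pow (?\<sigma> - {Suc j})) * sprob j"
    by (rule mult_right_mono) (rule sprob_nonneg)
  also have "\<dots> = (sprob (Suc j))\<^sup>2"
    by (rule cprob_two_facets) (use True in auto)
  finally show ?thesis .
qed (simp add: sprob_zero)

lemma edge_ratio_nonneg: "0 \<le> edge_ratio j"
  by (simp add: edge_ratio_def sprob_nonneg)

text \<open>In a simplex on j + 3 vertices the facets omitting 0 and omitting 1 form a complex Y
  without the edge {0, 1}. Adding the simplex on the first j + 2 vertices costs a factor at most
  \<alpha>_j, and the whole simplex contains the result. As Y has probability Q(j+2)^2 / Q(j+1),
  this reads \<alpha>_(j+1) \<le> \<alpha>_j.\<close>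

lemma edge_ratio_Suc_le: "edge_ratio (Suc j) \<le> edge_ratio j"
proof (cases "Suc (Suc (Suc j)) \<le> n \<and> sprob (Suc (Suc j)) > 0")
  case True
  let ?\<sigma>' = "{0..<Suc (Suc (Suc j))}" let ?\<sigma> = "{0..<Suc (Suc j)}"
  let ?Y = "Pow (?\<sigma>' - {0}) \<union> Pow (?\<sigma>' - {1})"
  have pos: "sprob (Suc j) > 0" "sprob (Suc (Suc j)) > 0"
    using True sprob_antimono[of "Suc j" "Suc (Suc j)"] by auto
  have Y: "subcomplex n ?Y" using True by (intro subcomplex_Un subcomplex_Pow) auto
  have "sprob (Suc (Suc (Suc j))) \<le> cprob (?Y \<union> Pow ?\<sigma>)"
    unfolding sprob_def by (rule cprob_antimono) auto
  also have "\<dots> \<le> edge_ratio j * cprob ?Y"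
  proof (rule cprob_missing_edge[OF Y, of _ _ 0 1])
    show "?\<sigma> \<subseteq> {0..<n}" using True by auto
    show "{0, 1} \<notin> ?Y" by blast
  qed (use pos in auto)
  finally have "sprob (Suc (Suc (Suc j))) * sprob (Suc j) \<le> edge_ratio j * (cprob ?Y * sprob (Suc j))"
    using pos(1) by (simp add: mult.assoc[symmetric])
  also have "cprob ?Y * sprob (Suc j) = (sprob (Suc (Suc j)))\<^sup>2"
  proof (rule cprob_two_facets)
    show "?\<sigma>' \<subseteq> {0..<n}" using True by auto
  qed auto
  finally show ?thesis using pos by (simp add: edge_ratio_def[of "Suc j"] divide_le_eq)
next
  case False
  then have "sprob (Suc (Suc (Suc j))) = 0 \<or> sprob (Suc (Suc j)) = 0"
    using sprob_zero[of "Suc (Suc (Suc j))"] sprob_nonneg[of "Suc (Suc j)"] by linarith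
  then show ?thesis using edge_ratio_nonneg[of j] by (auto simp: edge_ratio_def[of "Suc j"])
qed

text \<open>As Q(0) = 1, the ratio Q(i+1) / Q(i) is Q(1) times \<alpha>_0, ..., \<alpha>_(i-1), and
  for i \<le> k + 1 each of these is at least \<alpha>_k. At i = k + 1 the ratio is r_k.\<close>

lemma edge_ratio_power_le:
  assumes "sprob (Suc k) > 0"
  shows "sprob 1 * edge_ratio k ^ Suc k \<le> rk P k"
proof -
  have anti: "edge_ratio k \<le> edge_ratio i" if "i \<le> k" for i
    by (rule lift_Suc_antimono_le[of edge_ratio, OF edge_ratio_Suc_le that])
  have "sprob 1 * edge_ratio k ^ i \<le> sprob (Suc i) / sprob i" if "i \<le> Suc k" for i
    using that
  proof (induction i)
    case 0 then show ?case by (simp add: sprob_0)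
  next
    case (Suc i)
    have pos: "sprob i > 0" "sprob (Suc i) > 0"
      using assms Suc.prems sprob_antimono[of i "Suc k"] sprob_antimono[of "Suc i" "Suc k"] by auto
    have "sprob 1 * edge_ratio k ^ Suc i = (sprob 1 * edge_ratio k ^ i) * edge_ratio k" by simp
    also have "\<dots> \<le> (sprob (Suc i) / sprob i) * edge_ratio i"
      using Suc by (intro mult_mono anti) (auto simp: edge_ratio_nonneg sprob_nonneg)
    also have "\<dots> = sprob (Suc (Suc i)) / sprob (Suc i)"
      using pos by (simp add: edge_ratio_def power2_eq_square field_simps)
    finally show ?case .
  qed
  from this[of "Suc k"] show ?thesis by (simp add: rk_eq)
qed

text \<open>Log-concavity with Q(0) = 1 makes Q(j)^(1/j) decreasing in j; in terms of powers this
  stays meaningful when some Q(j) vanish.\<close>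

lemma sprob_power_le:
  assumes "j \<le> K" shows "sprob K ^ j \<le> sprob j ^ K"
proof -
  have step: "sprob (Suc i) ^ i \<le> sprob i ^ Suc i" for i
  proof (induction i)
    case (Suc i)
    show ?case
    proof (cases "sprob (Suc i) = 0")
      case True
      then have "sprob (Suc (Suc i)) = 0"
        using sprob_antimono[of "Suc i" "Suc (Suc i)"] sprob_nonneg[of "Suc (Suc i)"] by simp
      then show ?thesis using True by simp
    next
      case False
      then have pos: "sprob (Suc i) > 0" using sprob_nonneg[of "Suc i"] by simp
      \<comment> \<open>The factor Q(i+1)^i is cancelled at the end, which is why the case Q(i+1) =
        0 is split off.\<close>
      have "sprob (Suc (Suc i)) ^ Suc i * sprob (Suc i) ^ i \<le> sprob (Suc (Suc i)) ^ Suc i * sprob i ^ Suc i"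
        using Suc by (intro mult_left_mono) (auto simp: sprob_nonneg)
      also have "\<dots> = (sprob (Suc (Suc i)) * sprob i) ^ Suc i" by (simp only: power_mult_distrib)
      also have "\<dots> \<le> ((sprob (Suc i))\<^sup>2) ^ Suc i"
        by (intro power_mono sprob_log_concave) (simp add: sprob_nonneg)
      also have "\<dots> = sprob (Suc i) ^ Suc (Suc i) * sprob (Suc i) ^ i"
        by (simp add: power_mult[symmetric] power_add[symmetric] mult_2)
      finally show ?thesis using pos by (simp only: mult_le_cancel_right) simp
    qed
  qed (simp add: sprob_0)
  show ?thesis using assms
  proof (induction K rule: dec_induct)
    case (step K)
    show ?case
    proof (cases "K = 0")
      case True then show ?thesis using step by (simp add: sprob_0)
    next
      case False
      have "(sprob (Suc K) ^ j) ^ K = (sprob (Suc K) ^ K) ^ j" by (simp add: power_mult[symmetric] mult.commute)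
      also have "\<dots> \<le> (sprob K ^ Suc K) ^ j" using \<open>\<And>i. sprob (Suc i) ^ i \<le> sprob i ^ Suc i\<close>[of K]
        by (intro power_mono) (auto simp: sprob_nonneg)
      also have "\<dots> = (sprob K ^ j) ^ Suc K" by (simp only: power_mult[symmetric] mult.commute)
      also have "\<dots> \<le> (sprob j ^ K) ^ Suc K" using step by (intro power_mono) (auto simp: sprob_nonneg)
      also have "\<dots> = (sprob j ^ Suc K) ^ K" by (simp only: power_mult[symmetric] mult.commute)
      finally show ?thesis
        using False power_mono_iff[of "sprob (Suc K) ^ j" "sprob j ^ Suc K" K] by (simp add: sprob_nonneg)
    qed
  qed simp
qed

end

lemma walk_complex_down_closed:
  "\<sigma> \<in> walk_complex \<tau> ws \<Longrightarrow> \<rho> \<subseteq> \<sigma> \<Longrightarrow> \<rho> \<in> walk_complex \<tau> ws"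
  by (induction \<tau> ws rule: walk_complex.induct) auto

lemma empty_mem_walk_complex: "{} \<in> walk_complex \<tau> ws"
  by (induction \<tau> ws rule: walk_complex.induct) auto

text \<open>Each step adds at most one vertex, the one of \<sigma> outside the current
  k-simplex.\<close>

lemma walk_valid_card_Union:
  "walk_valid k \<tau> ws \<Longrightarrow> finite (\<Union>(walk_complex \<tau> ws)) \<and> card (\<Union>(walk_complex \<tau> ws) - \<tau>) \<le> length ws"
proof (induction \<tau> ws rule: walk_complex.induct)
  case (1 \<tau>)
  then show ?case by (auto intro: card_ge_0_finite)
next
  case (2 \<tau> \<sigma> \<rho> ws)
  let ?U = "\<Union>(walk_complex \<rho> ws)"
  have IH: "finite ?U" "card (?U - \<rho>) \<le> length ws" using 2 by auto
  have \<sigma>: "finite \<sigma>" using 2(2) by (auto intro: card_ge_0_finite)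
  have "finite \<tau>" using \<sigma> 2(2) finite_subset by auto
  then have "card (\<sigma> - \<tau>) = 1" using 2(2) \<sigma> by (auto simp: card_Diff_subset)
  have "\<sigma> \<union> ?U - \<tau> \<subseteq> (\<sigma> - \<tau>) \<union> (?U - \<rho>)" using 2(2) by auto
  then have "card (\<sigma> \<union> ?U - \<tau>) \<le> card ((\<sigma> - \<tau>) \<union> (?U - \<rho>))"
    using IH \<sigma> by (intro card_mono) auto
  also have "\<dots> \<le> 1 + length ws" using card_Un_le[of "\<sigma> - \<tau>" "?U - \<rho>"] IH \<open>card (\<sigma> - \<tau>) = 1\<close> by linarith
  finally show ?case using IH \<sigma> by simp
qed

lemma walk_step_insert:
  assumes "\<tau> \<subseteq> \<sigma>" "card \<tau> = Suc k" "card \<sigma> = Suc (Suc k)"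
  obtains x where "\<sigma> = insert x \<tau>" "x \<notin> \<tau>"
proof -
  have "finite \<sigma>" "finite \<tau>" using assms by (auto intro: card_ge_0_finite)
  then have "card (\<sigma> - \<tau>) = 1" using assms by (simp add: card_Diff_subset)
  then obtain x where "\<sigma> - \<tau> = {x}" by (auto simp: card_1_singleton_iff)
  then have "\<sigma> = insert x \<tau>" "x \<notin> \<tau>" using assms(1) by auto
  then show ?thesis by (rule that)
qed

section \<open>Cost of extending a complex along a walk\<close>

context spatial_law begin

lemma subcomplex_Union: "subcomplex n Y \<Longrightarrow> \<Union>Y \<subseteq> {0..<n}"
  by (auto simp: subcomplex_def)

lemma subcomplex_finite_Union: "subcomplex n Y \<Longrightarrow> finite (\<Union>Y)"
  using subcomplex_Union finite_subset by blast

text \<open>Up to a constant, the expected number of copies of Y in the random complex.\<close>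
definition scaled :: "nat set set \<Rightarrow> real" where
  "scaled Y = real n ^ card (\<Union>Y) * cprob Y"

text \<open>A common bound for the factor of one step: n r_k at a new vertex, at most 1 at an old
  one.\<close>

definition growth :: "nat \<Rightarrow> real" where
  "growth k = max 1 (real n * rk P k)"

lemma growth_ge_1: "1 \<le> growth k" by (simp add: growth_def)

lemma scaled_nonneg: "0 \<le> scaled Y"
  by (simp add: scaled_def cprob_nonneg)

lemma rk_nonneg: "0 \<le> rk P k"
  by (simp add: rk_eq sprob_nonneg)

lemma scaled_new_vertex:
  assumes Y: "subcomplex n Y" and \<tau>: "\<tau> \<in> Y" "card \<tau> = Suc k" and x: "x \<notin> \<Union>Y" "x < n"
    and pos: "sprob (Suc k) > 0"
  shows "scaled (Y \<union> Pow (insert x \<tau>)) = real n * rk P k * scaled Y"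
proof -
  have "\<Union>(Y \<union> Pow (insert x \<tau>)) = insert x (\<Union>Y)" using \<tau> by auto
  then have c: "card (\<Union>(Y \<union> Pow (insert x \<tau>))) = Suc (card (\<Union>Y))"
    using x subcomplex_finite_Union[OF Y] by simp
  have "cprob (Y \<union> Pow (insert x \<tau>)) = rk P k * cprob Y"
    using cprob_new_vertex[OF Y \<tau>(1) x] \<tau>(2) pos by (simp add: rk_eq field_simps)
  then show ?thesis unfolding scaled_def c by simp
qed

lemma scaled_old_vertices:
  assumes "\<sigma> \<subseteq> \<Union>Y"
  shows "scaled (Y \<union> Pow \<sigma>) \<le> scaled Y"
proof -
  have "\<Union>(Y \<union> Pow \<sigma>) = \<Union>Y" using assms by auto
  then show ?thesis unfolding scaled_def by (simp add: mult_left_mono cprob_antimono)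
qed

lemma scaled_missing_edge:
  assumes Y: "subcomplex n Y" and \<sigma>: "\<sigma> \<subseteq> \<Union>Y" "card \<sigma> = Suc (Suc k)"
    and uv: "u \<in> \<sigma>" "v \<in> \<sigma>" "u \<noteq> v" "{u, v} \<notin> Y" and pos: "sprob (Suc k) > 0"
  shows "scaled (Y \<union> Pow \<sigma>) \<le> edge_ratio k * scaled Y"
proof -
  have eq: "\<Union>(Y \<union> Pow \<sigma>) = \<Union>Y" using \<sigma> by auto
  have "\<sigma> \<subseteq> {0..<n}" using \<sigma>(1) subcomplex_Union[OF Y] by auto
  then have "cprob (Y \<union> Pow \<sigma>) \<le> edge_ratio k * cprob Y"
    by (rule cprob_missing_edge[OF Y _ \<sigma>(2) uv pos])
  then have "real n ^ card (\<Union>Y) * cprob (Y \<union> Pow \<sigma>) \<le> real n ^ card (\<Union>Y) * (edge_ratio k * cprob Y)"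
    by (rule mult_left_mono) simp
  then show ?thesis unfolding scaled_def eq by (simp add: mult_ac)
qed

lemma scaled_step_le:
  assumes Y: "subcomplex n Y" and \<tau>: "\<tau> \<in> Y" "card \<tau> = Suc k" and \<sigma>: "\<tau> \<subseteq> \<sigma>" "card \<sigma> = Suc (Suc k)" "\<sigma> \<subseteq> {0..<n}"
    and pos: "sprob (Suc k) > 0"
  shows "scaled (Y \<union> Pow \<sigma>) \<le> growth k * scaled Y"
proof -
  obtain x where x: "\<sigma> = insert x \<tau>" "x \<notin> \<tau>" by (rule walk_step_insert[OF \<sigma>(1) \<tau>(2) \<sigma>(2)])
  show ?thesis
  proof (cases "x \<in> \<Union>Y")
    case True
    then have "scaled (Y \<union> Pow \<sigma>) \<le> scaled Y" using x \<tau> by (intro scaled_old_vertices) auto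
    also have "\<dots> \<le> growth k * scaled Y"
      using mult_right_mono[OF growth_ge_1 scaled_nonneg] by simp
    finally show ?thesis .
  next
    case False
    have "scaled (Y \<union> Pow \<sigma>) = real n * rk P k * scaled Y"
      unfolding x(1) by (rule scaled_new_vertex[OF Y \<tau> False _ pos]) (use \<sigma>(3) x in auto)
    also have "\<dots> \<le> growth k * scaled Y"
      by (rule mult_right_mono) (auto simp: growth_def scaled_nonneg)
    finally show ?thesis .
  qed
qed

text \<open>Walks are not confined to the vertices below n; those leaving them have probability 0,
  which settles that case in the inductions below.\<close>

lemma scaled_zero: "\<not> \<sigma> \<subseteq> {0..<n} \<Longrightarrow> \<sigma> \<in> Y \<Longrightarrow> scaled Y = 0"
  by (simp add: scaled_def cprob_zero)

lemma scaled_walk_le: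
  assumes "subcomplex n Y" "\<tau> \<in> Y" "walk_valid k \<tau> ws" "sprob (Suc k) > 0"
  shows "scaled (Y \<union> walk_complex \<tau> ws) \<le> growth k ^ length ws * scaled Y"
  using assms
proof (induction ws arbitrary: Y \<tau>)
  case Nil
  then have "Y \<union> Pow \<tau> = Y" by (auto simp: subcomplex_def)
  then show ?case by simp
next
  case (Cons p ws)
  obtain \<sigma> \<rho> where p: "p = (\<sigma>, \<rho>)" by force
  have eq: "Y \<union> walk_complex \<tau> (p # ws) = (Y \<union> Pow \<sigma>) \<union> walk_complex \<rho> ws" by (auto simp: p)
  have g: "0 \<le> growth k" using growth_ge_1[of k] by linarith
  show ?case
  proof (cases "\<sigma> \<subseteq> {0..<n}")
    case True
    have v: "card \<tau> = Suc k" "card \<sigma> = Suc (Suc k)" "\<tau> \<subseteq> \<sigma>" "\<rho> \<subseteq> \<sigma>" "walk_valid k \<rho> ws"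
      using Cons.prems by (auto simp: p)
    have "scaled ((Y \<union> Pow \<sigma>) \<union> walk_complex \<rho> ws) \<le> growth k ^ length ws * scaled (Y \<union> Pow \<sigma>)"
      by (rule Cons.IH) (use Cons.prems True v in \<open>auto intro: subcomplex_Un subcomplex_Pow\<close>)
    also have "\<dots> \<le> growth k ^ length ws * (growth k * scaled Y)"
      by (intro mult_left_mono scaled_step_le[OF Cons.prems(1,2) v(1,3,2) True Cons.prems(4)]) (simp add: g)
    finally show ?thesis unfolding eq by (simp add: mult_ac)
  next
    case False
    then have "scaled (Y \<union> walk_complex \<tau> (p # ws)) = 0" by (rule scaled_zero) (simp add: p)
    then show ?thesis by (simp add: g scaled_nonneg)
  qed
qed

text \<open>U collects the part of the walk seen so far, still disjoint from Z. No simplex of Z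
  \<union> U joins the two vertex sets, so the first step reaching a vertex x of Z uses a missing
  edge {u, x} with u \<in> \<tau> and pays \<open>edge_ratio k\<close>; the other steps pay
  \<open>growth k\<close>.\<close>

lemma scaled_walk_meeting_le:
  assumes "subcomplex n Z" "subcomplex n U" "\<Union>Z \<inter> \<Union>U = {}" "\<tau> \<in> U" "walk_valid k \<tau> ws"
    "\<Union>(walk_complex \<tau> ws) \<inter> \<Union>Z \<noteq> {}" "sprob (Suc k) > 0"
  shows "scaled (Z \<union> U \<union> walk_complex \<tau> ws) \<le> edge_ratio k * growth k ^ length ws * scaled (Z \<union> U)"
  using assms
proof (induction ws arbitrary: U \<tau>)
  case Nil
  then have "\<tau> \<inter> \<Union>Z = {}" by auto
  then have False using Nil(6) by auto
  then show ?case ..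
next
  case (Cons p ws)
  obtain \<sigma> \<rho> where p: "p = (\<sigma>, \<rho>)" by force
  have eq: "Z \<union> U \<union> walk_complex \<tau> (p # ws) = (Z \<union> U \<union> Pow \<sigma>) \<union> walk_complex \<rho> ws" by (auto simp: p)
  have g: "0 \<le> growth k" using growth_ge_1[of k] by linarith
  have v: "card \<tau> = Suc k" "card \<sigma> = Suc (Suc k)" "\<tau> \<subseteq> \<sigma>" "\<rho> \<subseteq> \<sigma>" "walk_valid k \<rho> ws"
    using Cons.prems(5) by (auto simp: p)
  obtain x where x: "\<sigma> = insert x \<tau>" "x \<notin> \<tau>" by (rule walk_step_insert[OF v(3,1,2)])
  have ZU: "subcomplex n (Z \<union> U)" by (rule subcomplex_Un[OF Cons.prems(1,2)])
  show ?case
  proof (cases "\<sigma> \<subseteq> {0..<n}")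
    case True
    have sub: "subcomplex n (Z \<union> U \<union> Pow \<sigma>)" by (rule subcomplex_Un[OF ZU subcomplex_Pow[OF True]])
    have \<rho>: "\<rho> \<in> Z \<union> U \<union> Pow \<sigma>" using v by auto
    show ?thesis
    proof (cases "x \<in> \<Union>Z")
      case xZ: True
      obtain u where u: "u \<in> \<tau>" using v(1) by fastforce
      have "u \<in> \<Union>U" using u Cons.prems(4) by auto
      then have "u \<notin> \<Union>Z" "x \<notin> \<Union>U" using xZ Cons.prems(3) by auto
      then have "{u, x} \<notin> Z \<union> U" by auto
      then have 1: "scaled (Z \<union> U \<union> Pow \<sigma>) \<le> edge_ratio k * scaled (Z \<union> U)"
        using x u xZ Cons.prems(4,7) v(2) by (intro scaled_missing_edge[OF ZU, where u=u and v=x]) auto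
      have "scaled ((Z \<union> U \<union> Pow \<sigma>) \<union> walk_complex \<rho> ws) \<le> growth k ^ length ws * scaled (Z \<union> U \<union> Pow \<sigma>)"
        by (rule scaled_walk_le[OF sub \<rho> v(5) Cons.prems(7)])
      also have "\<dots> \<le> growth k ^ length ws * (edge_ratio k * scaled (Z \<union> U))"
        by (rule mult_left_mono[OF 1]) (simp add: g)
      \<comment> \<open>The entering step has already paid the edge ratio; the extra factor
        \<open>growth k\<close>, at least 1, only restores the exponent of the statement.\<close>
      also have "\<dots> \<le> growth k ^ Suc (length ws) * (edge_ratio k * scaled (Z \<union> U))"
        by (intro mult_right_mono power_increasing) (auto simp: growth_ge_1 edge_ratio_nonneg scaled_nonneg)
      finally show ?thesis unfolding eq by (simp add: mult_ac)
    next
      case False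
      have "(Z \<union> U \<union> Pow \<sigma>) \<union> walk_complex \<rho> ws = Z \<union> (U \<union> Pow \<sigma>) \<union> walk_complex \<rho> ws" by auto
      also have "scaled \<dots> \<le> edge_ratio k * growth k ^ length ws * scaled (Z \<union> (U \<union> Pow \<sigma>))"
      proof (rule Cons.IH)
        have dis: "\<tau> \<inter> \<Union>Z = {}" using Cons.prems(3,4) by auto
        then show "\<Union>Z \<inter> \<Union>(U \<union> Pow \<sigma>) = {}" using Cons.prems(3) False x by auto
        show "\<Union>(walk_complex \<rho> ws) \<inter> \<Union>Z \<noteq> {}" using Cons.prems(6) dis False x by (auto simp: p)
      qed (use Cons.prems True v in \<open>auto intro: subcomplex_Un subcomplex_Pow\<close>)
      also have "Z \<union> (U \<union> Pow \<sigma>) = Z \<union> U \<union> Pow \<sigma>" by auto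
      also have "edge_ratio k * growth k ^ length ws * scaled (Z \<union> U \<union> Pow \<sigma>)
          \<le> edge_ratio k * growth k ^ length ws * (growth k * scaled (Z \<union> U))"
        by (intro mult_left_mono scaled_step_le[OF ZU _ v(1,3,2) True Cons.prems(7)])
          (use Cons.prems(4) in \<open>auto simp: g edge_ratio_nonneg\<close>)
      finally show ?thesis unfolding eq by (simp add: mult_ac)
    qed
  next
    case False
    then have "scaled (Z \<union> U \<union> walk_complex \<tau> (p # ws)) = 0" by (rule scaled_zero) (simp add: p)
    then show ?thesis by (simp add: g scaled_nonneg edge_ratio_nonneg)
  qed
qed

text \<open>Asymptotically j! times the expected number of faces with j vertices; for j = k + 1 it
  is the normalisation n^(k+1) q_k.\<close>

definition face_scale :: "nat \<Rightarrow> real" where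
  "face_scale j = real n ^ j * sprob j"

lemma face_scale_nonneg: "0 \<le> face_scale j"
  by (simp add: face_scale_def sprob_nonneg)

text \<open>There are two ways of meeting Z. If the initial simplex \<tau> is disjoint from Z, it
  contributes \<open>face_scale (Suc k)\<close> and the later encounter costs an edge ratio. If
  \<tau> shares j \<ge> 1 vertices with Z, only k + 1 - j vertices are new, and the factor n^(k+1-j)
  Q(k+1) / Q(j) is \<open>face_scale (Suc k) / face_scale j\<close>. The sum over j covers all
  overlaps at once.\<close>

lemma scaled_walk_pair_le:
  assumes Z: "subcomplex n Z" "{} \<in> Z" and v: "walk_valid k \<tau> ws"
    and meet: "\<Union>(walk_complex \<tau> ws) \<inter> \<Union>Z \<noteq> {}"
    and n: "n > 0" and pos: "sprob (Suc k) > 0"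
  shows "scaled (Z \<union> walk_complex \<tau> ws) \<le> growth k ^ length ws * scaled Z * face_scale (Suc k)
           * (edge_ratio k + (\<Sum>j\<in>{1..Suc k}. 1 / face_scale j))" (is "_ \<le> ?B * scaled Z * ?N * (_ + ?s)")
proof (cases "\<tau> \<subseteq> {0..<n}")
  case False
  have "\<tau> \<in> walk_complex \<tau> ws" using walk_valid_Pow_subset[OF v] by auto
  then have 1: "scaled (Z \<union> walk_complex \<tau> ws) = 0" using False by (intro scaled_zero) auto
  have "0 \<le> growth k" using growth_ge_1[of k] by linarith
  then show ?thesis unfolding 1
    by (intro mult_nonneg_nonneg add_nonneg_nonneg sum_nonneg) (auto simp: scaled_nonneg face_scale_nonneg edge_ratio_nonneg)
next
  case True
  have card: "card \<tau> = Suc k" by (rule walk_valid_card[OF v])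
  have fin: "finite \<tau>" "finite (\<Union>Z)" using True finite_subset subcomplex_finite_Union[OF Z(1)] by auto
  have g: "0 \<le> growth k" using growth_ge_1[of k] by linarith
  have s: "0 \<le> ?s" by (intro sum_nonneg) (auto simp: face_scale_nonneg)
  have P: "subcomplex n (Pow \<tau>)" by (rule subcomplex_Pow[OF True])
  have eq: "Z \<union> walk_complex \<tau> ws = Z \<union> Pow \<tau> \<union> walk_complex \<tau> ws"
    using walk_valid_Pow_subset[OF v] by auto
  show ?thesis
  proof (cases "\<tau> \<inter> \<Union>Z = {}")
    case dis: True
    have "card (\<Union>(Z \<union> Pow \<tau>)) = card (\<Union>Z) + Suc k"
      using dis fin card by (simp add: card_Un_disjoint Int_commute)
    moreover have "cprob (Z \<union> Pow \<tau>) = cprob Z * sprob (Suc k)"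
      using cprob_disjoint[OF Z(1) P Z(2)] dis cprob_Pow[OF True] card by (simp add: Int_commute)
    ultimately have "scaled (Z \<union> Pow \<tau>) = scaled Z * ?N"
      unfolding scaled_def face_scale_def by (simp add: power_add mult_ac)
    moreover have "scaled (Z \<union> Pow \<tau> \<union> walk_complex \<tau> ws) \<le> edge_ratio k * ?B * scaled (Z \<union> Pow \<tau>)"
      by (rule scaled_walk_meeting_le[OF Z(1) P _ _ v meet pos]) (use dis in auto)
    ultimately have "scaled (Z \<union> walk_complex \<tau> ws) \<le> ?B * scaled Z * ?N * edge_ratio k"
      unfolding eq by (simp add: mult_ac)
    also have "\<dots> \<le> ?B * scaled Z * ?N * (edge_ratio k + ?s)"
      using s g by (intro mult_left_mono mult_nonneg_nonneg) (auto simp: scaled_nonneg face_scale_nonneg)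
    finally show ?thesis .
  next
    case False
    define j where "j = card (\<tau> \<inter> \<Union>Z)"
    have j: "1 \<le> j" "j \<le> Suc k"
      using False fin card_mono[of \<tau> "\<tau> \<inter> \<Union>Z"] card by (auto simp: j_def Suc_le_eq card_gt_0_iff)
    have posj: "sprob j > 0" using pos sprob_antimono[OF j(2)] by linarith
    have c: "card (\<Union>(Z \<union> Pow \<tau>)) + j = card (\<Union>Z) + Suc k"
      using card_Un_Int[OF fin] card by (simp add: j_def Un_commute)
    have le: "cprob (Z \<union> Pow \<tau>) \<le> cprob Z * sprob (Suc k) / sprob j"
      using cprob_add_simplex_le[OF Z(1) True] posj by (simp add: j_def card)
    have "scaled (Z \<union> Pow \<tau>) * real n ^ j = real n ^ (card (\<Union>(Z \<union> Pow \<tau>)) + j) * cprob (Z \<union> Pow \<tau>)"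
      unfolding scaled_def power_add by (simp add: mult_ac)
    also have "\<dots> \<le> real n ^ (card (\<Union>Z) + Suc k) * (cprob Z * sprob (Suc k) / sprob j)"
      unfolding c by (rule mult_left_mono[OF le]) simp
    also have "\<dots> = scaled Z * ?N / sprob j"
      unfolding scaled_def face_scale_def power_add by (simp add: mult_ac)
    finally have "scaled (Z \<union> Pow \<tau>) \<le> scaled Z * ?N * (1 / face_scale j)"
      using n posj by (simp add: face_scale_def field_simps)
    also have "\<dots> \<le> scaled Z * ?N * (edge_ratio k + ?s)"
    proof (rule mult_left_mono)
      have "1 / face_scale j \<le> ?s"
        by (rule member_le_sum) (use j in \<open>auto simp: face_scale_nonneg\<close>)
      then show "1 / face_scale j \<le> edge_ratio k + ?s" using edge_ratio_nonneg[of k] by linarith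
    qed (simp add: scaled_nonneg face_scale_nonneg)
    finally have 1: "scaled (Z \<union> Pow \<tau>) \<le> scaled Z * ?N * (edge_ratio k + ?s)" .
    have "scaled (Z \<union> Pow \<tau> \<union> walk_complex \<tau> ws) \<le> ?B * scaled (Z \<union> Pow \<tau>)"
      by (rule scaled_walk_le[OF subcomplex_Un[OF Z(1) P] _ v pos]) auto
    also have "\<dots> \<le> ?B * (scaled Z * ?N * (edge_ratio k + ?s))"
      by (rule mult_left_mono[OF 1]) (simp add: g)
    finally show ?thesis unfolding eq by (simp add: mult_ac)
  qed
qed

end

section \<open>Relabelling vertices\<close>

lemma exists_permutation_strict_mono:
  assumes V: "V \<subseteq> {0..<n::nat}"
  obtains g where "g permutes {0..<n}" "g ` {0..<card V} = V" "strict_mono_on {0..<card V} g"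
proof -
  have fin: "finite V" using V finite_subset by blast
  have le: "card V \<le> n" using card_mono[OF _ V] by simp
  obtain h where h: "bij_betw h {0..<card V} V" "strict_mono_on {0..<card V} h"
    by (rule ex_bij_betw_strict_mono_card[OF fin]) (simp add: lessThan_atLeast0)
  obtain g where g: "g permutes {0..<n}" "\<And>x. x \<in> {0..<card V} \<Longrightarrow> g x = h x"
    by (rule exists_permutation_extending[OF h(1), of "{0..<n}"]) (use V le in auto)
  show ?thesis
  proof (rule that[OF g(1)])
    show "g ` {0..<card V} = V" using g(2) h(1) by (force simp: bij_betw_def)
    show "strict_mono_on {0..<card V} g" using g(2) h(2) by (auto simp: strict_mono_on_def)
  qed
qed

text \<open>Every V is the increasing image of an initial segment. Grouping by vertex set therefore
  turns a sum whose index set grows with n into boundedly many sums over fixed index sets, so that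
  limits can be taken term by term. The action is abstract because the lemma serves both walks and
  pairs of walks.\<close>

lemma sum_by_vertex_set:
  fixes F :: "'a \<Rightarrow> real" and vs :: "'a \<Rightarrow> nat set" and act :: "(nat \<Rightarrow> nat) \<Rightarrow> 'a \<Rightarrow> 'a"
  assumes fin: "finite {w \<in> W. vs w \<subseteq> {0..<n}}"
    and M: "\<And>w. w \<in> W \<Longrightarrow> card (vs w) \<le> M"
    and act: "\<And>g w. g permutes {0..<n} \<Longrightarrow> w \<in> W \<Longrightarrow> act g w \<in> W"
      "\<And>g w. g permutes {0..<n} \<Longrightarrow> w \<in> W \<Longrightarrow> vs (act g w) = g ` vs w"
      "\<And>g w. g permutes {0..<n} \<Longrightarrow> w \<in> W \<Longrightarrow> act (inv_into UNIV g) (act g w) = w"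
    and F: "\<And>g w. g permutes {0..<n} \<Longrightarrow> w \<in> W \<Longrightarrow> strict_mono_on (vs w) g \<Longrightarrow> F (act g w) = F w"
  shows "(\<Sum>w\<in>{w \<in> W. vs w \<subseteq> {0..<n}}. F w)
    = (\<Sum>v\<le>M. real (n choose v) * (\<Sum>w\<in>{w \<in> W. vs w = {0..<v}}. F w))"
proof -
  let ?A = "{w \<in> W. vs w \<subseteq> {0..<n}}"
  define s where "s v = (\<Sum>w\<in>{w \<in> W. vs w = {0..<v}}. F w)" for v :: nat
  have relabel: "(\<Sum>w\<in>{w \<in> W. vs w = V}. F w) = s (card V)" if V: "V \<subseteq> {0..<n}" for V
  proof -
    obtain g where g: "g permutes {0..<n}" "g ` {0..<card V} = V" "strict_mono_on {0..<card V} g"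
      by (rule exists_permutation_strict_mono[OF V])
    have ginv: "inv_into UNIV g permutes {0..<n}" by (rule permutes_inv[OF g(1)])
    have invV: "inv_into UNIV g ` V = {0..<card V}"
    proof -
      have "inv_into UNIV g ` g ` {0..<card V} = {0..<card V}"
        unfolding image_comp permutes_inv_o(2)[OF g(1)] by simp
      then show ?thesis by (simp only: g(2))
    qed
    have retract: "act g (act (inv_into UNIV g) w) = w" if "w \<in> W" for w
      using act(3)[OF ginv that] permutes_inv_inv[OF g(1)] by simp
    have "bij_betw (act g) {w \<in> W. vs w = {0..<card V}} {w \<in> W. vs w = V}"
    proof (rule bij_betw_byWitness[where f'="act (inv_into UNIV g)"])
      show "\<forall>w\<in>{w \<in> W. vs w = {0..<card V}}. act (inv_into UNIV g) (act g w) = w" using act(3)[OF g(1)] by auto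
      show "\<forall>w\<in>{w \<in> W. vs w = V}. act g (act (inv_into UNIV g) w) = w" using retract by auto
      show "act g ` {w \<in> W. vs w = {0..<card V}} \<subseteq> {w \<in> W. vs w = V}"
        using act(1,2)[OF g(1)] g(2) by auto
      show "act (inv_into UNIV g) ` {w \<in> W. vs w = V} \<subseteq> {w \<in> W. vs w = {0..<card V}}"
        using act(1,2)[OF ginv] invV by auto
    qed
    then have "(\<Sum>w\<in>{w \<in> W. vs w = V}. F w) = (\<Sum>w\<in>{w \<in> W. vs w = {0..<card V}}. F (act g w))"
      by (rule sum.reindex_bij_betw[symmetric])
    also have "\<dots> = s (card V)" unfolding s_def
      by (rule sum.cong[OF refl]) (use F[OF g(1)] g(3) in auto)
    finally show ?thesis .
  qed
  have "(\<Sum>w\<in>?A. F w) = (\<Sum>V\<in>Pow {0..<n}. \<Sum>w\<in>{w \<in> ?A. vs w = V}. F w)"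
    by (rule sum.group[symmetric]) (use fin in auto)
  also have "\<dots> = (\<Sum>V\<in>Pow {0..<n}. s (card V))"
  proof (rule sum.cong[OF refl])
    fix V assume V: "V \<in> Pow {0..<n}"
    then have "{w \<in> ?A. vs w = V} = {w \<in> W. vs w = V}" by auto
    then show "(\<Sum>w\<in>{w \<in> ?A. vs w = V}. F w) = s (card V)" using relabel V by simp
  qed
  also have "\<dots> = (\<Sum>v\<le>n. \<Sum>V\<in>{V \<in> Pow {0..<n}. card V = v}. s (card V))"
    by (rule sum.group[symmetric]) (auto simp: subset_eq_atLeast0_lessThan_card)
  also have "\<dots> = (\<Sum>v\<le>n. real (n choose v) * s v)"
    by (rule sum.cong) (auto simp: n_subsets)
  \<comment> \<open>The range up to n + M contains both truncations: the binomial vanishes for v >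
    n, the inner sum for v > M.\<close>
  also have "\<dots> = (\<Sum>v\<le>n + M. real (n choose v) * s v)"
    by (rule sum.mono_neutral_left) auto
  also have "\<dots> = (\<Sum>v\<le>M. real (n choose v) * s v)"
  proof (rule sum.mono_neutral_right)
    have "{w \<in> W. vs w = {0..<v}} = {}" if "v > M" for v using M that by fastforce
    then have "s v = 0" if "v > M" for v using that by (simp only: s_def sum.empty)
    then show "\<forall>v\<in>{..n + M} - {..M}. real (n choose v) * s v = 0" by simp
  qed auto
  finally show ?thesis unfolding s_def .
qed

section \<open>Action of relabellings on walks\<close>

definition walk_image :: "(nat \<Rightarrow> nat) \<Rightarrow> nat set \<times> (nat set \<times> nat set) list \<Rightarrow> nat set \<times> (nat set \<times> nat set) list" where
  "walk_image g w = (g ` fst w, map (map_prod ((`) g) ((`) g)) (snd w))"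

lemma walk_valid_image:
  "inj g \<Longrightarrow> walk_valid k (g ` \<tau>) (map (map_prod ((`) g) ((`) g)) ws) = walk_valid k \<tau> ws"
  by (induction k \<tau> ws rule: walk_valid.induct) (auto simp: card_image inj_on_subset inj_image_subset_iff)

lemma walk_end_image:
  "walk_end (g ` \<tau>) (map (map_prod ((`) g) ((`) g)) ws) = g ` walk_end \<tau> ws"
  by (induction \<tau> ws rule: walk_end.induct) auto

lemma walk_complex_image:
  "walk_complex (g ` \<tau>) (map (map_prod ((`) g) ((`) g)) ws) = (`) g ` walk_complex \<tau> ws"
  by (induction \<tau> ws rule: walk_complex.induct) (simp_all add: image_Pow_surj image_Un)

text \<open>The signs depend on the order of the vertices, so only relabellings that are monotone on the
  vertices involved preserve them.\<close>
lemma coboundary_sign_image: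
  assumes g: "inj g" and mono: "strict_mono_on \<eta> g" and fin: "finite \<eta>"
  shows "coboundary_sign (g ` \<eta>) (g ` \<sigma>) = coboundary_sign \<eta> \<sigma>"
proof -
  have d: "g ` \<eta> - g ` \<sigma> = g ` (\<eta> - \<sigma>)" using g by (simp add: image_set_diff)
  have c: "card (g ` \<eta> - g ` \<sigma>) = card (\<eta> - \<sigma>)" unfolding d using g by (simp add: card_image inj_on_subset)
  have "card {w \<in> g ` \<eta>. w < the_elem (g ` \<eta> - g ` \<sigma>)} = card {w \<in> \<eta>. w < the_elem (\<eta> - \<sigma>)}"
    if one: "card (\<eta> - \<sigma>) = 1"
  proof -
    obtain x where x: "\<eta> - \<sigma> = {x}" using one by (rule card_1_singletonE)
    then have "x \<in> \<eta>" by auto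
    then have "{w \<in> g ` \<eta>. w < g x} = g ` {w \<in> \<eta>. w < x}"
      using strict_mono_on_less[OF mono] by auto
    then show ?thesis unfolding d x using g by (simp add: card_image inj_on_subset)
  qed
  then show ?thesis unfolding coboundary_sign_def c using g by (simp add: inj_image_subset_iff)
qed

lemma walk_weight_image:
  "inj g \<Longrightarrow> walk_valid k \<tau> ws \<Longrightarrow> strict_mono_on (\<Union>(walk_complex \<tau> ws)) g \<Longrightarrow>
    walk_weight (g ` \<tau>) (map (map_prod ((`) g) ((`) g)) ws) = walk_weight \<tau> ws"
proof (induction k \<tau> ws rule: walk_valid.induct)
  case (2 k \<tau> \<sigma> \<rho> ws)
  have "strict_mono_on \<sigma> g" "strict_mono_on (\<Union>(walk_complex \<rho> ws)) g" "finite \<sigma>"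
    using 2(3,4) by (auto intro: monotone_on_subset card_ge_0_finite)
  then show ?case using 2 by (simp add: coboundary_sign_image)
qed simp

lemma abs_walk_weight_le_1: "\<bar>walk_weight \<tau> ws\<bar> \<le> 1"
proof (induction \<tau> ws rule: walk_weight.induct)
  case (2 \<tau> \<sigma> \<rho> ws)
  have "\<bar>coboundary_sign \<sigma> \<tau>\<bar> \<le> 1" for \<sigma> \<tau> by (simp add: coboundary_sign_def)
  then have "\<bar>coboundary_sign \<sigma> \<tau>\<bar> * \<bar>coboundary_sign \<sigma> \<rho>\<bar> * \<bar>walk_weight \<rho> ws\<bar> \<le> 1 * 1 * 1"
    using 2 by (intro mult_mono) auto
  then show ?case by (simp add: abs_mult)
qed simp

definition walk_vertices :: "nat set \<times> (nat set \<times> nat set) list \<Rightarrow> nat set" where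
  "walk_vertices w = \<Union>(walk_complex (fst w) (snd w))"

definition all_closed_walks :: "nat \<Rightarrow> nat \<Rightarrow> (nat set \<times> (nat set \<times> nat set) list) set" where
  "all_closed_walks k m = closed_walks k m UNIV"

lemma closed_walks_Pow: "closed_walks k m (Pow S) = {w \<in> all_closed_walks k m. walk_vertices w \<subseteq> S}"
proof -
  have "K \<subseteq> Pow S \<longleftrightarrow> \<Union>K \<subseteq> S" for K :: "nat set set" by blast
  note Pow = this
  show ?thesis
    unfolding closed_walks_def all_closed_walks_def walk_vertices_def Pow
    by (simp add: set_eq_iff)
qed

lemma walk_vertices_image: "walk_vertices (walk_image g w) = g ` walk_vertices w"
  by (auto simp: walk_vertices_def walk_image_def walk_complex_image)

lemma walk_image_closed:
  "inj g \<Longrightarrow> w \<in> all_closed_walks k m \<Longrightarrow> walk_image g w \<in> all_closed_walks k m"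
  by (auto simp: all_closed_walks_def closed_walks_def walk_image_def walk_valid_image walk_end_image)

lemma walk_image_inverse:
  assumes "bij g" shows "walk_image (inv_into UNIV g) (walk_image g w) = w"
proof -
  have "inv_into UNIV g ` g ` S = S" for S using assms by (simp add: bij_is_inj image_inv_f_f)
  then show ?thesis by (cases w) (simp add: walk_image_def map_prod.comp comp_def map_prod_def case_prod_unfold)
qed

definition weight :: "nat set \<times> (nat set \<times> nat set) list \<Rightarrow> real" where
  "weight w = walk_weight (fst w) (snd w)"

definition support :: "nat set \<times> (nat set \<times> nat set) list \<Rightarrow> nat set set" where
  "support w = walk_complex (fst w) (snd w)"

definition walk_sum :: "nat \<Rightarrow> nat \<Rightarrow> nat set set \<Rightarrow> real" where
  "walk_sum k m Y = (\<Sum>w\<in>closed_walks k m Y. weight w)"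

lemma abs_weight_le_1: "\<bar>weight w\<bar> \<le> 1"
  unfolding weight_def by (rule abs_walk_weight_le_1)

lemma walk_vertices_eq: "walk_vertices w = \<Union>(support w)"
  by (simp add: walk_vertices_def support_def)

lemma card_walk_vertices_le:
  assumes "w \<in> all_closed_walks k m" shows "finite (walk_vertices w)" "card (walk_vertices w) \<le> Suc k + m"
proof -
  obtain \<tau> ws where w: "w = (\<tau>, ws)" "walk_valid k \<tau> ws" "length ws = m"
    using assms by (auto simp: all_closed_walks_def closed_walks_def)
  have \<tau>: "card \<tau> = Suc k" by (rule walk_valid_card[OF w(2)])
  then have f: "finite \<tau>" by (auto intro: card_ge_0_finite)
  have *: "finite (walk_vertices w)" "card (walk_vertices w - \<tau>) \<le> m"
    using walk_valid_card_Union[OF w(2)] w by (auto simp: walk_vertices_def)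
  then show "finite (walk_vertices w)" by simp
  have "card (walk_vertices w) \<le> card (\<tau> \<union> (walk_vertices w - \<tau>))"
    using * f by (intro card_mono) auto
  also have "\<dots> \<le> card \<tau> + card (walk_vertices w - \<tau>)" by (rule card_Un_le)
  finally show "card (walk_vertices w) \<le> Suc k + m" using * \<tau> by simp
qed

lemma closed_walks_subset: "closed_walks k m Y = {w \<in> all_closed_walks k m. support w \<subseteq> Y}"
  by (auto simp: closed_walks_def all_closed_walks_def support_def)

lemma support_image: "support (walk_image g w) = (`) g ` support w"
  by (simp add: support_def walk_image_def walk_complex_image)

lemma weight_image:
  assumes "inj g" "w \<in> all_closed_walks k m" "strict_mono_on (walk_vertices w) g"
  shows "weight (walk_image g w) = weight w"
  using assms walk_weight_image[of g k "fst w" "snd w"]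
  by (auto simp: weight_def walk_image_def all_closed_walks_def closed_walks_def walk_vertices_def)

text \<open>The pairs whose covariance can be nonzero: the supports of any other pair share only the
  empty simplex and are independent.\<close>

definition meeting_pairs where
  "meeting_pairs k m = {(w, w'). w \<in> all_closed_walks k m \<and> w' \<in> all_closed_walks k m \<and> walk_vertices w \<inter> walk_vertices w' \<noteq> {}}"

lemma mem_meeting_pairs:
  "(w, w') \<in> meeting_pairs k m \<longleftrightarrow>
    w \<in> all_closed_walks k m \<and> w' \<in> all_closed_walks k m \<and> walk_vertices w \<inter> walk_vertices w' \<noteq> {}"
  unfolding meeting_pairs_def by (simp only: mem_Collect_eq prod.case)

lemma subcomplex_support:
  assumes "walk_vertices w \<subseteq> {0..<n}" shows "subcomplex n (support w)"
proof -
  have "support w \<subseteq> Pow {0..<n}" using assms by (auto simp: walk_vertices_eq)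
  then show ?thesis by (auto simp: subcomplex_def support_def intro: walk_complex_down_closed)
qed

section \<open>Mean and variance of walk sums\<close>

context spatial_law begin

abbreviation expect :: "(nat set set \<Rightarrow> real) \<Rightarrow> real" where
  "expect \<equiv> measure_pmf.expectation P"

lemma finite_set_pmf_law: "finite (set_pmf P)"
  by (rule finite_subset[of _ "Pow (Pow {0..<n})"]) (use set_pmf_subcomplex in \<open>auto simp: subcomplex_def\<close>)

lemma integrable_law: "integrable (measure_pmf P) (f :: _ \<Rightarrow> real)"
  by (rule integrable_measure_pmf_finite[OF finite_set_pmf_law])

lemma expect_indicator: "expect (indicator {X. Y \<subseteq> X}) = cprob Y"
  by (simp add: cprob_def)

lemma expect_cong: "(\<And>Y. Y \<in> set_pmf P \<Longrightarrow> f Y = g Y) \<Longrightarrow> expect f = expect g"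
  by (rule integral_cong_AE) (auto simp: AE_measure_pmf_iff)

abbreviation walks_n :: "nat \<Rightarrow> nat \<Rightarrow> (nat set \<times> (nat set \<times> nat set) list) set" where
  "walks_n k m \<equiv> closed_walks k m (Pow {0..<n})"

lemma finite_walks_n: "finite (walks_n k m)"
  by (rule finite_closed_walks) simp

lemma walk_sum_indicator:
  assumes "Y \<in> set_pmf P"
  shows "walk_sum k m Y = (\<Sum>w\<in>walks_n k m. weight w * indicator {X. support w \<subseteq> X} Y)"
proof -
  have Y: "Y \<subseteq> Pow {0..<n}" using set_pmf_subcomplex[OF assms] by (simp add: subcomplex_def)
  have "closed_walks k m Y = {w \<in> walks_n k m. support w \<subseteq> Y}"
    using Y unfolding closed_walks_subset[of k m Y] closed_walks_subset[of k m "Pow {0..<n}"] by auto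
  then have "walk_sum k m Y = (\<Sum>w\<in>walks_n k m. if support w \<subseteq> Y then weight w else 0)"
    unfolding walk_sum_def by (simp only: sum.inter_filter[OF finite_walks_n])
  also have "\<dots> = (\<Sum>w\<in>walks_n k m. weight w * indicator {X. support w \<subseteq> X} Y)"
    by (rule sum.cong) (auto simp: indicator_def)
  finally show ?thesis .
qed

definition mean :: "nat \<Rightarrow> nat \<Rightarrow> real" where "mean k m = expect (walk_sum k m)"

lemma mean_eq: "mean k m = (\<Sum>w\<in>walks_n k m. weight w * cprob (support w))"
proof -
  have "mean k m = expect (\<lambda>Y. \<Sum>w\<in>walks_n k m. weight w * indicator {X. support w \<subseteq> X} Y)"
    unfolding mean_def by (rule expect_cong) (rule walk_sum_indicator)
  then show ?thesis by (simp add: Bochner_Integration.integral_sum integrable_law expect_indicator cprob_def)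
qed

lemma second_moment_eq:
  "expect (\<lambda>Y. (walk_sum k m Y)\<^sup>2)
    = (\<Sum>w\<in>walks_n k m. \<Sum>w'\<in>walks_n k m. weight w * weight w' * cprob (support w \<union> support w'))"
proof -
  have ind: "indicator {X. A \<subseteq> X} Y * indicator {X. B \<subseteq> X} Y = (indicator {X. A \<union> B \<subseteq> X} Y :: real)" for A B Y :: "nat set set"
    by (auto simp: indicator_def)
  have "expect (\<lambda>Y. (walk_sum k m Y)\<^sup>2) = expect (\<lambda>Y. \<Sum>w\<in>walks_n k m. \<Sum>w'\<in>walks_n k m.
      weight w * weight w' * indicator {X. support w \<union> support w' \<subseteq> X} Y)"
  proof (rule expect_cong)
    fix Y assume Y: "Y \<in> set_pmf P"
    show "(walk_sum k m Y)\<^sup>2 = (\<Sum>w\<in>walks_n k m. \<Sum>w'\<in>walks_n k m.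
      weight w * weight w' * indicator {X. support w \<union> support w' \<subseteq> X} Y)"
      unfolding walk_sum_indicator[OF Y] power2_eq_square sum_product
      by (intro sum.cong refl) (simp only: ind[symmetric] mult_ac)
  qed
  also have "\<dots> = (\<Sum>w\<in>walks_n k m. \<Sum>w'\<in>walks_n k m. weight w * weight w' * expect (indicator {X. support w \<union> support w' \<subseteq> X}))"
    by (simp add: Bochner_Integration.integral_sum integrable_law)
  finally show ?thesis unfolding expect_indicator .
qed

lemma variance_le:
  "expect (\<lambda>Y. (walk_sum k m Y - mean k m)\<^sup>2)
    \<le> (\<Sum>p\<in>{p \<in> meeting_pairs k m. walk_vertices (fst p) \<union> walk_vertices (snd p) \<subseteq> {0..<n}}.
         cprob (support (fst p) \<union> support (snd p)))"
proof -
  let ?W = "walks_n k m"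
  let ?c = "\<lambda>p. weight (fst p) * weight (snd p) *
      (cprob (support (fst p) \<union> support (snd p)) - cprob (support (fst p)) * cprob (support (snd p)))"
  let ?D = "{p \<in> meeting_pairs k m. walk_vertices (fst p) \<union> walk_vertices (snd p) \<subseteq> {0..<n}}"
  have D: "?D \<subseteq> ?W \<times> ?W" unfolding closed_walks_Pow meeting_pairs_def by auto
  have "expect (\<lambda>Y. (walk_sum k m Y - mean k m)\<^sup>2) = expect (\<lambda>Y. (walk_sum k m Y)\<^sup>2) - (mean k m)\<^sup>2"
    using measure_pmf.variance_eq[where X="walk_sum k m", OF integrable_law integrable_law] by (simp add: mean_def)
  also have "\<dots> = (\<Sum>w\<in>?W. \<Sum>w'\<in>?W. ?c (w, w'))"
    unfolding second_moment_eq
    unfolding mean_eq power2_eq_square sum_product sum_subtractf[symmetric]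
    by (intro sum.cong refl) (simp add: algebra_simps)
  also have "\<dots> = (\<Sum>p\<in>?W \<times> ?W. ?c p)" by (simp add: sum.cartesian_product case_prod_unfold)
  also have "\<dots> = (\<Sum>p\<in>?D. ?c p)"
  proof (rule sum.mono_neutral_right[OF _ D])
    show "\<forall>p\<in>?W \<times> ?W - ?D. ?c p = 0"
    proof
      fix p assume p: "p \<in> ?W \<times> ?W - ?D"
      then have dis: "\<Union>(support (fst p)) \<inter> \<Union>(support (snd p)) = {}"
        and sub: "walk_vertices (fst p) \<subseteq> {0..<n}" "walk_vertices (snd p) \<subseteq> {0..<n}"
        unfolding closed_walks_Pow meeting_pairs_def walk_vertices_eq[symmetric] by auto
      have "cprob (support (fst p) \<union> support (snd p)) = cprob (support (fst p)) * cprob (support (snd p))"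
        using subcomplex_support[OF sub(1)] subcomplex_support[OF sub(2)] dis
        by (intro cprob_disjoint) (auto simp: support_def empty_mem_walk_complex)
      then show "?c p = 0" by simp
    qed
  qed (simp add: finite_walks_n)
  also have "\<dots> \<le> (\<Sum>p\<in>?D. cprob (support (fst p) \<union> support (snd p)))"
  proof (rule sum_mono)
    fix p assume p: "p \<in> ?D"
    then have sub: "subcomplex n (support (fst p))" "subcomplex n (support (snd p))"
      using subcomplex_support[of "fst p" n] subcomplex_support[of "snd p" n] by auto
    let ?x = "cprob (support (fst p) \<union> support (snd p)) - cprob (support (fst p)) * cprob (support (snd p))"
    have x: "0 \<le> ?x" "?x \<le> cprob (support (fst p) \<union> support (snd p))"
      using cprob_supermult[OF sub] cprob_nonneg by auto
    have "?c p \<le> \<bar>weight (fst p)\<bar> * \<bar>weight (snd p)\<bar> * ?x"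
      unfolding abs_mult[symmetric] by (rule mult_right_mono[OF abs_ge_self x(1)])
    also have "\<dots> \<le> 1 * 1 * ?x" using x(1) by (intro mult_mono abs_weight_le_1) auto
    finally show "?c p \<le> cprob (support (fst p) \<union> support (snd p))" using x(2) by simp
  qed
  finally show ?thesis .
qed

lemma mean_by_vertex_set:
  "mean k m = (\<Sum>v\<le>Suc k + m. real (n choose v) *
     (\<Sum>w\<in>{w \<in> all_closed_walks k m. walk_vertices w = {0..<v}}. weight w * cprob (support w)))"
  unfolding mean_eq closed_walks_Pow
proof (rule sum_by_vertex_set[where act=walk_image])
  show "finite {w \<in> all_closed_walks k m. walk_vertices w \<subseteq> {0..<n}}"
    using finite_walks_n by (simp only: closed_walks_Pow)
next
  fix w assume "w \<in> all_closed_walks k m"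
  then show "card (walk_vertices w) \<le> Suc k + m" by (rule card_walk_vertices_le)
next
  fix g w assume g: "g permutes {0..<n}" and w: "w \<in> all_closed_walks k m"
  note inj = permutes_inj[OF g]
  show "walk_image g w \<in> all_closed_walks k m" by (rule walk_image_closed[OF inj w])
  show "walk_vertices (walk_image g w) = g ` walk_vertices w" by (rule walk_vertices_image)
  show "walk_image (inv_into UNIV g) (walk_image g w) = w" by (rule walk_image_inverse[OF permutes_bij[OF g]])
  assume "strict_mono_on (walk_vertices w) g"
  then show "weight (walk_image g w) * cprob (support (walk_image g w)) = weight w * cprob (support w)"
    using weight_image[OF inj w] cprob_permute[OF g] by (simp add: support_image)
qed

text \<open>A permutation acts on both components of a pair. The summand carries no signs, so its
  invariance follows from homogeneity for every permutation, monotone or not.\<close>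

lemma variance_le_by_vertex_set:
  "expect (\<lambda>Y. (walk_sum k m Y - mean k m)\<^sup>2)
    \<le> (\<Sum>v\<le>2 * (Suc k + m). real (n choose v) *
       (\<Sum>p\<in>{p \<in> meeting_pairs k m. walk_vertices (fst p) \<union> walk_vertices (snd p) = {0..<v}}.
         cprob (support (fst p) \<union> support (snd p))))"
proof (rule order_trans[OF variance_le], rule eq_refl, rule sum_by_vertex_set[where act="\<lambda>g. map_prod (walk_image g) (walk_image g)"])
  show "finite {p \<in> meeting_pairs k m. walk_vertices (fst p) \<union> walk_vertices (snd p) \<subseteq> {0..<n}}"
    by (rule finite_subset[of _ "walks_n k m \<times> walks_n k m"])
      (auto simp: closed_walks_Pow meeting_pairs_def finite_walks_n[unfolded closed_walks_Pow])
next
  fix p assume "p \<in> meeting_pairs k m"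
  then have "card (walk_vertices (fst p)) \<le> Suc k + m" "card (walk_vertices (snd p)) \<le> Suc k + m"
    using card_walk_vertices_le(2) by (auto simp: meeting_pairs_def)
  then show "card (walk_vertices (fst p) \<union> walk_vertices (snd p)) \<le> 2 * (Suc k + m)"
    using card_Un_le[of "walk_vertices (fst p)" "walk_vertices (snd p)"] unfolding mult_2
    by (meson add_mono order_trans)
next
  fix g p assume g: "g permutes {0..<n}" and p: "p \<in> meeting_pairs k m"
  note inj = permutes_inj[OF g]
  obtain w w' where w: "p = (w, w')" by (rule prod.exhaust)
  have ww: "w \<in> all_closed_walks k m" "w' \<in> all_closed_walks k m" "walk_vertices w \<inter> walk_vertices w' \<noteq> {}"
    using p by (simp_all add: w mem_meeting_pairs)
  have "g ` walk_vertices w \<inter> g ` walk_vertices w' \<noteq> {}"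
    unfolding image_Int[OF inj, symmetric] using ww(3) by simp
  then show "map_prod (walk_image g) (walk_image g) p \<in> meeting_pairs k m"
    using walk_image_closed[OF inj ww(1)] walk_image_closed[OF inj ww(2)]
    by (simp add: w mem_meeting_pairs walk_vertices_image)
  show "walk_vertices (fst (map_prod (walk_image g) (walk_image g) p)) \<union> walk_vertices (snd (map_prod (walk_image g) (walk_image g) p))
      = g ` (walk_vertices (fst p) \<union> walk_vertices (snd p))"
    by (simp add: walk_vertices_image image_Un)
  show "map_prod (walk_image (inv_into UNIV g)) (walk_image (inv_into UNIV g)) (map_prod (walk_image g) (walk_image g) p) = p"
    by (cases p) (simp add: walk_image_inverse[OF permutes_bij[OF g]])
  show "cprob (support (fst (map_prod (walk_image g) (walk_image g) p)) \<union> support (snd (map_prod (walk_image g) (walk_image g) p)))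
      = cprob (support (fst p) \<union> support (snd p))"
    using cprob_permute[OF g, of "support (fst p) \<union> support (snd p)"] by (simp add: support_image image_Un)
qed

text \<open>Closed walks without the closing condition: for upper bounds the sum can then be built
  one free step at a time.\<close>

definition open_walks :: "nat \<Rightarrow> nat \<Rightarrow> nat set \<Rightarrow> (nat set \<times> nat set) list set" where
  "open_walks k m \<tau> = {ws. length ws = m \<and> walk_valid k \<tau> ws \<and> walk_complex \<tau> ws \<subseteq> Pow {0..<n}}"

lemma finite_open_walks: "finite (open_walks k m \<tau>)"
  by (rule finite_subset[of _ "{ws. set ws \<subseteq> Pow {0..<n} \<times> Pow {0..<n} \<and> length ws = m}"])
    (auto simp: open_walks_def finite_lists_length_eq dest!: walk_steps_subset)

text \<open>A new vertex of \<sigma> costs r_k and there are at most n of them; an old vertex costs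
  at most 1 and there are at most \<open>card (\<Union>Y)\<close>.\<close>

lemma sum_extensions_le:
  assumes Y: "subcomplex n Y" and \<tau>: "\<tau> \<in> Y" "card \<tau> = Suc k" and pos: "sprob (Suc k) > 0"
  shows "(\<Sum>\<sigma>\<in>{\<sigma>. \<tau> \<subseteq> \<sigma> \<and> \<sigma> \<subseteq> {0..<n} \<and> card \<sigma> = Suc (Suc k)}. cprob (Y \<union> Pow \<sigma>))
    \<le> (real n * rk P k + card (\<Union>Y)) * cprob Y"
proof -
  let ?S = "{\<sigma>. \<tau> \<subseteq> \<sigma> \<and> \<sigma> \<subseteq> {0..<n} \<and> card \<sigma> = Suc (Suc k)}"
  have \<tau>n: "\<tau> \<subseteq> {0..<n}" using Y \<tau>(1) by (auto simp: subcomplex_def)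
  have sub: "?S \<subseteq> (\<lambda>x. insert x \<tau>) ` ({0..<n} - \<tau>)"
  proof
    fix \<sigma> assume "\<sigma> \<in> ?S"
    then obtain x where "\<sigma> = insert x \<tau>" "x \<notin> \<tau>" "\<sigma> \<subseteq> {0..<n}"
      using walk_step_insert[of \<tau> \<sigma> k] \<tau>(2) by blast
    then show "\<sigma> \<in> (\<lambda>x. insert x \<tau>) ` ({0..<n} - \<tau>)" by auto
  qed
  have "(\<Sum>\<sigma>\<in>?S. cprob (Y \<union> Pow \<sigma>)) \<le> (\<Sum>\<sigma>\<in>(\<lambda>x. insert x \<tau>) ` ({0..<n} - \<tau>). cprob (Y \<union> Pow \<sigma>))"
    by (rule sum_mono2[OF _ sub]) (auto simp: cprob_nonneg)
  also have "\<dots> = (\<Sum>x\<in>{0..<n} - \<tau>. cprob (Y \<union> Pow (insert x \<tau>)))"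
    by (rule sum.reindex_cong[of "\<lambda>x. insert x \<tau>"]) (auto simp: inj_on_def)
  also have "\<dots> \<le> (\<Sum>x\<in>{0..<n}. (if x \<in> \<Union>Y then cprob Y else rk P k * cprob Y))"
  proof (rule sum_le_included[where i=id])
    show "\<forall>x\<in>{0..<n} - \<tau>. \<exists>y\<in>{0..<n}. id y = x \<and> cprob (Y \<union> Pow (insert x \<tau>)) \<le> (if y \<in> \<Union>Y then cprob Y else rk P k * cprob Y)"
    proof
      fix x assume x: "x \<in> {0..<n} - \<tau>"
      have "cprob (Y \<union> Pow (insert x \<tau>)) \<le> (if x \<in> \<Union>Y then cprob Y else rk P k * cprob Y)"
      proof (cases "x \<in> \<Union>Y")
        case False
        then have "cprob (Y \<union> Pow (insert x \<tau>)) = rk P k * cprob Y"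
          using cprob_new_vertex[OF Y \<tau>(1) False] x \<tau>(2) pos by (simp add: rk_eq field_simps)
        then show ?thesis using False by simp
      qed (auto intro: cprob_antimono)
      then show "\<exists>y\<in>{0..<n}. id y = x \<and> cprob (Y \<union> Pow (insert x \<tau>)) \<le> (if y \<in> \<Union>Y then cprob Y else rk P k * cprob Y)"
        using x by auto
    qed
  qed (auto simp: cprob_nonneg rk_nonneg)
  also have "\<dots> \<le> (\<Sum>x\<in>{0..<n}. (if x \<in> \<Union>Y then cprob Y else 0) + rk P k * cprob Y)"
    by (intro sum_mono) (auto simp: cprob_nonneg rk_nonneg)
  also have "\<dots> = card ({0..<n} \<inter> \<Union>Y) * cprob Y + real n * (rk P k * cprob Y)"
    by (simp only: sum.distrib sum.inter_restrict[symmetric] finite_atLeastLessThan sum_constant card_atLeastLessThan) simp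
  also have "{0..<n} \<inter> \<Union>Y = \<Union>Y" using subcomplex_Union[OF Y] by blast
  finally show ?thesis by (simp add: algebra_simps)
qed

text \<open>Each step contributes the bound of \<open>sum_extensions_le\<close> times the k + 2
  choices of the next k-simplex in \<sigma>. The vertex count grows by at most 1 per step, hence the
  summand j, which is the source of the factorial growth of the moments.\<close>

lemma open_walk_sum_le:
  assumes "subcomplex n Y" "\<tau> \<in> Y" "card \<tau> = Suc k" "sprob (Suc k) > 0"
  shows "(\<Sum>ws\<in>open_walks k m \<tau>. cprob (Y \<union> walk_complex \<tau> ws))
    \<le> cprob Y * (\<Prod>j<m. real (Suc (Suc k)) * (real n * rk P k + card (\<Union>Y) + real j))"
  using assms
proof (induction m arbitrary: Y \<tau>)
  case 0
  have "Y \<union> Pow \<tau> = Y" using 0 by (auto simp: subcomplex_def)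
  moreover have "open_walks k 0 \<tau> \<subseteq> {[]}" by (auto simp: open_walks_def)
  then have "(\<Sum>ws\<in>open_walks k 0 \<tau>. cprob (Y \<union> walk_complex \<tau> ws)) \<le> (\<Sum>ws\<in>{[]}. cprob (Y \<union> walk_complex \<tau> ws))"
    by (rule sum_mono2[rotated]) (auto simp: cprob_nonneg)
  ultimately show ?case by simp
next
  case (Suc m)
  note Y = Suc.prems(1) and \<tau> = Suc.prems(2,3) and pos = Suc.prems(4)
  let ?T = "{\<sigma>. \<tau> \<subseteq> \<sigma> \<and> \<sigma> \<subseteq> {0..<n} \<and> card \<sigma> = Suc (Suc k)}"
  let ?F = "\<lambda>\<sigma>. {\<rho>. \<rho> \<subseteq> \<sigma> \<and> card \<rho> = Suc k}"
  define S where "S = Sigma ?T ?F"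
  \<comment> \<open>The bound for the remaining m steps, with j shifted by one since the first step
    may have added a vertex; \<open>prod.lessThan_Suc_shift\<close> reassembles the product at the
    end.\<close>
  define B where "B = (\<Prod>j<m. real (Suc (Suc k)) * (real n * rk P k + card (\<Union>Y) + real (Suc j)))"
  have finT: "finite ?T" by (rule finite_subset[of _ "Pow {0..<n}"]) auto
  have finF: "finite (?F \<sigma>)" "card (?F \<sigma>) = Suc (Suc k)" if "\<sigma> \<in> ?T" for \<sigma>
  proof -
    have "finite \<sigma>" using that finite_subset by blast
    then show "finite (?F \<sigma>)" by simp
    show "card (?F \<sigma>) = Suc (Suc k)" using n_subsets[OF \<open>finite \<sigma>\<close>, of "Suc k"] that binomial_Suc_n[of "Suc k"] by simp
  qed
  have finS: "finite S" unfolding S_def using finT finF(1) by (intro finite_SigmaI)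
  have B: "0 \<le> B" unfolding B_def by (intro prod_nonneg) (auto simp: rk_nonneg)
  have eq: "open_walks k (Suc m) \<tau> \<subseteq> (\<lambda>(p, ws). p # ws) ` (SIGMA p:S. open_walks k m (snd p))"
  proof
    fix ws assume ws: "ws \<in> open_walks k (Suc m) \<tau>"
    then obtain \<sigma> \<rho> ws' where e: "ws = (\<sigma>, \<rho>) # ws'"
      by (cases ws) (auto simp: open_walks_def)
    have *: "walk_valid k \<rho> ws'" "Pow \<sigma> \<subseteq> Pow {0..<n}" "\<rho> \<subseteq> \<sigma>" "\<tau> \<subseteq> \<sigma>" "card \<sigma> = Suc (Suc k)"
      using ws by (simp_all add: e open_walks_def)
    then have "(\<sigma>, \<rho>) \<in> S" using walk_valid_card[OF *(1)] by (auto simp: S_def)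
    moreover have "ws' \<in> open_walks k m \<rho>" using ws by (simp add: e open_walks_def)
    ultimately show "ws \<in> (\<lambda>(p, ws). p # ws) ` (SIGMA p:S. open_walks k m (snd p))" unfolding e by force
  qed
  have "(\<Sum>ws\<in>open_walks k (Suc m) \<tau>. cprob (Y \<union> walk_complex \<tau> ws))
      \<le> (\<Sum>ws\<in>(\<lambda>(p, ws). p # ws) ` (SIGMA p:S. open_walks k m (snd p)). cprob (Y \<union> walk_complex \<tau> ws))"
    by (rule sum_mono2[OF _ eq]) (auto simp: cprob_nonneg finS finite_open_walks)
  also have "\<dots> = (\<Sum>(p, ws)\<in>(SIGMA p:S. open_walks k m (snd p)). cprob (Y \<union> walk_complex \<tau> (p # ws)))"
    by (subst sum.reindex) (auto simp: inj_on_def case_prod_unfold)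
  also have "\<dots> = (\<Sum>p\<in>S. \<Sum>ws\<in>open_walks k m (snd p). cprob (Y \<union> walk_complex \<tau> (p # ws)))"
    by (subst sum.Sigma) (auto simp: finS finite_open_walks)
  also have "\<dots> \<le> (\<Sum>p\<in>S. cprob (Y \<union> Pow (fst p)) * B)"
  proof (rule sum_mono)
    fix p assume p: "p \<in> S"
    obtain \<sigma> \<rho> where e: "p = (\<sigma>, \<rho>)" by force
    have \<sigma>: "\<tau> \<subseteq> \<sigma>" "\<sigma> \<subseteq> {0..<n}" "card \<sigma> = Suc (Suc k)" "\<rho> \<subseteq> \<sigma>" "card \<rho> = Suc k"
      using p by (auto simp: S_def e)
    obtain x where x: "\<sigma> = insert x \<tau>" "x \<notin> \<tau>" by (rule walk_step_insert[OF \<sigma>(1) \<tau>(2) \<sigma>(3)])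
    have "\<Union>(Y \<union> Pow \<sigma>) \<subseteq> insert x (\<Union>Y)" using x \<tau>(1) by auto
    then have "card (\<Union>(Y \<union> Pow \<sigma>)) \<le> card (insert x (\<Union>Y))"
      using subcomplex_finite_Union[OF Y] by (intro card_mono) auto
    also have "\<dots> \<le> Suc (card (\<Union>Y))" by (rule card_insert_le_m1) auto
    finally have c: "real (card (\<Union>(Y \<union> Pow \<sigma>))) \<le> real (card (\<Union>Y)) + 1" by linarith
    have "(\<Sum>ws\<in>open_walks k m \<rho>. cprob (Y \<union> walk_complex \<tau> (p # ws)))
        = (\<Sum>ws\<in>open_walks k m \<rho>. cprob ((Y \<union> Pow \<sigma>) \<union> walk_complex \<rho> ws))"
      by (simp add: e Un_assoc)
    also have "\<dots> \<le> cprob (Y \<union> Pow \<sigma>) * (\<Prod>j<m. real (Suc (Suc k)) * (real n * rk P k + card (\<Union>(Y \<union> Pow \<sigma>)) + real j))"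
      by (rule Suc.IH) (use Y \<sigma> pos in \<open>auto intro: subcomplex_Un subcomplex_Pow\<close>)
    also have "\<dots> \<le> cprob (Y \<union> Pow \<sigma>) * B"
      unfolding B_def using c by (intro mult_left_mono prod_mono) (auto simp: cprob_nonneg rk_nonneg)
    finally show "(\<Sum>ws\<in>open_walks k m (snd p). cprob (Y \<union> walk_complex \<tau> (p # ws))) \<le> cprob (Y \<union> Pow (fst p)) * B"
      by (simp add: e)
  qed
  also have "\<dots> = (\<Sum>\<sigma>\<in>?T. \<Sum>\<rho>\<in>?F \<sigma>. cprob (Y \<union> Pow \<sigma>) * B)"
    unfolding S_def by (subst sum.Sigma[OF finT]) (use finF(1) in \<open>auto simp: case_prod_unfold\<close>)
  also have "\<dots> = (\<Sum>\<sigma>\<in>?T. cprob (Y \<union> Pow \<sigma>) * (B * real (Suc (Suc k))))"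
    by (rule sum.cong[OF refl]) (simp only: sum_constant finF(2) mult_ac)
  also have "\<dots> = (\<Sum>\<sigma>\<in>?T. cprob (Y \<union> Pow \<sigma>)) * (B * real (Suc (Suc k)))"
    by (rule sum_distrib_right[symmetric])
  also have "\<dots> \<le> ((real n * rk P k + card (\<Union>Y)) * cprob Y) * (B * real (Suc (Suc k)))"
    by (rule mult_right_mono[OF sum_extensions_le[OF Y \<tau> pos]]) (use B in auto)
  also have "\<dots> = cprob Y * ((real (Suc (Suc k)) * (real n * rk P k + card (\<Union>Y) + real 0)) * B)"
    by (simp only: of_nat_0 add_0_right mult_ac)
  also have "\<dots> = cprob Y * (\<Prod>j<Suc m. real (Suc (Suc k)) * (real n * rk P k + card (\<Union>Y) + real j))"
    unfolding prod.lessThan_Suc_shift B_def ..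
  finally show ?case .
qed

text \<open>Weights have absolute value at most 1, and there are at most n^(k+1) initial simplices,
  each of probability q_k.\<close>

lemma abs_mean_le:
  assumes pos: "sprob (Suc k) > 0"
  shows "\<bar>mean k m\<bar> \<le> face_scale (Suc k) * (\<Prod>j<m. real (Suc (Suc k)) * (real n * rk P k + real (Suc k) + real j))"
proof -
  let ?T = "{\<tau>. \<tau> \<subseteq> {0..<n} \<and> card \<tau> = Suc k}"
  let ?B = "\<Prod>j<m. real (Suc (Suc k)) * (real n * rk P k + real (Suc k) + real j)"
  have finT: "finite ?T" by simp
  have B: "0 \<le> ?B" by (intro prod_nonneg) (auto simp: rk_nonneg)
  have sub: "walks_n k m \<subseteq> Sigma ?T (open_walks k m)"
  proof
    fix w assume "w \<in> walks_n k m"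
    then obtain \<tau> ws where w: "w = (\<tau>, ws)" "length ws = m" "walk_valid k \<tau> ws" "walk_complex \<tau> ws \<subseteq> Pow {0..<n}"
      by (auto simp: closed_walks_def)
    then show "w \<in> Sigma ?T (open_walks k m)"
      using walk_valid_Pow_subset[OF w(3)] walk_valid_card[OF w(3)] by (auto simp: open_walks_def)
  qed
  have "\<bar>mean k m\<bar> \<le> (\<Sum>w\<in>walks_n k m. \<bar>weight w * cprob (support w)\<bar>)"
    unfolding mean_eq by (rule sum_abs)
  also have "\<dots> \<le> (\<Sum>w\<in>walks_n k m. cprob (support w))"
    by (rule sum_mono) (simp add: abs_mult cprob_nonneg mult_left_le_one_le abs_weight_le_1)
  also have "\<dots> \<le> (\<Sum>w\<in>Sigma ?T (open_walks k m). cprob (support w))"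
    by (rule sum_mono2[OF _ sub]) (use finT finite_open_walks in \<open>auto simp: cprob_nonneg\<close>)
  also have "\<dots> = (\<Sum>\<tau>\<in>?T. \<Sum>ws\<in>open_walks k m \<tau>. cprob (walk_complex \<tau> ws))"
    by (subst sum.Sigma[OF finT]) (auto simp: finite_open_walks support_def case_prod_unfold)
  also have "\<dots> \<le> (\<Sum>\<tau>\<in>?T. sprob (Suc k) * ?B)"
  proof (rule sum_mono)
    fix \<tau> assume \<tau>: "\<tau> \<in> ?T"
    have "(\<Sum>ws\<in>open_walks k m \<tau>. cprob (walk_complex \<tau> ws)) = (\<Sum>ws\<in>open_walks k m \<tau>. cprob (Pow \<tau> \<union> walk_complex \<tau> ws))"
    proof (rule sum.cong[OF refl])
      fix ws assume "ws \<in> open_walks k m \<tau>"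
      then have "Pow \<tau> \<subseteq> walk_complex \<tau> ws" by (intro walk_valid_Pow_subset) (auto simp: open_walks_def)
      then show "cprob (walk_complex \<tau> ws) = cprob (Pow \<tau> \<union> walk_complex \<tau> ws)" by (simp add: Un_absorb1)
    qed
    also have "\<dots> \<le> cprob (Pow \<tau>) * (\<Prod>j<m. real (Suc (Suc k)) * (real n * rk P k + card (\<Union>(Pow \<tau>)) + real j))"
      by (rule open_walk_sum_le) (use \<tau> pos in \<open>auto intro: subcomplex_Pow\<close>)
    finally show "(\<Sum>ws\<in>open_walks k m \<tau>. cprob (walk_complex \<tau> ws)) \<le> sprob (Suc k) * ?B"
      using cprob_Pow[of \<tau>] \<tau> by simp
  qed
  also have "\<dots> = real (n choose Suc k) * (sprob (Suc k) * ?B)"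
    using n_subsets[of "{0..<n}" "Suc k"] by simp
  also have "\<dots> \<le> real n ^ Suc k * (sprob (Suc k) * ?B)"
  proof (rule mult_right_mono)
    have "n choose Suc k \<le> n ^ Suc k"
      by (cases "Suc k \<le> n") (simp_all only: binomial_le_pow binomial_eq_0 not_le zero_le)
    then show "real (n choose Suc k) \<le> real n ^ Suc k" by (metis of_nat_le_iff of_nat_power)
  qed (use B pos in auto)
  finally show ?thesis by (simp only: face_scale_def mult.assoc)
qed

end

lemma binomial_over_power_tendsto:
  "(\<lambda>n. real (n choose v) / real n ^ v) \<longlonglongrightarrow> 1 / fact v"
proof -
  have "(\<lambda>n. (\<Prod>i<v. 1 - real i / real n) / fact v) \<longlonglongrightarrow> (\<Prod>i<v. 1 - 0) / fact v"
    by (intro tendsto_intros lim_const_over_n) simp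
  moreover have "\<forall>\<^sub>F n in sequentially. (\<Prod>i<v. 1 - real i / real n) / fact v = real (n choose v) / real n ^ v"
    using eventually_gt_at_top[of 0]
  proof eventually_elim
    case (elim n)
    have "real (n choose v) = (\<Prod>i<v. real n - real i) / fact v"
      by (simp add: binomial_gbinomial gbinomial_prod_rev atLeast0LessThan)
    moreover have "(\<Prod>i<v. real n - real i) = (\<Prod>i<v. real n * (1 - real i / real n))"
      using elim by (intro prod.cong) (auto simp: field_simps)
    ultimately show ?case using elim by (simp add: prod.distrib)
  qed
  ultimately show ?thesis by (simp add: tendsto_cong)
qed

text \<open>A step of a walk to an already visited vertex either stays inside the complex spanned so far or,
  for complexes with this property, adds a missing edge and hence costs a vanishing factor.\<close>
definition flag_at :: "nat \<Rightarrow> nat set set \<Rightarrow> bool" where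
  "flag_at k Y \<longleftrightarrow> (\<forall>\<tau>\<in>Y. card \<tau> = Suc k \<longrightarrow> (\<forall>x\<in>\<Union>Y. (\<forall>u\<in>\<tau>. {u, x} \<in> Y) \<longrightarrow> insert x \<tau> \<in> Y))"

lemma flag_at_Pow:
  assumes "card \<tau> = Suc k" shows "flag_at k (Pow \<tau>)"
  unfolding flag_at_def by auto

text \<open>A simplex of the new complex that contains x0 lies in \<open>insert x0 \<tau>0\<close>,
  one that does not is old. If x0 is x or belongs to \<tau>, the edges {u, x} force x and \<tau>
  into \<open>insert x0 \<tau>0\<close>; otherwise everything is old and the property of Y
  applies.\<close>

lemma flag_at_new_vertex:
  assumes Y: "\<And>\<sigma> \<rho>. \<sigma> \<in> Y \<Longrightarrow> \<rho> \<subseteq> \<sigma> \<Longrightarrow> \<rho> \<in> Y"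
    and flag: "flag_at k Y" and \<tau>0: "\<tau>0 \<in> Y" and x0: "x0 \<notin> \<Union>Y"
  shows "flag_at k (Y \<union> Pow (insert x0 \<tau>0))"
  unfolding flag_at_def
proof (intro ballI impI)
  fix \<tau> x
  assume \<tau>: "\<tau> \<in> Y \<union> Pow (insert x0 \<tau>0)" "card \<tau> = Suc k" and x: "x \<in> \<Union>(Y \<union> Pow (insert x0 \<tau>0))"
    and edges: "\<forall>u\<in>\<tau>. {u, x} \<in> Y \<union> Pow (insert x0 \<tau>0)"
  have old: "\<rho> \<in> Y" if "\<rho> \<in> Y \<union> Pow (insert x0 \<tau>0)" "x0 \<notin> \<rho>" for \<rho>
    using that \<tau>0 Y[of \<tau>0 \<rho>] by auto
  have new: "\<rho> \<subseteq> insert x0 \<tau>0" if "\<rho> \<in> Y \<union> Pow (insert x0 \<tau>0)" "x0 \<in> \<rho>" for \<rho>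
    using that x0 by auto
  consider "x0 = x" | "x0 \<noteq> x" "x0 \<in> \<tau>" | "x0 \<noteq> x" "x0 \<notin> \<tau>" by blast
  then show "insert x \<tau> \<in> Y \<union> Pow (insert x0 \<tau>0)"
  proof cases
    case 1
    then have "u \<in> insert x0 \<tau>0" if "u \<in> \<tau>" for u using new[of "{u, x}"] edges that by auto
    then show ?thesis using 1 by auto
  next
    case 2
    then have "{x0, x} \<subseteq> insert x0 \<tau>0" "\<tau> \<subseteq> insert x0 \<tau>0" using new[of "{x0, x}"] new[of \<tau>] edges \<tau>(1) by auto
    then show ?thesis by auto
  next
    case 3
    have "\<tau> \<in> Y" using old[OF \<tau>(1)] 3 by simp
    moreover have "x \<in> \<Union>Y" using x 3 \<tau>0 by auto
    moreover have "{u, x} \<in> Y" if "u \<in> \<tau>" for u using old[of "{u, x}"] edges that 3 by auto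
    ultimately have "insert x \<tau> \<in> Y" using flag \<tau>(2) unfolding flag_at_def by blast
    then show ?thesis by simp
  qed
qed

section \<open>Asymptotics\<close>

locale spatial_sequence =
  fixes X :: "nat \<Rightarrow> nat set set pmf" and k :: nat and c :: real
  assumes law: "\<And>n. spatial_law n (X n)"
    and c_pos: "c > 0"
    and faces_lim: "filterlim (\<lambda>n. real n ^ Suc k * qk (X n) k) at_top sequentially"
    and rk_lim: "(\<lambda>n. real n * rk (X n) k) \<longlonglongrightarrow> c"
begin

sublocale L: spatial_law n "X n" for n by (rule law)

abbreviation N :: "nat \<Rightarrow> real" where "N n \<equiv> L.face_scale n (Suc k)"

lemma N_at_top: "filterlim N at_top sequentially"
  using faces_lim unfolding L.face_scale_def L.qk_eq .

lemma N_pos: "\<forall>\<^sub>F n in sequentially. N n > 0"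
  using N_at_top by (simp add: filterlim_at_top_dense)

lemma sprob_pos: "\<forall>\<^sub>F n in sequentially. L.sprob n (Suc k) > 0"
  using N_pos
proof eventually_elim
  case (elim n)
  then have "L.sprob n (Suc k) \<noteq> 0" by (auto simp: L.face_scale_def)
  then show ?case using L.sprob_nonneg[of n "Suc k"] by linarith
qed

text \<open>By \<open>sprob_power_le\<close>, N^j \<le> (n^j Q(j))^(k+1), and N \<le> N^j once N
  \<ge> 1.\<close>

lemma face_scale_at_top:
  assumes j: "1 \<le> j" "j \<le> Suc k"
  shows "filterlim (\<lambda>n. L.face_scale n j) at_top sequentially"
  unfolding filterlim_at_top
proof
  fix Z :: real
  have "\<forall>\<^sub>F n in sequentially. max 1 (\<bar>Z\<bar> ^ Suc k) \<le> N n" using N_at_top by (simp only: filterlim_at_top)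
  then show "\<forall>\<^sub>F n in sequentially. Z \<le> L.face_scale n j"
  proof eventually_elim
    case (elim n)
    have "\<bar>Z\<bar> ^ Suc k \<le> N n" "1 \<le> N n" using elim by auto
    then have "\<bar>Z\<bar> ^ Suc k \<le> N n ^ j" using self_le_power[of "N n" j] j by linarith
    also have "\<dots> = (real n ^ Suc k) ^ j * L.sprob n (Suc k) ^ j" by (simp only: L.face_scale_def power_mult_distrib)
    also have "\<dots> \<le> (real n ^ Suc k) ^ j * L.sprob n j ^ Suc k"
      by (intro mult_left_mono L.sprob_power_le j) simp
    also have "\<dots> = L.face_scale n j ^ Suc k"
      by (simp only: L.face_scale_def power_mult_distrib power_mult[symmetric] mult.commute[of j])
    finally have "\<bar>Z\<bar> \<le> L.face_scale n j"
      by (rule power_le_imp_le_base) (simp add: L.face_scale_nonneg)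
    then show ?case by simp
  qed
qed

lemma inverse_face_scale_tendsto:
  "1 \<le> j \<Longrightarrow> j \<le> Suc k \<Longrightarrow> (\<lambda>n. 1 / L.face_scale n j) \<longlonglongrightarrow> 0"
  by (intro tendsto_divide_0[OF tendsto_const] filterlim_at_top_imp_at_infinity face_scale_at_top)

text \<open>The bound Q(1) \<alpha>^(k+1) \<le> r_k is multiplied by n; a (k+1)-st root then turns
  convergence of the power into convergence of \<alpha>.\<close>

lemma edge_ratio_tendsto: "(\<lambda>n. L.edge_ratio n k) \<longlonglongrightarrow> 0"
proof -
  have "(\<lambda>n. L.edge_ratio n k ^ Suc k) \<longlonglongrightarrow> 0"
  proof (rule tendsto_sandwich[where f="\<lambda>_. 0" and h="\<lambda>n. (real n * rk (X n) k) * (1 / L.face_scale n 1)"])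
    have "\<forall>\<^sub>F n in sequentially. L.face_scale n 1 > 0"
      using face_scale_at_top[of 1] by (simp add: filterlim_at_top_dense)
    then show "\<forall>\<^sub>F n in sequentially. L.edge_ratio n k ^ Suc k \<le> (real n * rk (X n) k) * (1 / L.face_scale n 1)"
      using sprob_pos
    proof eventually_elim
      case (elim n)
      have "real n * (L.sprob n 1 * L.edge_ratio n k ^ Suc k) \<le> real n * rk (X n) k"
        by (intro mult_left_mono L.edge_ratio_power_le elim) simp
      then have "L.face_scale n 1 * L.edge_ratio n k ^ Suc k \<le> real n * rk (X n) k"
        by (simp only: L.face_scale_def power_one_right mult.assoc)
      then show ?case using elim(1) by (simp only: pos_le_divide_eq mult.commute times_divide_eq_right mult_1_right)
    qed
    have "(\<lambda>n. (real n * rk (X n) k) * (1 / L.face_scale n 1)) \<longlonglongrightarrow> c * 0"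
      by (intro tendsto_mult rk_lim inverse_face_scale_tendsto) auto
    then show "(\<lambda>n. (real n * rk (X n) k) * (1 / L.face_scale n 1)) \<longlonglongrightarrow> 0" by simp
  qed (auto simp: L.edge_ratio_nonneg)
  then have "(\<lambda>n. root (Suc k) (L.edge_ratio n k ^ Suc k)) \<longlonglongrightarrow> root (Suc k) 0"
    by (rule tendsto_real_root)
  then show ?thesis by (simp only: real_root_power_cancel[OF zero_less_Suc L.edge_ratio_nonneg] real_root_zero)
qed

lemma growth_tendsto: "(\<lambda>n. L.growth n k) \<longlonglongrightarrow> max 1 c"
  unfolding L.growth_def by (intro tendsto_max tendsto_const rk_lim)

lemma eventually_subcomplex:
  assumes "finite (\<Union>Y)" and closed: "\<And>\<sigma> \<rho>. \<sigma> \<in> Y \<Longrightarrow> \<rho> \<subseteq> \<sigma> \<Longrightarrow> \<rho> \<in> Y"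
  shows "\<forall>\<^sub>F n in sequentially. subcomplex n Y"
proof -
  obtain b where b: "\<Union>Y \<subseteq> {0..<b}"
    using finite_nat_bounded[OF assms(1)] by (auto simp: lessThan_atLeast0)
  show ?thesis using eventually_ge_at_top[of b]
  proof eventually_elim
    case (elim n)
    then have "Y \<subseteq> Pow {0..<n}" using b by fastforce
    then show ?case unfolding subcomplex_def by (intro conjI ballI allI impI) (auto intro: closed)
  qed
qed

text \<open>In the limit a step changes nothing if \<sigma> is already in Y, gives a factor c if it
  adds a vertex, and 0 if it adds a missing edge; after the last kind the remaining steps are merely
  bounded by powers of \<open>growth\<close>. The first two kinds preserve \<open>flag_at\<close>,
  so up to the first missing edge the dichotomy for old vertices stays available.\<close>

lemma walk_limit:
  assumes "finite (\<Union>Y)" "\<And>\<sigma> \<rho>. \<sigma> \<in> Y \<Longrightarrow> \<rho> \<subseteq> \<sigma> \<Longrightarrow> \<rho> \<in> Y" "flag_at k Y" "\<tau> \<in> Y" "walk_valid k \<tau> ws"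
    "(\<lambda>n. L.scaled n Y / N n) \<longlonglongrightarrow> l"
  shows "\<exists>l'. (\<lambda>n. L.scaled n (Y \<union> walk_complex \<tau> ws) / N n) \<longlonglongrightarrow> l'"
  using assms
proof (induction ws arbitrary: Y \<tau> l)
  case Nil
  have "Y \<union> walk_complex \<tau> [] = Y" using Nil(2)[OF Nil(4)] by auto
  then show ?case using Nil(6) by auto
next
  case (Cons p ws)
  obtain \<sigma> \<rho> where p: "p = (\<sigma>, \<rho>)" by force
  have eq: "Y \<union> walk_complex \<tau> (p # ws) = (Y \<union> Pow \<sigma>) \<union> walk_complex \<rho> ws" by (auto simp: p)
  have v: "card \<tau> = Suc k" "card \<sigma> = Suc (Suc k)" "\<tau> \<subseteq> \<sigma>" "\<rho> \<subseteq> \<sigma>" "walk_valid k \<rho> ws"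
    using Cons.prems(5) by (auto simp: p)
  obtain x where x: "\<sigma> = insert x \<tau>" "x \<notin> \<tau>" by (rule walk_step_insert[OF v(3,1,2)])
  have sub: "\<forall>\<^sub>F n in sequentially. subcomplex n Y" by (rule eventually_subcomplex[OF Cons.prems(1,2)])
  consider "\<sigma> \<in> Y" | "\<sigma> \<notin> Y" "x \<in> \<Union>Y" | "x \<notin> \<Union>Y" by blast
  then show ?case
  proof cases
    case 1
    have "Y \<union> Pow \<sigma> = Y" using Cons.prems(2)[OF 1] by auto
    moreover have "\<exists>l'. (\<lambda>n. L.scaled n (Y \<union> walk_complex \<rho> ws) / N n) \<longlonglongrightarrow> l'"
      by (rule Cons.IH[OF Cons.prems(1,2,3) _ v(5) Cons.prems(6)]) (use Cons.prems(2)[OF 1 v(4)] in auto)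
    ultimately show ?thesis unfolding eq by simp
  next
    case 2
    \<comment> \<open>Contrapositive of \<open>flag_at\<close>: \<open>insert x \<tau>\<close> is
      not in Y although x is an old vertex.\<close>
    obtain u where u: "u \<in> \<tau>" "{u, x} \<notin> Y"
      using Cons.prems(3,4) 2 v(1) x(1) unfolding flag_at_def by blast
    have "(\<lambda>n. L.scaled n (Y \<union> walk_complex \<tau> (p # ws)) / N n) \<longlonglongrightarrow> 0"
    proof (rule tendsto_sandwich[where f="\<lambda>_. 0" and h="\<lambda>n. L.growth n k ^ length ws * L.edge_ratio n k * (L.scaled n Y / N n)"])
      show "\<forall>\<^sub>F n in sequentially. 0 \<le> L.scaled n (Y \<union> walk_complex \<tau> (p # ws)) / N n"
        by (simp add: L.scaled_nonneg L.face_scale_nonneg)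
      show "\<forall>\<^sub>F n in sequentially. L.scaled n (Y \<union> walk_complex \<tau> (p # ws)) / N n
          \<le> L.growth n k ^ length ws * L.edge_ratio n k * (L.scaled n Y / N n)"
        using sub sprob_pos
      proof eventually_elim
        case (elim n)
        have \<sigma>Y: "\<sigma> \<subseteq> \<Union>Y" using x 2 Cons.prems(4) by auto
        then have \<sigma>n: "\<sigma> \<subseteq> {0..<n}" using L.subcomplex_Union[OF elim(1)] by blast
        have g: "0 \<le> L.growth n k" using L.growth_ge_1[of n k] by linarith
        have "L.scaled n (Y \<union> Pow \<sigma> \<union> walk_complex \<rho> ws) \<le> L.growth n k ^ length ws * L.scaled n (Y \<union> Pow \<sigma>)"
          by (rule L.scaled_walk_le[OF _ _ v(5) elim(2)])
            (use v(4) L.subcomplex_Un[OF elim(1) L.subcomplex_Pow[OF \<sigma>n]] in auto)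
        also have "\<dots> \<le> L.growth n k ^ length ws * (L.edge_ratio n k * L.scaled n Y)"
        proof (rule mult_left_mono)
          show "L.scaled n (Y \<union> Pow \<sigma>) \<le> L.edge_ratio n k * L.scaled n Y"
            by (rule L.scaled_missing_edge[OF elim(1) \<sigma>Y v(2) _ _ _ u(2) elim(2)]) (use x u in auto)
        qed (simp add: g)
        finally have "L.scaled n (Y \<union> walk_complex \<tau> (p # ws)) \<le> L.growth n k ^ length ws * L.edge_ratio n k * L.scaled n Y"
          by (simp only: eq mult.assoc)
        then have "L.scaled n (Y \<union> walk_complex \<tau> (p # ws)) / N n \<le> (L.growth n k ^ length ws * L.edge_ratio n k * L.scaled n Y) / N n"
          by (rule divide_right_mono) (rule L.face_scale_nonneg)
        then show ?case by simp
      qed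
      have "(\<lambda>n. L.growth n k ^ length ws * L.edge_ratio n k * (L.scaled n Y / N n)) \<longlonglongrightarrow> max 1 c ^ length ws * 0 * l"
        by (intro tendsto_mult tendsto_power growth_tendsto edge_ratio_tendsto Cons.prems(6))
      then show "(\<lambda>n. L.growth n k ^ length ws * L.edge_ratio n k * (L.scaled n Y / N n)) \<longlonglongrightarrow> 0" by simp
    qed simp
    then show ?thesis by blast
  next
    case 3
    have "\<exists>l'. (\<lambda>n. L.scaled n ((Y \<union> Pow \<sigma>) \<union> walk_complex \<rho> ws) / N n) \<longlonglongrightarrow> l'"
    proof (rule Cons.IH)
      have "finite \<sigma>" using v(2) by (auto intro: card_ge_0_finite)
      then show "finite (\<Union>(Y \<union> Pow \<sigma>))" using Cons.prems(1) by simp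
      show "\<rho>' \<in> Y \<union> Pow \<sigma>" if "\<sigma>' \<in> Y \<union> Pow \<sigma>" "\<rho>' \<subseteq> \<sigma>'" for \<sigma>' \<rho>'
        using that Cons.prems(2)[of \<sigma>' \<rho>'] by auto
      show "flag_at k (Y \<union> Pow \<sigma>)"
        unfolding x(1) by (rule flag_at_new_vertex[OF Cons.prems(2,3,4) 3])
      show "\<rho> \<in> Y \<union> Pow \<sigma>" using v(4) by auto
      show "walk_valid k \<rho> ws" by (rule v(5))
      have "\<forall>\<^sub>F n in sequentially. real n * rk (X n) k * (L.scaled n Y / N n) = L.scaled n (Y \<union> Pow \<sigma>) / N n"
        using sub sprob_pos eventually_gt_at_top[of x]
        by eventually_elim (simp add: x(1) L.scaled_new_vertex[OF _ Cons.prems(4) v(1) 3])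
      moreover have "(\<lambda>n. real n * rk (X n) k * (L.scaled n Y / N n)) \<longlonglongrightarrow> c * l"
        by (intro tendsto_mult[OF rk_lim Cons.prems(6)])
      ultimately show "(\<lambda>n. L.scaled n (Y \<union> Pow \<sigma>) / N n) \<longlonglongrightarrow> c * l"
        by (rule Lim_transform_eventually[rotated])
    qed
    then show ?thesis unfolding eq .
  qed
qed

lemma scaled_Pow_eq:
  assumes "card \<tau> = Suc k" "\<tau> \<subseteq> {0..<n}" shows "L.scaled n (Pow \<tau>) = N n"
  using assms L.cprob_Pow[OF assms(2)] by (simp add: L.scaled_def L.face_scale_def)

lemma eventually_subset_interval:
  assumes "finite V" shows "\<forall>\<^sub>F n in sequentially. V \<subseteq> {0..<n}"
proof -
  obtain b where "V \<subseteq> {0..<b}"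
    using finite_nat_bounded[OF assms] by (auto simp: lessThan_atLeast0)
  then show ?thesis by (intro eventually_sequentiallyI[of b]) fastforce
qed

lemma closed_walk_limit:
  assumes "w \<in> all_closed_walks k m"
  shows "\<exists>l. (\<lambda>n. L.scaled n (support w) / N n) \<longlonglongrightarrow> l"
proof -
  obtain \<tau> ws where w: "w = (\<tau>, ws)" "walk_valid k \<tau> ws"
    using assms by (auto simp: all_closed_walks_def closed_walks_def)
  have \<tau>: "card \<tau> = Suc k" by (rule walk_valid_card[OF w(2)])
  then have f: "finite \<tau>" by (auto intro: card_ge_0_finite)
  have "\<exists>l. (\<lambda>n. L.scaled n (Pow \<tau> \<union> walk_complex \<tau> ws) / N n) \<longlonglongrightarrow> l"
  proof (rule walk_limit[OF _ _ flag_at_Pow[OF \<tau>] _ w(2)])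
    have "\<forall>\<^sub>F n in sequentially. 1 = L.scaled n (Pow \<tau>) / N n"
      using eventually_subset_interval[OF f] N_pos
      by eventually_elim (simp add: scaled_Pow_eq[OF \<tau>])
    then show "(\<lambda>n. L.scaled n (Pow \<tau>) / N n) \<longlonglongrightarrow> 1"
      by (rule Lim_transform_eventually[OF tendsto_const])
  qed (use f in auto)
  moreover have "Pow \<tau> \<union> walk_complex \<tau> ws = support w"
    using walk_valid_Pow_subset[OF w(2)] by (auto simp: support_def w(1))
  ultimately show ?thesis by simp
qed

text \<open>After \<open>mean_by_vertex_set\<close> the index sets are independent of n. The
  binomial is split as its quotient by n^v, which converges, times n^v, which joins the probability
  to form \<open>scaled\<close>; every term then converges.\<close>

lemma mean_limit: "\<exists>A. (\<lambda>n. L.mean n k m / N n) \<longlonglongrightarrow> A"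
proof -
  have "\<forall>w\<in>all_closed_walks k m. \<exists>l. (\<lambda>n. L.scaled n (support w) / N n) \<longlonglongrightarrow> l"
    using closed_walk_limit by blast
  then obtain l where l: "\<And>w. w \<in> all_closed_walks k m \<Longrightarrow> (\<lambda>n. L.scaled n (support w) / N n) \<longlonglongrightarrow> l w"
    by metis
  let ?W = "\<lambda>v. {w \<in> all_closed_walks k m. walk_vertices w = {0..<v}}"
  have "(\<lambda>n. \<Sum>v\<le>Suc k + m. (real (n choose v) / real n ^ v) * (\<Sum>w\<in>?W v. weight w * (L.scaled n (support w) / N n)))
      \<longlonglongrightarrow> (\<Sum>v\<le>Suc k + m. (1 / fact v) * (\<Sum>w\<in>?W v. weight w * l w))"
    by (intro tendsto_sum tendsto_mult tendsto_const binomial_over_power_tendsto l) auto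
  moreover have "\<forall>\<^sub>F n in sequentially. (\<Sum>v\<le>Suc k + m. (real (n choose v) / real n ^ v) * (\<Sum>w\<in>?W v. weight w * (L.scaled n (support w) / N n)))
      = L.mean n k m / N n"
    using eventually_gt_at_top[of 0]
  proof eventually_elim
    case (elim n)
    have "(real (n choose v) / real n ^ v) * (\<Sum>w\<in>?W v. weight w * (L.scaled n (support w) / N n))
        = real (n choose v) * (\<Sum>w\<in>?W v. weight w * L.cprob n (support w)) / N n" for v
    proof -
      have "weight w * (L.scaled n (support w) / N n) = real n ^ v * (weight w * L.cprob n (support w) / N n)" if "w \<in> ?W v" for w
      proof -
        have "\<Union>(support w) = {0..<v}" using that by (simp add: walk_vertices_eq)
        then show ?thesis by (simp only: L.scaled_def card_atLeastLessThan diff_zero) simp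
      qed
      then have "(\<Sum>w\<in>?W v. weight w * (L.scaled n (support w) / N n)) = (\<Sum>w\<in>?W v. real n ^ v * (weight w * L.cprob n (support w) / N n))"
        by (rule sum.cong[OF refl])
      also have "\<dots> = real n ^ v * ((\<Sum>w\<in>?W v. weight w * L.cprob n (support w)) / N n)"
        by (simp only: sum_distrib_left sum_divide_distrib)
      finally show ?thesis using elim by simp
    qed
    then show ?case unfolding L.mean_by_vertex_set sum_divide_distrib by (rule sum.cong[OF refl])
  qed
  ultimately show ?thesis by (blast intro: Lim_transform_eventually)
qed

lemma scaled_support_le:
  assumes w: "w \<in> all_closed_walks k m" and pos: "L.sprob n (Suc k) > 0"
  shows "L.scaled n (support w) \<le> L.growth n k ^ m * N n"
proof -
  obtain \<tau> ws where w': "w = (\<tau>, ws)" "walk_valid k \<tau> ws" "length ws = m"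
    using w by (auto simp: all_closed_walks_def closed_walks_def)
  have \<tau>: "card \<tau> = Suc k" by (rule walk_valid_card[OF w'(2)])
  have eq: "Pow \<tau> \<union> walk_complex \<tau> ws = support w"
    using walk_valid_Pow_subset[OF w'(2)] by (auto simp: support_def w'(1))
  have g: "0 \<le> L.growth n k" using L.growth_ge_1[of n k] by linarith
  show ?thesis
  proof (cases "\<tau> \<subseteq> {0..<n}")
    case True
    have "L.scaled n (Pow \<tau> \<union> walk_complex \<tau> ws) \<le> L.growth n k ^ length ws * L.scaled n (Pow \<tau>)"
      by (rule L.scaled_walk_le[OF L.subcomplex_Pow[OF True] _ w'(2) pos]) simp
    then show ?thesis by (simp only: eq scaled_Pow_eq[OF \<tau> True] w'(3))
  next
    case False
    have "\<tau> \<in> support w" using eq by auto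
    then have "L.scaled n (support w) = 0" using False by (rule L.scaled_zero[rotated])
    then show ?thesis by (simp add: g L.face_scale_nonneg)
  qed
qed

text \<open>The first walk contributes at most growth^m N, the second growth^m N times the error
  term of \<open>scaled_walk_pair_le\<close>. Division by N^2 leaves a bounded factor times an error
  that tends to 0.\<close>

lemma pair_limit:
  assumes p: "(w, w') \<in> meeting_pairs k m"
  shows "(\<lambda>n. L.scaled n (support w \<union> support w') / (N n)\<^sup>2) \<longlonglongrightarrow> 0"
proof -
  have w: "w \<in> all_closed_walks k m" "w' \<in> all_closed_walks k m" "walk_vertices w \<inter> walk_vertices w' \<noteq> {}"
    using p by (simp_all add: mem_meeting_pairs)
  obtain \<tau> ws where w': "w' = (\<tau>, ws)" "walk_valid k \<tau> ws" "length ws = m"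
    using w(2) by (auto simp: all_closed_walks_def closed_walks_def)
  have supp: "support w' = walk_complex \<tau> ws" by (simp add: support_def w'(1))
  define err where "err n = L.edge_ratio n k + (\<Sum>j\<in>{1..Suc k}. 1 / L.face_scale n j)" for n
  have err: "err \<longlonglongrightarrow> 0 + (\<Sum>j\<in>{1..Suc k}. 0)"
    unfolding err_def by (intro tendsto_add edge_ratio_tendsto tendsto_sum inverse_face_scale_tendsto) auto
  show ?thesis
  proof (rule tendsto_sandwich[where f="\<lambda>_. 0" and h="\<lambda>n. L.growth n k ^ m * L.growth n k ^ m * err n"])
    show "\<forall>\<^sub>F n in sequentially. 0 \<le> L.scaled n (support w \<union> support w') / (N n)\<^sup>2"
      by (simp add: L.scaled_nonneg)
    show "\<forall>\<^sub>F n in sequentially. L.scaled n (support w \<union> support w') / (N n)\<^sup>2 \<le> L.growth n k ^ m * L.growth n k ^ m * err n"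
      using sprob_pos N_pos eventually_subset_interval[OF card_walk_vertices_le(1)[OF w(1)]] eventually_gt_at_top[of 0]
    proof eventually_elim
      case (elim n)
      have g: "0 \<le> L.growth n k" using L.growth_ge_1[of n k] by linarith
      have e: "0 \<le> err n" unfolding err_def
        by (intro add_nonneg_nonneg sum_nonneg) (auto simp: L.edge_ratio_nonneg L.face_scale_nonneg)
      have "L.scaled n (support w \<union> support w') \<le> L.growth n k ^ m * L.scaled n (support w) * N n * err n"
        unfolding supp err_def w'(3)[symmetric]
      proof (rule L.scaled_walk_pair_le[OF subcomplex_support[OF elim(3)] _ w'(2) _ elim(4,1)])
        show "{} \<in> support w" by (simp add: support_def empty_mem_walk_complex)
        show "\<Union>(walk_complex \<tau> ws) \<inter> \<Union>(support w) \<noteq> {}"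
          using w(3) by (simp add: walk_vertices_eq supp Int_commute)
      qed
      also have "\<dots> \<le> L.growth n k ^ m * (L.growth n k ^ m * N n) * N n * err n"
        using scaled_support_le[OF w(1) elim(1)] g e elim(2)
        by (intro mult_right_mono mult_left_mono) auto
      finally show ?case using elim(2) by (simp add: power2_eq_square field_simps)
    qed
    have "(\<lambda>n. L.growth n k ^ m * L.growth n k ^ m * err n) \<longlonglongrightarrow> max 1 c ^ m * max 1 c ^ m * (0 + (\<Sum>j\<in>{1..Suc k}. 0))"
      by (intro tendsto_mult tendsto_power growth_tendsto err)
    then show "(\<lambda>n. L.growth n k ^ m * L.growth n k ^ m * err n) \<longlonglongrightarrow> 0" by simp
  qed simp
qed

definition variance_walk_sum :: "nat \<Rightarrow> nat \<Rightarrow> real" where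
  "variance_walk_sum m n = measure_pmf.expectation (X n) (\<lambda>Y. (walk_sum k m Y - L.mean n k m)\<^sup>2)"

lemma variance_limit: "(\<lambda>n. variance_walk_sum m n / (N n)\<^sup>2) \<longlonglongrightarrow> 0"
proof -
  let ?W = "\<lambda>v. {p \<in> meeting_pairs k m. walk_vertices (fst p) \<union> walk_vertices (snd p) = {0..<v}}"
  let ?h = "\<lambda>n. \<Sum>v\<le>2 * (Suc k + m). (real (n choose v) / real n ^ v) * (\<Sum>p\<in>?W v. L.scaled n (support (fst p) \<union> support (snd p)) / (N n)\<^sup>2)"
  show ?thesis
  proof (rule tendsto_sandwich[where f="\<lambda>_. 0" and h="?h"])
    show "\<forall>\<^sub>F n in sequentially. 0 \<le> variance_walk_sum m n / (N n)\<^sup>2"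
      by (simp add: variance_walk_sum_def)
    have "?h \<longlonglongrightarrow> (\<Sum>v\<le>2 * (Suc k + m). (1 / fact v) * (\<Sum>p\<in>?W v. 0))"
    proof (intro tendsto_sum tendsto_mult binomial_over_power_tendsto)
      fix v p assume "p \<in> ?W v"
      then have "(fst p, snd p) \<in> meeting_pairs k m" by simp
      then show "(\<lambda>n. L.scaled n (support (fst p) \<union> support (snd p)) / (N n)\<^sup>2) \<longlonglongrightarrow> 0" by (rule pair_limit)
    qed
    then show "?h \<longlonglongrightarrow> 0" by simp
    show "\<forall>\<^sub>F n in sequentially. variance_walk_sum m n / (N n)\<^sup>2 \<le> ?h n"
      using eventually_gt_at_top[of 0]
    proof eventually_elim
      case (elim n)
      have "(real (n choose v) / real n ^ v) * (\<Sum>p\<in>?W v. L.scaled n (support (fst p) \<union> support (snd p)) / (N n)\<^sup>2)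
          = real (n choose v) * (\<Sum>p\<in>?W v. L.cprob n (support (fst p) \<union> support (snd p))) / (N n)\<^sup>2" for v
      proof -
        have "L.scaled n (support (fst p) \<union> support (snd p)) = real n ^ v * L.cprob n (support (fst p) \<union> support (snd p))" if "p \<in> ?W v" for p
        proof -
          have "\<Union>(support (fst p) \<union> support (snd p)) = {0..<v}" using that by (simp add: walk_vertices_eq)
          then show ?thesis by (simp only: L.scaled_def card_atLeastLessThan diff_zero)
        qed
        then have "(\<Sum>p\<in>?W v. L.scaled n (support (fst p) \<union> support (snd p)) / (N n)\<^sup>2)
            = (\<Sum>p\<in>?W v. real n ^ v * L.cprob n (support (fst p) \<union> support (snd p)) / (N n)\<^sup>2)"
          by (intro sum.cong[OF refl]) (simp only:)
        also have "\<dots> = real n ^ v * (\<Sum>p\<in>?W v. L.cprob n (support (fst p) \<union> support (snd p))) / (N n)\<^sup>2"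
          by (simp only: sum_distrib_left sum_divide_distrib)
        finally show ?thesis using elim by simp
      qed
      then have "?h n = (\<Sum>v\<le>2 * (Suc k + m). real (n choose v) * (\<Sum>p\<in>?W v. L.cprob n (support (fst p) \<union> support (snd p)))) / (N n)\<^sup>2"
        by (simp only: sum_divide_distrib)
      then show ?case unfolding variance_walk_sum_def
        using divide_right_mono[OF L.variance_le_by_vertex_set[of n k m], of "(N n)\<^sup>2"] by simp
    qed
  qed simp
qed

definition A :: "nat \<Rightarrow> real" where "A m = lim (\<lambda>n. L.mean n k m / N n)"

lemma mean_tendsto: "(\<lambda>n. L.mean n k m / N n) \<longlonglongrightarrow> A m"
proof -
  obtain B where B: "(\<lambda>n. L.mean n k m / N n) \<longlonglongrightarrow> B" using mean_limit by blast
  have "A m = B" unfolding A_def by (rule limI[OF B])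
  then show ?thesis using B by (simp only:)
qed

text \<open>Chebyshev's inequality. Half of \<delta> is spent on the distance from the scaled mean
  to \<open>A m\<close>, the other half on the deviation from the mean; hence 4 /
  \<delta>^2.\<close>

lemma walk_sum_tendsto_in_prob:
  assumes \<delta>: "\<delta> > 0"
  shows "(\<lambda>n. measure_pmf.prob (X n) {Y. \<bar>walk_sum k m Y / N n - A m\<bar> \<ge> \<delta>}) \<longlonglongrightarrow> 0"
proof (rule tendsto_sandwich[where f="\<lambda>_. 0" and h="\<lambda>n. (4 / \<delta>\<^sup>2) * (variance_walk_sum m n / (N n)\<^sup>2)"])
  have "(\<lambda>n. (4 / \<delta>\<^sup>2) * (variance_walk_sum m n / (N n)\<^sup>2)) \<longlonglongrightarrow> (4 / \<delta>\<^sup>2) * 0"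
    by (intro tendsto_mult tendsto_const variance_limit)
  then show "(\<lambda>n. (4 / \<delta>\<^sup>2) * (variance_walk_sum m n / (N n)\<^sup>2)) \<longlonglongrightarrow> 0" by simp
  have "\<forall>\<^sub>F n in sequentially. dist (L.mean n k m / N n) (A m) < \<delta> / 2"
    by (rule tendstoD[OF mean_tendsto]) (use \<delta> in simp)
  then show "\<forall>\<^sub>F n in sequentially. measure_pmf.prob (X n) {Y. \<bar>walk_sum k m Y / N n - A m\<bar> \<ge> \<delta>}
      \<le> (4 / \<delta>\<^sup>2) * (variance_walk_sum m n / (N n)\<^sup>2)"
    using N_pos
  proof eventually_elim
    case (elim n)
    have "{Y. \<bar>walk_sum k m Y / N n - A m\<bar> \<ge> \<delta>} \<subseteq> {Y. \<delta> * N n / 2 \<le> \<bar>walk_sum k m Y - L.mean n k m\<bar>}"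
    proof
      fix Y assume "Y \<in> {Y. \<bar>walk_sum k m Y / N n - A m\<bar> \<ge> \<delta>}"
      then have "\<delta> / 2 \<le> \<bar>walk_sum k m Y / N n - L.mean n k m / N n\<bar>"
        using elim(1) unfolding dist_real_def mem_Collect_eq by linarith
      also have "\<dots> = \<bar>walk_sum k m Y - L.mean n k m\<bar> / N n"
        using elim(2) by (simp add: diff_divide_distrib[symmetric])
      finally show "Y \<in> {Y. \<delta> * N n / 2 \<le> \<bar>walk_sum k m Y - L.mean n k m\<bar>}"
        using elim(2) by (simp add: field_simps)
    qed
    then have "measure_pmf.prob (X n) {Y. \<bar>walk_sum k m Y / N n - A m\<bar> \<ge> \<delta>}
        \<le> measure_pmf.prob (X n) {Y. \<delta> * N n / 2 \<le> \<bar>walk_sum k m Y - L.mean n k m\<bar>}"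
      by (rule measure_pmf.finite_measure_mono) simp
    also have "\<dots> \<le> variance_walk_sum m n / (\<delta> * N n / 2)\<^sup>2"
      using measure_pmf.Chebyshev_inequality[of "walk_sum k m" "X n" "\<delta> * N n / 2"] L.integrable_law[of n] \<delta> elim(2)
      by (simp add: variance_walk_sum_def L.mean_def)
    also have "\<dots> = (4 / \<delta>\<^sup>2) * (variance_walk_sum m n / (N n)\<^sup>2)"
      by (simp add: power_mult_distrib power_divide)
    finally show ?case .
  qed
qed simp_all

text \<open>Walks of length 0 are the k-simplices. Thus \<open>A 0\<close> is the limit of the
  expected f_k / N and becomes the denominator of the limiting moments, so its positivity
  matters.\<close>

lemma A_0: "A 0 = 1 / fact (Suc k)"
proof (rule LIMSEQ_unique[OF mean_tendsto])
  have "\<forall>\<^sub>F n in sequentially. real (n choose Suc k) / real n ^ Suc k = L.mean n k 0 / N n"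
    using sprob_pos
  proof eventually_elim
    case (elim n)
    have "closed_walks k 0 (Pow {0..<n}) = (\<lambda>\<tau>. (\<tau>, [])) ` {\<tau>. \<tau> \<subseteq> {0..<n} \<and> card \<tau> = Suc k}"
    proof (rule Set.set_eqI)
      fix w :: "nat set \<times> (nat set \<times> nat set) list"
      obtain \<tau> ws where w: "w = (\<tau>, ws)" by (rule prod.exhaust)
      have "Pow \<tau> \<subseteq> Pow {0..<n} \<longleftrightarrow> \<tau> \<subseteq> {0..<n}" by blast
      then show "w \<in> closed_walks k 0 (Pow {0..<n}) \<longleftrightarrow> w \<in> (\<lambda>\<tau>. (\<tau>, [])) ` {\<tau>. \<tau> \<subseteq> {0..<n} \<and> card \<tau> = Suc k}"
        by (cases ws) (simp_all add: w closed_walks_def image_iff conj_commute)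
    qed
    then have "L.mean n k 0 = (\<Sum>\<tau>\<in>{\<tau>. \<tau> \<subseteq> {0..<n} \<and> card \<tau> = Suc k}. L.cprob n (Pow \<tau>))"
      unfolding L.mean_eq by (simp add: sum.reindex inj_on_def weight_def support_def)
    also have "\<dots> = (\<Sum>\<tau>\<in>{\<tau>. \<tau> \<subseteq> {0..<n} \<and> card \<tau> = Suc k}. L.sprob n (Suc k))"
      by (rule sum.cong) (auto simp: L.cprob_Pow)
    also have "\<dots> = real (n choose Suc k) * L.sprob n (Suc k)"
      using n_subsets[of "{0..<n}" "Suc k"] by simp
    finally show ?case using elim by (simp add: L.face_scale_def)
  qed
  then show "(\<lambda>n. L.mean n k 0 / N n) \<longlonglongrightarrow> 1 / fact (Suc k)"
    by (rule Lim_transform_eventually[OF binomial_over_power_tendsto])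
qed

lemma abs_A_le: "\<bar>A m\<bar> \<le> (\<Prod>j<m. real (Suc (Suc k)) * (c + real (Suc k) + real j))"
proof (rule tendsto_le[OF _ _ tendsto_rabs[OF mean_tendsto]])
  show "(\<lambda>n. \<Prod>j<m. real (Suc (Suc k)) * (real n * rk (X n) k + real (Suc k) + real j))
      \<longlonglongrightarrow> (\<Prod>j<m. real (Suc (Suc k)) * (c + real (Suc k) + real j))"
    by (intro tendsto_prod tendsto_mult tendsto_add tendsto_const rk_lim)
  show "\<forall>\<^sub>F n in sequentially. \<bar>L.mean n k m / N n\<bar> \<le> (\<Prod>j<m. real (Suc (Suc k)) * (real n * rk (X n) k + real (Suc k) + real j))"
    using sprob_pos N_pos
  proof eventually_elim
    case (elim n)
    show ?case using L.abs_mean_le[OF elim(1), of m] elim(2) by (simp add: field_simps abs_divide)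
  qed
qed simp

end

section \<open>From walk sums to moments of the spectral measure\<close>

lemma prod_linear_le:
  fixes x :: real and b :: nat
  assumes "0 \<le> x" "x \<le> real b" "0 \<le> y"
  shows "(\<Prod>j<m. y * (x + real j)) \<le> (y * (real b + 1)) ^ m * fact m"
proof (induction m)
  case (Suc m)
  have "x + real m \<le> (real b + 1) * (real m + 1)"
  proof -
    have "(real b + 1) * (real m + 1) = real b * real m + real b + real m + 1" by (simp add: algebra_simps)
    moreover have "0 \<le> real b * real m" by simp
    ultimately show ?thesis using assms(2) by linarith
  qed
  then have "y * (x + real m) \<le> y * ((real b + 1) * (real m + 1))"
    using assms(3) by (rule mult_left_mono)
  then have "(\<Prod>j<m. y * (x + real j)) * (y * (x + real m)) \<le> ((y * (real b + 1)) ^ m * fact m) * (y * ((real b + 1) * (real m + 1)))"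
    by (rule mult_mono[OF Suc.IH]) (use assms in auto)
  then show ?case by (simp add: mult_ac add.commute)
qed simp

text \<open>Continuity of division at (A j, A 0), with one \<eta> for all j \<le> m.\<close>

lemma ratios_near:
  fixes A :: "nat \<Rightarrow> real"
  assumes A0: "A 0 > 0" and \<delta>: "\<delta> > 0"
  obtains \<eta> where "\<eta> > 0"
    "\<And>x j. \<lbrakk>\<And>i. i \<le> m \<Longrightarrow> \<bar>x i - A i\<bar> < \<eta>; j \<le> m\<rbrakk> \<Longrightarrow> x 0 > 0 \<and> \<bar>x j / x 0 - A j / A 0\<bar> < \<delta>"
proof -
  define S where "S = A 0 + (\<Sum>i\<le>m. \<bar>A i\<bar>)"
  have S: "S > 0" unfolding S_def using A0 by (intro add_pos_nonneg sum_nonneg) auto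
  \<comment> \<open>The first bound keeps x 0 above A 0 / 2. The second makes the cross difference
    of x j A 0 and A j x 0, which stays below \<eta> S, at most \<delta> (A 0)^2 / 2.\<close>
  define \<eta> where "\<eta> = min (A 0 / 2) (\<delta> * (A 0)\<^sup>2 / (2 * S))"
  have \<eta>: "\<eta> > 0" "\<eta> \<le> A 0 / 2" "\<eta> * (2 * S) \<le> \<delta> * (A 0)\<^sup>2"
  proof -
    show "\<eta> > 0" unfolding \<eta>_def using A0 \<delta> S by simp
    show "\<eta> \<le> A 0 / 2" by (simp add: \<eta>_def)
    have "\<eta> \<le> \<delta> * (A 0)\<^sup>2 / (2 * S)" by (simp add: \<eta>_def)
    then show "\<eta> * (2 * S) \<le> \<delta> * (A 0)\<^sup>2" using S by (simp add: pos_le_divide_eq)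
  qed
  show ?thesis
  proof (rule that[OF \<eta>(1)])
    fix x :: "nat \<Rightarrow> real" and j
    assume x: "\<And>i. i \<le> m \<Longrightarrow> \<bar>x i - A i\<bar> < \<eta>" and j: "j \<le> m"
    have x0: "x 0 > A 0 / 2" using x[of 0] \<eta>(2) by (simp add: abs_less_iff)
    then have pos: "x 0 > 0" using A0 by linarith
    have Aj: "A 0 + \<bar>A j\<bar> \<le> S"
      unfolding S_def using j by (intro add_left_mono member_le_sum) auto
    have "\<bar>x j * A 0 - A j * x 0\<bar> = \<bar>(x j - A j) * A 0 - A j * (x 0 - A 0)\<bar>" by (simp add: algebra_simps)
    also have "\<dots> \<le> \<bar>x j - A j\<bar> * A 0 + \<bar>A j\<bar> * \<bar>x 0 - A 0\<bar>"
      using abs_triangle_ineq4[of "(x j - A j) * A 0" "A j * (x 0 - A 0)"] A0 by (simp add: abs_mult)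
    also have "\<dots> < \<eta> * A 0 + \<eta> * \<bar>A j\<bar>"
    proof (rule add_less_le_mono)
      show "\<bar>x j - A j\<bar> * A 0 < \<eta> * A 0" using x[OF j] A0 by simp
      have "\<bar>A j\<bar> * \<bar>x 0 - A 0\<bar> \<le> \<bar>A j\<bar> * \<eta>" using x[of 0] by (intro mult_left_mono) auto
      then show "\<bar>A j\<bar> * \<bar>x 0 - A 0\<bar> \<le> \<eta> * \<bar>A j\<bar>" by (simp only: mult.commute)
    qed
    also have "\<dots> = \<eta> * (A 0 + \<bar>A j\<bar>)" by (simp only: distrib_left)
    also have "\<dots> \<le> \<eta> * S" using Aj \<eta>(1) by (intro mult_left_mono) auto
    also have "\<dots> \<le> \<delta> * (A 0 * (A 0 / 2))" using \<eta>(3) by (simp add: power2_eq_square)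
    also have "\<dots> \<le> \<delta> * (A 0 * x 0)" using x0 A0 \<delta> by (intro mult_left_mono) auto
    finally have *: "\<bar>x j * A 0 - A j * x 0\<bar> < \<delta> * (A 0 * x 0)" .
    have "x j / x 0 - A j / A 0 = (x j * A 0 - A j * x 0) / (A 0 * x 0)"
      using pos A0 by (simp add: field_simps)
    then have "\<bar>x j / x 0 - A j / A 0\<bar> = \<bar>x j * A 0 - A j * x 0\<bar> / (A 0 * x 0)"
      using pos A0 by (simp add: abs_mult)
    also have "\<dots> < \<delta>" using * pos A0 by (simp add: pos_divide_less_eq)
    finally show "x 0 > 0 \<and> \<bar>x j / x 0 - A j / A 0\<bar> < \<delta>" using pos by simp
  qed
qed

text \<open>A simplex of dimension at least k contains one of dimension exactly k, and Y is
  down-closed.\<close>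

lemma cdim_ge_iff:
  assumes Y: "subcomplex n Y"
  shows "cdim Y \<ge> int k \<longleftrightarrow> faces Y k \<noteq> {}"
proof -
  have fin: "finite Y" using Y finite_subset[of Y "Pow {0..<n}"] by (auto simp: subcomplex_def)
  have "{int (card \<sigma>) - 1 | \<sigma>. \<sigma> \<in> Y} = (\<lambda>\<sigma>. int (card \<sigma>) - 1) ` Y" by auto
  then have "cdim Y \<ge> int k \<longleftrightarrow> (\<exists>\<sigma>\<in>Y. int k \<le> int (card \<sigma>) - 1)"
    unfolding cdim_def using fin by (subst Max_ge_iff) auto
  also have "\<dots> \<longleftrightarrow> faces Y k \<noteq> {}"
  proof
    assume "\<exists>\<sigma>\<in>Y. int k \<le> int (card \<sigma>) - 1"
    then obtain \<sigma> where \<sigma>: "\<sigma> \<in> Y" "k + 1 \<le> card \<sigma>" by auto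
    obtain \<tau> where \<tau>: "\<tau> \<subseteq> \<sigma>" "card \<tau> = k + 1" by (rule obtain_subset_with_card_n[OF \<sigma>(2)])
    then have "\<tau> \<in> Y" using Y \<sigma>(1) unfolding subcomplex_def by blast
    then have "\<tau> \<in> faces Y k" using \<tau>(2) by (simp add: faces_def)
    then show "faces Y k \<noteq> {}" by blast
  next
    assume "faces Y k \<noteq> {}"
    then show "\<exists>\<sigma>\<in>Y. int k \<le> int (card \<sigma>) - 1" by (auto simp: faces_def intro!: bexI)
  qed
  finally show ?thesis .
qed

lemma walk_sum_0:
  assumes Y: "subcomplex n Y" shows "walk_sum k 0 Y = real (card (faces Y k))"
proof -
  have "closed_walks k 0 Y = (\<lambda>\<tau>. (\<tau>, [])) ` faces Y k"
  proof (rule Set.set_eqI)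
    fix w :: "nat set \<times> (nat set \<times> nat set) list"
    obtain \<tau> ws where w: "w = (\<tau>, ws)" by (rule prod.exhaust)
    have "Pow \<tau> \<subseteq> Y \<longleftrightarrow> \<tau> \<in> Y" using Y by (auto simp: subcomplex_def)
    then show "w \<in> closed_walks k 0 Y \<longleftrightarrow> w \<in> (\<lambda>\<tau>. (\<tau>, [])) ` faces Y k"
      by (cases ws) (simp_all add: w closed_walks_def faces_def image_iff conj_commute)
  qed
  then show ?thesis by (simp add: walk_sum_def sum.reindex inj_on_def weight_def)
qed

lemma esd_mem: "esd L \<in> borel_prob_measures"
  using real_distribution_esd[of L] by (simp add: borel_prob_measures_def real_distribution_def real_distribution_axioms_def)

context spatial_sequence begin

definition limit_moment :: "nat \<Rightarrow> real" where "limit_moment m = A m / A 0"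

text \<open>The integer b majorises c + k + 1, as \<open>prod_linear_le\<close> requires; the
  constant (k+1)! comes from dividing by \<open>A 0\<close>.\<close>

lemma limit_moment_bound:
  obtains K D where "D > 0" "\<And>m. \<bar>limit_moment m\<bar> \<le> K * D ^ m * fact m"
proof -
  obtain b :: nat where b: "c + real (Suc k) \<le> real b" using real_arch_simple by blast
  show ?thesis
  proof (rule that)
    show "real (Suc (Suc k)) * (real b + 1) > 0" by simp
    fix m
    have "\<bar>limit_moment m\<bar> = fact (Suc k) * \<bar>A m\<bar>" by (simp add: limit_moment_def A_0 abs_mult)
    also have "\<dots> \<le> fact (Suc k) * ((real (Suc (Suc k)) * (real b + 1)) ^ m * fact m)"
      using order_trans[OF abs_A_le[of m] prod_linear_le[OF _ b, of "real (Suc (Suc k))" m]] c_pos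
      by (intro mult_left_mono) auto
    finally show "\<bar>limit_moment m\<bar> \<le> fact (Suc k) * (real (Suc (Suc k)) * (real b + 1)) ^ m * fact m"
      by (simp only: mult.assoc)
  qed
qed

definition near_event :: "nat \<Rightarrow> real \<Rightarrow> nat set set set" where
  "near_event m \<delta> = {Y. faces Y k \<noteq> {} \<and> has_moments_near limit_moment m \<delta> (esd (up_laplacian Y k))}"

text \<open>By the union bound all walk sums of length at most m are close to their limits
  simultaneously. The one of length 0 is f_k, so its closeness to a positive limit also provides a
  k-face; in quotients of walk sums the normalisation N cancels.\<close>

lemma prob_near_event:
  assumes \<delta>: "\<delta> > 0"
  shows "(\<lambda>n. measure_pmf.prob (X n) (near_event m \<delta>)) \<longlonglongrightarrow> 1"
proof -
  obtain \<eta> where \<eta>: "\<eta> > 0"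
    "\<And>x j. \<lbrakk>\<And>i. i \<le> m \<Longrightarrow> \<bar>x i - A i\<bar> < \<eta>; j \<le> m\<rbrakk> \<Longrightarrow> x 0 > 0 \<and> \<bar>x j / x 0 - A j / A 0\<bar> < \<delta>"
    by (rule ratios_near[of A \<delta> m]) (use \<delta> A_0 in auto)
  define bad where "bad n j = {Y. \<bar>walk_sum k j Y / N n - A j\<bar> \<ge> \<eta>}" for n j
  have bad: "(\<lambda>n. 1 - (\<Sum>j\<le>m. measure_pmf.prob (X n) (bad n j))) \<longlonglongrightarrow> 1 - (\<Sum>j\<le>m. 0)"
    unfolding bad_def by (intro tendsto_diff tendsto_const tendsto_sum walk_sum_tendsto_in_prob \<eta>(1))
  show ?thesis
  proof (rule tendsto_sandwich[where h="\<lambda>_. 1"])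
    show "(\<lambda>n. 1 - (\<Sum>j\<le>m. measure_pmf.prob (X n) (bad n j))) \<longlonglongrightarrow> 1" using bad by simp
    show "\<forall>\<^sub>F n in sequentially. 1 - (\<Sum>j\<le>m. measure_pmf.prob (X n) (bad n j)) \<le> measure_pmf.prob (X n) (near_event m \<delta>)"
      using N_pos
    proof eventually_elim
      case (elim n)
      have near: "Y \<in> near_event m \<delta>" if Y: "Y \<in> set_pmf (X n)" and good: "Y \<notin> (\<Union>j\<le>m. bad n j)" for Y
      proof -
        have sub: "subcomplex n Y" by (rule L.set_pmf_subcomplex[OF Y])
        have fin: "finite Y" using sub finite_subset[of Y "Pow {0..<n}"] by (auto simp: subcomplex_def)
        have closed: "\<tau> \<in> Y" if "\<sigma> \<in> Y" "\<tau> \<subseteq> \<sigma>" for \<sigma> \<tau>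
          using sub that by (auto simp: subcomplex_def)
        have x: "\<bar>walk_sum k i Y / N n - A i\<bar> < \<eta>" if "i \<le> m" for i
        proof -
          have "Y \<notin> bad n i" using good that by blast
          then show ?thesis by (simp add: bad_def not_le)
        qed
        have r: "walk_sum k 0 Y / N n > 0 \<and> \<bar>(walk_sum k j Y / N n) / (walk_sum k 0 Y / N n) - A j / A 0\<bar> < \<delta>" if "j \<le> m" for j
          using \<eta>(2)[of "\<lambda>i. walk_sum k i Y / N n" j] x that by simp
        have "walk_sum k 0 Y > 0" using r[of 0] elim by (simp add: zero_less_divide_iff)
        then have ne: "faces Y k \<noteq> {}" unfolding walk_sum_0[OF sub] by auto
        have moments: "integrable (esd (up_laplacian Y k)) (\<lambda>x. x ^ j)"
          "(LINT x|esd (up_laplacian Y k). x ^ j) = (\<Sum>(\<tau>, ws)\<in>closed_walks k j Y. walk_weight \<tau> ws) / card (faces Y k)" for j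
          by (rule up_laplacian_esd_moments[OF fin _ ne], erule (1) closed)+
        have "\<bar>(LINT x|esd (up_laplacian Y k). x ^ j) - limit_moment j\<bar> < \<delta>" if "j \<le> m" for j
        proof -
          have "(LINT x|esd (up_laplacian Y k). x ^ j) = walk_sum k j Y / walk_sum k 0 Y"
            unfolding moments(2) walk_sum_0[OF sub] by (simp add: walk_sum_def weight_def case_prod_unfold)
          also have "\<dots> = (walk_sum k j Y / N n) / (walk_sum k 0 Y / N n)" using elim by simp
          finally show ?thesis using r[OF that] unfolding limit_moment_def by (simp only:)
        qed
        then show ?thesis unfolding near_event_def has_moments_near_def
          using ne real_distribution_esd moments(1) by blast
      qed
      have "measure_pmf.prob (X n) (- near_event m \<delta>) \<le> measure_pmf.prob (X n) (\<Union>j\<le>m. bad n j)"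
        by (rule measure_pmf.finite_measure_mono_AE) (use near in \<open>auto simp: AE_measure_pmf_iff\<close>)
      also have "\<dots> \<le> (\<Sum>j\<le>m. measure_pmf.prob (X n) (bad n j))"
        by (rule measure_pmf.finite_measure_subadditive_finite) auto
      finally show ?case
        using measure_pmf.prob_compl[of "near_event m \<delta>" "X n"] by (simp add: Compl_eq_Diff_UNIV)
    qed
  qed simp_all
qed

text \<open>An event of positive probability contains a realisation, and its spectral measure is the
  witness that \<open>moment_method\<close> asks for.\<close>

lemma near_event_exists:
  assumes "\<delta> > 0" shows "\<exists>\<nu>. has_moments_near limit_moment m \<delta> \<nu>"
proof -
  have "\<forall>\<^sub>F n in sequentially. measure_pmf.prob (X n) (near_event m \<delta>) > 0"
    by (rule order_tendstoD(1)[OF prob_near_event[OF assms]]) simp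
  then obtain n where "measure_pmf.prob (X n) (near_event m \<delta>) > 0" by (auto simp: eventually_sequentially)
  then have "near_event m \<delta> \<noteq> {}" by auto
  then show ?thesis by (auto simp: near_event_def)
qed

lemma prob_tendsto_1_mono:
  assumes "(\<lambda>n. measure_pmf.prob (X n) S) \<longlonglongrightarrow> 1" "S \<subseteq> T"
  shows "(\<lambda>n. measure_pmf.prob (X n) T) \<longlonglongrightarrow> 1"
proof (rule tendsto_sandwich[OF _ _ assms(1) tendsto_const])
  show "\<forall>\<^sub>F n in sequentially. measure_pmf.prob (X n) S \<le> measure_pmf.prob (X n) T"
    using assms(2) by (intro always_eventually allI measure_pmf.finite_measure_mono) auto
qed simp

lemma prob_tendsto_1_Int:
  assumes "(\<lambda>n. measure_pmf.prob (X n) S) \<longlonglongrightarrow> 1" "(\<lambda>n. measure_pmf.prob (X n) T) \<longlonglongrightarrow> 1"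
  shows "(\<lambda>n. measure_pmf.prob (X n) (S \<inter> T)) \<longlonglongrightarrow> 1"
proof (rule tendsto_sandwich[where h="\<lambda>_. 1"])
  show "(\<lambda>n. measure_pmf.prob (X n) S + measure_pmf.prob (X n) T - 1) \<longlonglongrightarrow> 1"
    using tendsto_diff[OF tendsto_add[OF assms] tendsto_const[of 1]] by simp
  show "\<forall>\<^sub>F n in sequentially. measure_pmf.prob (X n) S + measure_pmf.prob (X n) T - 1 \<le> measure_pmf.prob (X n) (S \<inter> T)"
  proof (intro always_eventually allI)
    fix n
    have "measure_pmf.prob (X n) (S \<union> T) = measure_pmf.prob (X n) S + measure_pmf.prob (X n) T - measure_pmf.prob (X n) (S \<inter> T)"
      by (rule measure_Un3) (simp_all add: measure_pmf.fmeasurable_eq_sets)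
    then show "measure_pmf.prob (X n) S + measure_pmf.prob (X n) T - 1 \<le> measure_pmf.prob (X n) (S \<inter> T)"
      using measure_pmf.prob_le_1[of "X n" "S \<union> T"] by linarith
  qed
qed simp_all

text \<open>Induction on the generation of an open set from the subbasis: subbasic sets are handled
  by \<open>moment_method\<close> and \<open>prob_near_event\<close>, intersections because two
  events of probability tending to 1 meet in such an event, unions by passing to one member that
  contains \<mu>.\<close>

lemma esd_converges:
  "\<exists>\<mu>\<in>borel_prob_measures. \<forall>U. openin weak_topology U \<and> \<mu> \<in> U \<longrightarrow>
     (\<lambda>n. measure_pmf.prob (X n) {Y. faces Y k \<noteq> {} \<and> esd (up_laplacian Y k) \<in> U}) \<longlonglongrightarrow> 1"
proof -
  obtain K D where KD: "D > 0" "\<And>m. \<bar>limit_moment m\<bar> \<le> K * D ^ m * fact m"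
    by (rule limit_moment_bound) blast
  show ?thesis
  proof (rule moment_method[OF KD])
    show "\<exists>\<nu>. has_moments_near limit_moment m \<delta> \<nu>" if "\<delta> > 0" for m \<delta>
      using that by (rule near_event_exists)
  next
    fix \<mu> :: "real measure"
    assume \<mu>: "real_distribution \<mu>"
      "\<And>f \<epsilon>. bounded (range f) \<Longrightarrow> continuous_on UNIV f \<Longrightarrow> \<epsilon> > 0 \<Longrightarrow>
         \<exists>m. \<exists>\<delta>>0. \<forall>\<nu>. has_moments_near limit_moment m \<delta> \<nu> \<longrightarrow> \<bar>(LINT x|\<nu>. (f x :: real)) - (LINT x|\<mu>. f x)\<bar> < \<epsilon>"
    define E where "E U = {Y. faces Y k \<noteq> {} \<and> esd (up_laplacian Y k) \<in> U}" for U
    have mem: "\<mu> \<in> borel_prob_measures"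
      using \<mu>(1) by (simp add: borel_prob_measures_def real_distribution_def real_distribution_axioms_def)
    have main: "\<mu> \<in> U \<Longrightarrow> (\<lambda>n. measure_pmf.prob (X n) (E U)) \<longlonglongrightarrow> 1" if "openin weak_topology U" for U
      using that unfolding weak_topology_def openin_topology_generated_by_iff
    proof (induction rule: generate_topology_on.induct)
      case (Int a b)
      have "E (a \<inter> b) = E a \<inter> E b" by (auto simp: E_def)
      then show ?case using Int prob_tendsto_1_Int by simp
    next
      case (UN K)
      then obtain a where a: "a \<in> K" "\<mu> \<in> a" by auto
      then show ?case using UN.IH[OF a] by (rule_tac prob_tendsto_1_mono[of "E a"]) (auto simp: E_def)
    next
      case (Basis s)
      then obtain f :: "real \<Rightarrow> real" and V where s: "s = {M \<in> borel_prob_measures. (\<integral>x. f x \<partial>M) \<in> V}"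
        and f: "bounded (range f)" "continuous_on UNIV f" "open V" by blast
      have "(\<integral>x. f x \<partial>\<mu>) \<in> V" using Basis.prems s by simp
      then obtain \<epsilon> where \<epsilon>: "\<epsilon> > 0" "\<And>y. dist y (\<integral>x. f x \<partial>\<mu>) < \<epsilon> \<Longrightarrow> y \<in> V"
        using f(3) unfolding open_dist by blast
      obtain m \<delta> where \<delta>: "\<delta> > 0" "\<And>\<nu>. has_moments_near limit_moment m \<delta> \<nu> \<Longrightarrow> \<bar>(LINT x|\<nu>. f x) - (LINT x|\<mu>. f x)\<bar> < \<epsilon>"
        using \<mu>(2)[OF f(1,2) \<epsilon>(1)] by blast
      have "near_event m \<delta> \<subseteq> E s"
      proof
        fix Y assume "Y \<in> near_event m \<delta>"
        then have Y: "faces Y k \<noteq> {}" "has_moments_near limit_moment m \<delta> (esd (up_laplacian Y k))"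
          by (simp_all add: near_event_def)
        have "(\<integral>x. f x \<partial>esd (up_laplacian Y k)) \<in> V"
          using \<delta>(2)[OF Y(2)] by (intro \<epsilon>(2)) (simp add: dist_real_def)
        then show "Y \<in> E s" using Y(1) esd_mem by (simp add: E_def s)
      qed
      then show ?case by (rule prob_tendsto_1_mono[OF prob_near_event[OF \<delta>(1)]])
    qed simp
    show ?thesis
      by (rule bexI[OF _ mem]) (use main in \<open>auto simp: E_def\<close>)
  qed
qed

end

section \<open>Conditioning on the empty simplex and the conclusion\<close>

lemma prob_cond_pmf:
  assumes "set_pmf p \<inter> S \<noteq> {}"
  shows "measure_pmf.prob (cond_pmf p S) B = measure_pmf.prob p (S \<inter> B) / measure_pmf.prob p S"
proof -
  have "emeasure (measure_pmf p) S \<noteq> 0" using assms by (rule emeasure_measure_pmf_not_zero)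
  then show ?thesis
    unfolding cond_pmf.rep_eq[OF assms] by (subst measure_uniform_measure) auto
qed

text \<open>Relabelling preserves the event that the empty simplex is present. For two nonempty
  subcomplexes all four complexes in the independence identity contain {}, so conditioning divides
  both sides by the same squared probability; if one of them is void, the two sides are the same
  product.\<close>

lemma spatial_law_cond:
  assumes r: "random_subcomplex n P" and h: "homogeneous n P" and s: "spatially_independent n P"
    and ne: "set_pmf P \<inter> {Y. {} \<in> Y} \<noteq> {}"
  shows "spatial_law n (cond_pmf P {Y. {} \<in> Y})"
proof
  let ?S = "{Y. {} \<in> Y} :: nat set set set" and ?P = "cond_pmf P {Y. {} \<in> Y}"
  show "random_subcomplex n ?P" using r by (auto simp: random_subcomplex_def set_cond_pmf[OF ne])
  show "{} \<in> Y" if "Y \<in> set_pmf ?P" for Y using that by (simp add: set_cond_pmf[OF ne])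
  show "homogeneous n ?P" unfolding homogeneous_def
  proof (intro allI impI)
    fix g assume g: "g permutes {0..<n}"
    let ?f = "\<lambda>X. (`) g ` X"
    have map: "map_pmf ?f P = P" using h g by (simp add: homogeneous_def)
    have vim: "?f -` ?S = ?S" by auto
    have "cond_pmf (map_pmf ?f P) ?S = map_pmf ?f (cond_pmf P (?f -` ?S))"
      by (rule cond_map_pmf) (use ne vim in simp)
    then show "map_pmf ?f ?P = ?P" unfolding map vim by (rule sym)
  qed
  show "spatially_independent n ?P" unfolding spatially_independent_def
  proof (intro allI impI)
    fix Y1 Y2 assume Y: "subcomplex n Y1" "subcomplex n Y2"
    have pr: "measure_pmf.prob ?P {X. Z \<subseteq> X} = measure_pmf.prob P {X. Z \<subseteq> X} / measure_pmf.prob P ?S" if "{} \<in> Z" for Z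
    proof -
      have "?S \<inter> {X. Z \<subseteq> X} = {X. Z \<subseteq> X}" using that by auto
      then show ?thesis by (simp add: prob_cond_pmf[OF ne])
    qed
    show "measure_pmf.prob ?P {X. Y1 \<union> Y2 \<subseteq> X} * measure_pmf.prob ?P {X. Y1 \<inter> Y2 \<subseteq> X}
        = measure_pmf.prob ?P {X. Y1 \<subseteq> X} * measure_pmf.prob ?P {X. Y2 \<subseteq> X}"
    proof (cases "Y1 = {} \<or> Y2 = {}")
      case True
      then show ?thesis by auto
    next
      case False
      then have e: "{} \<in> Y1" "{} \<in> Y2" using Y by (auto simp: subcomplex_def)
      then have u: "{} \<in> Y1 \<union> Y2" "{} \<in> Y1 \<inter> Y2" by auto
      have prod: "measure_pmf.prob P {X. Y1 \<union> Y2 \<subseteq> X} * measure_pmf.prob P {X. Y1 \<inter> Y2 \<subseteq> X}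
        = measure_pmf.prob P {X. Y1 \<subseteq> X} * measure_pmf.prob P {X. Y2 \<subseteq> X}"
        using s Y unfolding spatially_independent_def by blast
      show ?thesis unfolding pr[OF e(1)] pr[OF e(2)] pr[OF u(1)] pr[OF u(2)] times_divide_times_eq prod ..
    qed
  qed
qed

text \<open>A placeholder for the indices n at which X_n is almost surely void, so that conditioning
  is impossible; \<open>spatial_sequence\<close> asks for a law at every n.\<close>

lemma spatial_law_return: "spatial_law n (return_pmf {{}})"
proof
  show "random_subcomplex n (return_pmf {{}})" by (simp add: random_subcomplex_def subcomplex_def)
  show "homogeneous n (return_pmf {{}})" by (simp add: homogeneous_def)
  show "spatially_independent n (return_pmf {{}})"
    by (auto simp: spatially_independent_def indicator_def)
qed simp

theorem theorem5p1:
  fixes k :: nat and c :: real and X :: "nat \<Rightarrow> nat set set pmf"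
  assumes "c > 0"
    and "\<And>n. random_subcomplex n (X n)"
    and "\<And>n. homogeneous n (X n)"
    and "\<And>n. spatially_independent n (X n)"
    and "filterlim (\<lambda>n. real n ^ (k + 1) * qk (X n) k) at_top sequentially"
    and "(\<lambda>n. real n * rk (X n) k) \<sim>[sequentially] (\<lambda>_. c)"
  shows "\<exists>\<mu> \<in> borel_prob_measures.
           \<forall>U. openin weak_topology U \<and> \<mu> \<in> U \<longrightarrow>
             (\<lambda>n. measure_pmf.prob (X n) {Y. cdim Y \<ge> int k \<and> esd (up_laplacian Y k) \<in> U}
                  / measure_pmf.prob (X n) {Y. cdim Y \<ge> int k}) \<longlonglongrightarrow> 1"
proof -
  let ?S = "{Y. {} \<in> Y} :: nat set set set"
  define X' where "X' n = (if set_pmf (X n) \<inter> ?S \<noteq> {} then cond_pmf (X n) ?S else return_pmf {{}})" for n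
  have sub: "subcomplex n Y" if "Y \<in> set_pmf (X n)" for n Y
    using assms(2) that by (auto simp: random_subcomplex_def)
  have empty: "{} \<in> Y" if "Y \<in> set_pmf (X n)" "\<tau> \<in> Y" for n Y \<tau>
    using sub[OF that(1)] that(2) by (auto simp: subcomplex_def)
  \<comment> \<open>An event that excludes the void complex almost surely forces the empty simplex
    to be present, so conditioning merely rescales its probability, by a factor common to all such
    events.\<close>
  have prob': "measure_pmf.prob (X' n) B = measure_pmf.prob (X n) B / measure_pmf.prob (X n) ?S"
    if ne: "set_pmf (X n) \<inter> ?S \<noteq> {}" and B: "\<And>Y. Y \<in> set_pmf (X n) \<Longrightarrow> Y \<in> B \<Longrightarrow> Y \<noteq> {}" for n B
  proof -
    have "measure_pmf.prob (X n) (?S \<inter> B) = measure_pmf.prob (X n) B"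
    proof (rule measure_pmf.finite_measure_eq_AE)
      show "AE Y in measure_pmf (X n). (Y \<in> ?S \<inter> B) = (Y \<in> B)"
        unfolding AE_measure_pmf_iff
      proof
        fix Y assume Y: "Y \<in> set_pmf (X n)"
        show "(Y \<in> ?S \<inter> B) = (Y \<in> B)" using B[OF Y] empty[OF Y] by blast
      qed
    qed auto
    then show ?thesis using ne by (simp add: X'_def prob_cond_pmf)
  qed
  have ne: "\<forall>\<^sub>F n in sequentially. set_pmf (X n) \<inter> ?S \<noteq> {}"
  proof -
    have "\<forall>\<^sub>F n in sequentially. real n ^ (k + 1) * qk (X n) k > 0"
      using assms(5) by (simp add: filterlim_at_top_dense)
    then show ?thesis
    proof eventually_elim
      case (elim n)
      then have "measure_pmf.prob (X n) {X. {0..k} \<in> X} \<noteq> 0" unfolding qk_def by auto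
      then have "set_pmf (X n) \<inter> {X. {0..k} \<in> X} \<noteq> {}"
        by (metis measure_Int_set_pmf inf_commute measure_empty)
      then show ?case using empty by blast
    qed
  qed
  have p0: "measure_pmf.prob (X n) ?S > 0" if ne0: "set_pmf (X n) \<inter> ?S \<noteq> {}" for n
  proof -
    obtain Y where "Y \<in> set_pmf (X n)" "Y \<in> ?S" using ne0 by blast
    then show ?thesis by (rule measure_pmf_posI)
  qed
  interpret spatial_sequence X' k c
  proof (rule spatial_sequence.intro)
    show "spatial_law n (X' n)" for n
      unfolding X'_def using spatial_law_cond[OF assms(2-4)] spatial_law_return by simp
    show "c > 0" by fact
    \<comment> \<open>Division by a probability can only enlarge q_k, so the divergence is
      inherited.\<close>
    show "filterlim (\<lambda>n. real n ^ Suc k * qk (X' n) k) at_top sequentially"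
    proof (rule filterlim_at_top_mono[OF assms(5)])
      show "\<forall>\<^sub>F n in sequentially. real n ^ (k + 1) * qk (X n) k \<le> real n ^ Suc k * qk (X' n) k"
        using ne
      proof eventually_elim
        case (elim n)
        have "qk (X' n) k = qk (X n) k / measure_pmf.prob (X n) ?S"
          unfolding qk_def by (rule prob'[OF elim]) auto
        moreover have "qk (X n) k * measure_pmf.prob (X n) ?S \<le> qk (X n) k"
          by (rule mult_left_le) (auto simp: qk_def)
        ultimately have "qk (X n) k \<le> qk (X' n) k" using p0[OF elim] by (simp add: pos_le_divide_eq)
        then show ?case by (simp add: mult_left_mono)
      qed
    qed
    have "(\<lambda>n. real n * rk (X n) k) \<longlonglongrightarrow> c"
      using tendsto_asymp_equiv_cong[OF assms(6)] by simp
    \<comment> \<open>r_k is a quotient of two probabilities rescaled by the same factor.\<close>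
    moreover have "\<forall>\<^sub>F n in sequentially. real n * rk (X n) k = real n * rk (X' n) k"
      using ne
    proof eventually_elim
      case (elim n)
      have "qk (X' n) k = qk (X n) k / measure_pmf.prob (X n) ?S"
        unfolding qk_def by (rule prob'[OF elim]) auto
      moreover have "measure_pmf.prob (X' n) {X. {0..Suc k} \<in> X \<and> {0..k} \<in> X}
          = measure_pmf.prob (X n) {X. {0..Suc k} \<in> X \<and> {0..k} \<in> X} / measure_pmf.prob (X n) ?S"
        by (rule prob'[OF elim]) auto
      ultimately have "rk (X' n) k = rk (X n) k" using p0[OF elim] by (simp add: rk_def)
      then show ?case by simp
    qed
    ultimately show "(\<lambda>n. real n * rk (X' n) k) \<longlonglongrightarrow> c" by (rule Lim_transform_eventually)
  qed
  obtain \<mu> where \<mu>: "\<mu> \<in> borel_prob_measures"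
    "\<And>U. openin weak_topology U \<Longrightarrow> \<mu> \<in> U \<Longrightarrow>
       (\<lambda>n. measure_pmf.prob (X' n) {Y. faces Y k \<noteq> {} \<and> esd (up_laplacian Y k) \<in> U}) \<longlonglongrightarrow> 1"
    using esd_converges by blast
  show ?thesis
  proof (rule bexI[OF _ \<mu>(1)], intro allI impI)
    fix U assume U: "openin weak_topology U \<and> \<mu> \<in> U"
    let ?F = "{Y. faces Y k \<noteq> {}}" and ?E = "{Y. faces Y k \<noteq> {} \<and> esd (up_laplacian Y k) \<in> U}"
    have E: "(\<lambda>n. measure_pmf.prob (X' n) ?E) \<longlonglongrightarrow> 1" using \<mu>(2) U by blast
    then have F: "(\<lambda>n. measure_pmf.prob (X' n) ?F) \<longlonglongrightarrow> 1" by (rule prob_tendsto_1_mono) auto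
    \<comment> \<open>Under the conditioned laws both probabilities tend to 1. In their quotient the
      rescaling factor cancels, which leaves the conditional probability given dim X_n \<ge> k under
      the original law.\<close>
    have "(\<lambda>n. measure_pmf.prob (X' n) ?E / measure_pmf.prob (X' n) ?F) \<longlonglongrightarrow> 1 / 1"
      by (intro tendsto_divide E F) simp
    moreover have "\<forall>\<^sub>F n in sequentially. measure_pmf.prob (X' n) ?E / measure_pmf.prob (X' n) ?F
        = measure_pmf.prob (X n) {Y. cdim Y \<ge> int k \<and> esd (up_laplacian Y k) \<in> U} / measure_pmf.prob (X n) {Y. cdim Y \<ge> int k}"
      using ne
    proof eventually_elim
      case (elim n)
      have "measure_pmf.prob (X n) {Y. cdim Y \<ge> int k \<and> esd (up_laplacian Y k) \<in> U} = measure_pmf.prob (X n) ?E"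
        by (rule measure_pmf.finite_measure_eq_AE) (auto simp: AE_measure_pmf_iff cdim_ge_iff[OF sub])
      moreover have "measure_pmf.prob (X n) {Y. cdim Y \<ge> int k} = measure_pmf.prob (X n) ?F"
        by (rule measure_pmf.finite_measure_eq_AE) (auto simp: AE_measure_pmf_iff cdim_ge_iff[OF sub])
      moreover have "measure_pmf.prob (X' n) ?E = measure_pmf.prob (X n) ?E / measure_pmf.prob (X n) ?S"
        by (rule prob'[OF elim]) (auto simp: faces_def)
      moreover have "measure_pmf.prob (X' n) ?F = measure_pmf.prob (X n) ?F / measure_pmf.prob (X n) ?S"
        by (rule prob'[OF elim]) (auto simp: faces_def)
      ultimately show ?case using p0[OF elim] by simp
    qed
    ultimately show "(\<lambda>n. measure_pmf.prob (X n) {Y. cdim Y \<ge> int k \<and> esd (up_laplacian Y k) \<in> U}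
                  / measure_pmf.prob (X n) {Y. cdim Y \<ge> int k}) \<longlonglongrightarrow> 1"
      by (simp add: Lim_transform_eventually)
  qed
qed

end
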